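(* Let $A$ be an abelian variety of complex dimension $n$ and $N$ a negative line bundle on $A$. Let $h$, $r$, $\mathcal D_k$ ($k\ge 0$), the Bergman-type metric $g$ on $\mathcal D_0$, and the Calabi-ansatz metric $\omega$ on $\mathcal D_0$ (for the Calabi–Yau manifold $M=A$ and the line bundle $L=N$) be as defined in the context. Then $g$ and $\omega$ coincide; that is, the Kähler form of $g$ is $$\omega=-(n+2)\sqrt{-1}\,\partial\bar\partial\log|\log r| .$$
   Context: A holomorphic line bundle is negative if its dual is ample. Setup. Write $A=\mathbb C^n/\Gamma$. Choose a $\mathbb Z$-basis $\lambda_1,\dots,\lambda_{2n}$ of the lattice $\Gamma$, with dual real coordinates $x_1,\dots,x_{2n}$, such that $c_1(N)=\sum_{\alpha=1}^n\delta_\alpha\,dx_\alpha\wedge dx_{n+\alpha}$ with $\delta_\alpha$ positive integers, and use the complex basis $e_\alpha=\delta_\alpha^{-1}\lambda_\alpha$ ($1\le\alpha\le n$) of $\mathbb C^n$, with complex coordinates $z=(z_1,\dots,z_n)$. In these coordinates the period matrix is $(\Delta_\delta,Z)$ with $\Delta_\delta=\mathrm{diag}(\delta_1,\dots,\delta_n)$ and $Z=X-\sqrt{-1}\,Y$, where $X,Y$ are real symmetric and $Y$ is positive definite; put $W=(W_{\alpha\beta})=Y^{-1}$. The pullback of $N$ to $\mathbb C^n$ is trivialized so that $N=(\mathbb C\times\mathbb C^n)/\Gamma$, with points $(w,z)$, where $\lambda_\alpha$ acts by $(w,z)\mapsto(w,z+\lambda_\alpha)$ and $\lambda_{n+\alpha}$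 acts by $(w,z)\mapsto(e^{-2\pi i(z_\alpha-t_\alpha)}w,\,z+\lambda_{n+\alpha})$, $1\le\alpha\le n$, for constants $t_\alpha\in\mathbb C$ determined by $N$. Put $$h(z)=\exp\Big(-\tfrac{\pi}{2}\sum_{\alpha,\beta}W_{\alpha\beta}(z_\alpha-\bar z_\alpha+iY_{\alpha\alpha}-t_\alpha+\bar t_\alpha)(z_\beta-\bar z_\beta+iY_{\beta\beta}-t_\beta+\bar t_\beta)\Big).$$ The function $r=|w|^2h(z)$ is $\Gamma$-invariant, so it is the squared norm function of a Hermitian metric on $N$. For $k\ge0$ let $\mathcal D_k=\{0<r<e^{-k}\}\subset N$. After contraction of the zero section of $N$ to a point $o$, $\mathcal D_k$ is a punctured neighborhood of $o$. The metric $g$ (via the ball). Let $\mathcal H_0=\{(u,z)\in\mathbb C\times\mathbb C^n:\ -\operatorname{Im}u+\log h(z)<0\}$. It is biholomorphic to the unit ball $\mathbb B^{n+1}$, and $(u,z)\mapsto[(e^{iu/2},z)]$ is a holomorphic covering $\mathcal H_0\to\mathcal D_0$ whose deck transformations are automorphisms of $\mathcal H_0$. The metric $g$ on $\mathcal D_0$ is the one whose pullback to $\mathcal H_0$ is the Bergman metric of $\mathcal H_0$, i.e. the metric with Kähler form $\sqrt{-1}\,\partial\bar\partial\log K$, where $K$ is the Bergman kernel of $\mathcal H_0$ on the diagonal. The metric $\omega$ (via the Calabi ansatz). For a Calabi–Yau manifold $M$ of dimension $n$ with negative line bundle $L$, take a Hermitian metric on $L$, with squared norm function $r$ on the total space (locally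 $r=a(z)|\eta|^2$, $\eta$ the fiber coordinate), such that $\omega_M=\sqrt{-1}\,\partial\bar\partial\log a$ is a Ricci-flat Kähler form on $M$. With $s=\log r<0$, the Calabi-ansatz metric on $\{0<r<1\}$ is $\omega=\omega_M+\sqrt{-1}\,\partial\bar\partial\rho$ with $\rho=-(n+2)\log|s|-s$. For $M=A$, $L=N$ the Hermitian metric used is the one above, $a=h$. *)

theory Defs
  imports "HOL-Analysis.Analysis"
begin

section \<open>Complex calculus in several variables\<close>

text \<open>A real normed vector space with a complex structure \<open>J\<close>; the instances below give the
  standard one on \<open>\<complex>\<close>, on products and on \<open>\<complex>\<close>-vectors, in particular on
  \<open>\<complex> \<times> \<complex>\<^sup>n\<close>.\<close>

class complex_structure = real_normed_vector +
  fixes J :: "'a \<Rightarrow> 'a"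
  assumes J_add: "J (x + y) = J x + J y"
    and J_scaleR: "J (c *\<^sub>R x) = c *\<^sub>R J x"
    and J_J: "J (J x) = - x"

instantiation complex :: complex_structure
begin
definition J_complex :: "complex \<Rightarrow> complex" where "J_complex x = \<i> * x"
instance
  by standard (simp_all add: J_complex_def distrib_left)
end

instantiation prod :: (complex_structure, complex_structure) complex_structure
begin
definition J_prod :: "'a \<times> 'b \<Rightarrow> 'a \<times> 'b" where "J_prod x = (J (fst x), J (snd x))"
instance
  by standard (simp_all add: J_prod_def J_add J_scaleR J_J uminus_prod_def)
end

instantiation vec :: (complex_structure, finite) complex_structure
begin
definition J_vec :: "'a ^ 'b \<Rightarrow> 'a ^ 'b" where "J_vec x = (\<chi> i. J (x $ i))"
instance
  by standard (simp_all add: J_vec_def vec_eq_iff J_add J_scaleR J_J)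
end

definition holo_on :: "'a::complex_structure set \<Rightarrow> ('a \<Rightarrow> complex) \<Rightarrow> bool" where
  "holo_on S f \<longleftrightarrow>
     (\<forall>p\<in>S. \<exists>D. (f has_derivative D) (at p) \<and> (\<forall>v. D (J v) = \<i> * D v))"

text \<open>The \<open>(1,0)\<close>- and \<open>(0,1)\<close>-parts of the differential of \<open>f\<close> at \<open>p\<close>, evaluated on the real
  tangent vector \<open>v\<close>.\<close>

definition del :: "('a::complex_structure \<Rightarrow> complex) \<Rightarrow> 'a \<Rightarrow> 'a \<Rightarrow> complex" where
  "del f p v = (frechet_derivative f (at p) v - \<i> * frechet_derivative f (at p) (J v)) / 2"

definition delbar :: "('a::complex_structure \<Rightarrow> complex) \<Rightarrow> 'a \<Rightarrow> 'a \<Rightarrow> complex" where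
  "delbar f p v = (frechet_derivative f (at p) v + \<i> * frechet_derivative f (at p) (J v)) / 2"

text \<open>The \<open>2\<close>-form \<open>\<surd>-1 \<partial>\<partial>bar f\<close>.  For a \<open>(0,1)\<close>-form \<open>\<beta> = \<Sum> b\<^sub>k dzbar\<^sub>k\<close> one has
  \<open>\<partial>\<beta> (v, w) = \<partial>(\<beta>(w))(v) - \<partial>(\<beta>(v))(w)\<close> for constant vector fields \<open>v, w\<close>, with
  \<open>dz \<and> dzbar (v, w) = dz(v) dzbar(w) - dz(w) dzbar(v)\<close>.\<close>

definition i_ddbar :: "('a::complex_structure \<Rightarrow> real) \<Rightarrow> 'a \<Rightarrow> 'a \<Rightarrow> 'a \<Rightarrow> complex" where
  "i_ddbar f p v w =
     \<i> * (del (\<lambda>q. delbar (\<lambda>x. complex_of_real (f x)) q w) p v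
        - del (\<lambda>q. delbar (\<lambda>x. complex_of_real (f x)) q v) p w)"

definition pullback ::
  "('a::real_normed_vector \<Rightarrow> 'b::real_normed_vector) \<Rightarrow> ('b \<Rightarrow> 'b \<Rightarrow> 'b \<Rightarrow> 'c) \<Rightarrow> 'a \<Rightarrow> 'a \<Rightarrow> 'a \<Rightarrow> 'c"
  where
  "pullback \<phi> \<eta> p v w =
     \<eta> (\<phi> p) (frechet_derivative \<phi> (at p) v) (frechet_derivative \<phi> (at p) w)"

text \<open>A Hermitian metric is given by its underlying \<open>J\<close>-invariant Riemannian metric.\<close>

definition hermitian_metric_on ::
  "'a::complex_structure set \<Rightarrow> ('a \<Rightarrow> 'a \<Rightarrow> 'a \<Rightarrow> real) \<Rightarrow> bool" where
  "hermitian_metric_on S g \<longleftrightarrow>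
     (\<forall>p\<in>S. bilinear (g p) \<and> (\<forall>v w. g p v w = g p w v) \<and>
            (\<forall>v w. g p (J v) (J w) = g p v w) \<and> (\<forall>v. v \<noteq> 0 \<longrightarrow> 0 < g p v v))"

definition kaehler_form ::
  "('a::complex_structure \<Rightarrow> 'a \<Rightarrow> 'a \<Rightarrow> real) \<Rightarrow> 'a \<Rightarrow> 'a \<Rightarrow> 'a \<Rightarrow> complex" where
  "kaehler_form g p v w = complex_of_real (g p (J v) w)"


section \<open>The Bergman kernel\<close>

definition bergman_space ::
  "'a::{complex_structure, euclidean_space} set \<Rightarrow> ('a \<Rightarrow> complex) set" where
  "bergman_space D =
     {f. holo_on D f \<and> set_integrable lborel D (\<lambda>x. (cmod (f x))\<^sup>2)}"

text \<open>\<open>bergman_kernel D x y\<close> is the value at \<open>x\<close> of the element of the Bergman space that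
  represents evaluation at \<open>y\<close>.\<close>

definition bergman_kernel ::
  "'a::{complex_structure, euclidean_space} set \<Rightarrow> 'a \<Rightarrow> 'a \<Rightarrow> complex" where
  "bergman_kernel D x y =
     (THE c. \<exists>k\<in>bergman_space D.
        (\<forall>f\<in>bergman_space D. f y = (LINT \<xi>:D|lborel. f \<xi> * cnj (k \<xi>))) \<and> c = k x)"


section \<open>Line bundles on complex tori\<close>

definition lattice_basis ::
  "'a::euclidean_space set \<Rightarrow> ('i::finite \<Rightarrow> 'a) \<Rightarrow> bool" where
  "lattice_basis \<Gamma> b \<longleftrightarrow>
     inj b \<and> independent (range b) \<and> span (range b) = UNIV \<and>
     \<Gamma> = {\<Sum>i\<in>UNIV. real_of_int (k i) *\<^sub>R b i |k. True}"

text \<open>A line bundle on \<open>\<complex>\<^sup>n / \<Gamma>\<close> whose pullback to \<open>\<complex>\<^sup>n\<close> is trivialized is given by a factor of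
  automorphy \<open>e\<close>: it is the quotient of \<open>\<complex> \<times> \<complex>\<^sup>n\<close> by the action
  \<open>\<gamma> (w, z) = (e \<gamma> z w, z + \<gamma>)\<close> of \<open>\<Gamma>\<close>.  Only the values \<open>e \<gamma>\<close> with \<open>\<gamma> \<in> \<Gamma>\<close> matter.\<close>

type_synonym 'n factor = "complex^'n \<Rightarrow> complex^'n \<Rightarrow> complex"

definition factor_of_automorphy :: "(complex^'n) set \<Rightarrow> 'n factor \<Rightarrow> bool" where
  "factor_of_automorphy \<Gamma> e \<longleftrightarrow>
     (\<forall>\<gamma>\<in>\<Gamma>. holo_on UNIV (e \<gamma>) \<and> (\<forall>z. e \<gamma> z \<noteq> 0)) \<and>
     (\<forall>\<gamma>\<in>\<Gamma>. \<forall>\<mu>\<in>\<Gamma>. \<forall>z. e (\<gamma> + \<mu>) z = e \<gamma> (z + \<mu>) * e \<mu> z)"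

definition act :: "'n factor \<Rightarrow> complex^'n \<Rightarrow> complex \<times> (complex^'n) \<Rightarrow> complex \<times> (complex^'n)" where
  "act e \<gamma> p = (e \<gamma> (snd p) * fst p, snd p + \<gamma>)"

definition bundle_proj ::
  "(complex^'n) set \<Rightarrow> 'n factor \<Rightarrow> complex \<times> (complex^'n) \<Rightarrow> (complex \<times> (complex^'n)) set" where
  "bundle_proj \<Gamma> e p = {act e \<gamma> p |\<gamma>. \<gamma> \<in> \<Gamma>}"

text \<open>Global holomorphic sections of the \<open>m\<close>-th power.\<close>

definition sections_power ::
  "(complex^'n) set \<Rightarrow> 'n factor \<Rightarrow> nat \<Rightarrow> (complex^'n \<Rightarrow> complex) set" where
  "sections_power \<Gamma> e m =
     {\<theta>. holo_on UNIV \<theta> \<and> (\<forall>\<gamma>\<in>\<Gamma>. \<forall>z. \<theta> (z + \<gamma>) = e \<gamma> z ^ m * \<theta> z)}"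

text \<open>Some positive power is very ample: its global sections have no base points, separate the
  points of \<open>\<complex>\<^sup>n / \<Gamma>\<close> and separate tangent vectors, so they define a projective embedding.\<close>

definition ample :: "(complex^'n) set \<Rightarrow> 'n factor \<Rightarrow> bool" where
  "ample \<Gamma> e \<longleftrightarrow>
     (\<exists>m\<ge>1.
        (\<forall>z. \<exists>\<theta>\<in>sections_power \<Gamma> e m. \<theta> z \<noteq> 0) \<and>
        (\<forall>z z'. z - z' \<notin> \<Gamma> \<longrightarrow> (\<exists>\<theta>\<in>sections_power \<Gamma> e m. \<theta> z = 0 \<and> \<theta> z' \<noteq> 0)) \<and>
        (\<forall>z v. v \<noteq> 0 \<longrightarrow>
           (\<exists>\<theta>\<in>sections_power \<Gamma> e m. \<theta> z = 0 \<and> frechet_derivative \<theta> (at z) v \<noteq> 0)))"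

definition dual_factor :: "'n factor \<Rightarrow> 'n factor" where
  "dual_factor e = (\<lambda>\<gamma> z. inverse (e \<gamma> z))"

definition negative_bundle :: "(complex^'n) set \<Rightarrow> 'n factor \<Rightarrow> bool" where
  "negative_bundle \<Gamma> e \<longleftrightarrow> ample \<Gamma> (dual_factor e)"

text \<open>\<open>c1_pairing e \<gamma> \<mu> k\<close>: the alternating integral form on the lattice given by the first Chern
  class takes the value \<open>k\<close> on \<open>(\<gamma>, \<mu>)\<close>.  The sign is the one for which \<open>c\<^sub>1\<close> is represented by
  \<open>\<surd>-1 / (2\<pi>)\<close> times the curvature: \<open>e \<lambda>\<^sub>\<alpha> = 1\<close>, \<open>e \<lambda>\<^sub>n\<^sub>+\<^sub>\<alpha> = exp (-2\<pi>i z\<^sub>\<alpha>)\<close> with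
  \<open>\<lambda>\<^sub>\<alpha> = \<delta>\<^sub>\<alpha> e\<^sub>\<alpha>\<close> have \<open>c\<^sub>1 = \<Sum> \<delta>\<^sub>\<alpha> dx\<^sub>\<alpha> \<and> dx\<^sub>n\<^sub>+\<^sub>\<alpha>\<close>.\<close>

definition c1_pairing :: "'n factor \<Rightarrow> complex^'n \<Rightarrow> complex^'n \<Rightarrow> int \<Rightarrow> bool" where
  "c1_pairing e \<gamma> \<mu> k \<longleftrightarrow>
     (\<exists>f g. holo_on UNIV f \<and> holo_on UNIV g \<and>
        (\<forall>z. e \<gamma> z = exp (2 * of_real pi * \<i> * f z)) \<and>
        (\<forall>z. e \<mu> z = exp (2 * of_real pi * \<i> * g z)) \<and>
        (\<forall>z. f (z + \<mu>) + g z - g (z + \<gamma>) - f z = of_int k))"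

text \<open>The values of \<open>\<Sum> \<delta>\<^sub>\<alpha> dx\<^sub>\<alpha> \<and> dx\<^sub>n\<^sub>+\<^sub>\<alpha>\<close> on pairs of basis vectors; \<open>Inl \<alpha>\<close> and \<open>Inr \<alpha>\<close> stand for
  the indices \<open>\<alpha>\<close> and \<open>n + \<alpha>\<close>.\<close>

fun elementary_form :: "('n \<Rightarrow> nat) \<Rightarrow> 'n + 'n \<Rightarrow> 'n + 'n \<Rightarrow> int" where
  "elementary_form \<delta> (Inl a) (Inr b) = (if a = b then int (\<delta> a) else 0)"
| "elementary_form \<delta> (Inr a) (Inl b) = (if a = b then - int (\<delta> a) else 0)"
| "elementary_form \<delta> (Inl a) (Inl b) = 0"
| "elementary_form \<delta> (Inr a) (Inr b) = 0"


section \<open>Hermitian metrics on line bundles and punctured disc bundles\<close>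

text \<open>\<open>a\<close> is the squared norm of the frame of the trivialization over \<open>\<complex>\<^sup>n\<close>.\<close>

definition sq_norm :: "(complex^'n \<Rightarrow> real) \<Rightarrow> complex \<times> (complex^'n) \<Rightarrow> real" where
  "sq_norm a p = (cmod (fst p))\<^sup>2 * a (snd p)"

definition bundle_metric :: "(complex^'n) set \<Rightarrow> 'n factor \<Rightarrow> (complex^'n \<Rightarrow> real) \<Rightarrow> bool" where
  "bundle_metric \<Gamma> e a \<longleftrightarrow>
     (\<forall>z. 0 < a z) \<and> (\<forall>\<gamma>\<in>\<Gamma>. \<forall>p. sq_norm a (act e \<gamma> p) = sq_norm a p)"

definition disc_bundle ::
  "(complex^'n) set \<Rightarrow> 'n factor \<Rightarrow> (complex^'n \<Rightarrow> real) \<Rightarrow> real \<Rightarrow> (complex \<times> (complex^'n)) set set"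
  where
  "disc_bundle \<Gamma> e a k =
     bundle_proj \<Gamma> e ` {p. 0 < sq_norm a p \<and> sq_norm a p < exp (- k)}"

text \<open>Tensors on a subset \<open>U\<close> of the quotient \<open>(\<complex> \<times> \<complex>\<^sup>n) / \<Gamma>\<close> are given by \<open>\<Gamma>\<close>-invariant tensors
  on the preimage of \<open>U\<close>.\<close>

definition preim ::
  "(complex^'n) set \<Rightarrow> 'n factor \<Rightarrow> (complex \<times> (complex^'n)) set set \<Rightarrow> (complex \<times> (complex^'n)) set"
  where
  "preim \<Gamma> e U = {p. bundle_proj \<Gamma> e p \<in> U}"

definition quotient_metric_on ::
  "(complex^'n) set \<Rightarrow> 'n factor \<Rightarrow> (complex \<times> (complex^'n)) set set \<Rightarrow>
   (complex \<times> (complex^'n) \<Rightarrow> complex \<times> (complex^'n) \<Rightarrow> complex \<times> (complex^'n) \<Rightarrow> real) \<Rightarrow> bool" where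
  "quotient_metric_on \<Gamma> e U g \<longleftrightarrow>
     hermitian_metric_on (preim \<Gamma> e U) g \<and>
     (\<forall>\<gamma>\<in>\<Gamma>. \<forall>p\<in>preim \<Gamma> e U. \<forall>v w. pullback (act e \<gamma>) g p v w = g p v w)"


section \<open>The two metrics\<close>

definition siegel_domain :: "(complex^'n \<Rightarrow> real) \<Rightarrow> (complex \<times> (complex^'n)) set" where
  "siegel_domain a = {(u, z). - Im u + ln (a z) < 0}"

text \<open>The lift to \<open>\<complex> \<times> \<complex>\<^sup>n\<close> of the covering of the punctured disc bundle.\<close>

definition cover_map :: "complex \<times> (complex^'n) \<Rightarrow> complex \<times> (complex^'n)" where
  "cover_map p = (exp (\<i> * fst p / 2), snd p)"

definition bergman_type_metric ::
  "(complex^'n) set \<Rightarrow> 'n factor \<Rightarrow> (complex^'n \<Rightarrow> real) \<Rightarrow>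
   (complex \<times> (complex^'n) \<Rightarrow> complex \<times> (complex^'n) \<Rightarrow> complex \<times> (complex^'n) \<Rightarrow> real) \<Rightarrow> bool" where
  "bergman_type_metric \<Gamma> e a g \<longleftrightarrow>
     quotient_metric_on \<Gamma> e (disc_bundle \<Gamma> e a 0) g \<and>
     (\<forall>p\<in>siegel_domain a. \<forall>v w.
        kaehler_form (pullback cover_map g) p v w =
        i_ddbar (\<lambda>q. ln (Re (bergman_kernel (siegel_domain a) q q))) p v w)"

text \<open>\<open>\<surd>-1 \<partial>\<partial>bar \<phi>\<close> is positive and its Ricci form
  \<open>- \<surd>-1 \<partial>\<partial>bar log det (\<partial>\<^sup>2\<phi> / \<partial>z\<^sub>j \<partial>zbar\<^sub>k)\<close> vanishes.\<close>

definition ricci_flat_kaehler_potential :: "(complex^'n \<Rightarrow> real) \<Rightarrow> bool" where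
  "ricci_flat_kaehler_potential \<phi> \<longleftrightarrow>
     (\<forall>z v. v \<noteq> 0 \<longrightarrow> i_ddbar \<phi> z v (J v) \<in> \<real> \<and> 0 < Re (i_ddbar \<phi> z v (J v))) \<and>
     (\<forall>z v w. i_ddbar (\<lambda>x. ln (Re (det (\<chi> j k.
         del (\<lambda>q. delbar (\<lambda>y. complex_of_real (\<phi> y)) q (axis k 1)) x (axis j 1))))) z v w = 0)"

definition calabi_potential :: "nat \<Rightarrow> real \<Rightarrow> real" where
  "calabi_potential n s = - (real n + 2) * ln \<bar>s\<bar> - s"

definition calabi_ansatz_metric ::
  "(complex^'n) set \<Rightarrow> 'n factor \<Rightarrow> (complex^'n \<Rightarrow> real) \<Rightarrow>
   (complex \<times> (complex^'n) \<Rightarrow> complex \<times> (complex^'n) \<Rightarrow> complex \<times> (complex^'n) \<Rightarrow> real) \<Rightarrow> bool" where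
  "calabi_ansatz_metric \<Gamma> e a g \<longleftrightarrow>
     bundle_metric \<Gamma> e a \<and> ricci_flat_kaehler_potential (\<lambda>z. ln (a z)) \<and>
     quotient_metric_on \<Gamma> e (disc_bundle \<Gamma> e a 0) g \<and>
     (\<forall>p\<in>preim \<Gamma> e (disc_bundle \<Gamma> e a 0). \<forall>v w.
        kaehler_form g p v w =
        pullback snd (i_ddbar (\<lambda>z. ln (a z))) p v w +
        i_ddbar (\<lambda>q. calabi_potential CARD('n) (ln (sq_norm a q))) p v w)"

text \<open>The function \<open>h\<close>; the double sum is real because the factors \<open>c \<alpha>\<close> are purely imaginary.\<close>

definition theta_metric :: "real^'n^'n \<Rightarrow> complex^'n \<Rightarrow> complex^'n \<Rightarrow> real" where
  "theta_metric Y t z =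
     (let W = matrix_inv Y;
          c = (\<lambda>\<alpha>. z $ \<alpha> - cnj (z $ \<alpha>) + \<i> * of_real (Y $ \<alpha> $ \<alpha>) - t $ \<alpha> + cnj (t $ \<alpha>))
      in exp (- (pi / 2) * Re (\<Sum>\<alpha>\<in>UNIV. \<Sum>\<beta>\<in>UNIV. of_real (W $ \<alpha> $ \<beta>) * c \<alpha> * c \<beta>)))"

end

theory Submission
  imports Defs "HOL-Complex_Analysis.Cauchy_Integral_Formula"
begin

text \<open>
  Write \<open>log h = Q\<close>, where \<open>Q z\<close> is a positive definite quadratic form in \<open>Im z + c\<close> for a constant real
  vector \<open>c\<close>.  Both metrics live on \<open>0 < r < 1\<close> and turn out to have the Kaehler form
  \<open>-(n+2) \<surd>-1 \<partial>\<partial>bar log |log r|\<close>, for two independent reasons.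

  On the Calabi side this is a cancellation: with \<open>s = log r = log |w|\<^sup>2 + Q z\<close> and \<open>log |w|\<^sup>2\<close> pluriharmonic,
  the summand \<open>-s\<close> of the potential contributes \<open>- \<surd>-1 \<partial>\<partial>bar Q\<close>, which is minus the pull-back of the
  Ricci-flat form of the base.

  On the Bergman side the pull-back of \<open>s\<close> to \<open>{Im u > Q z}\<close> is \<open>Q z - Im u\<close>, so it suffices to show that
  the Bergman kernel of this Siegel domain is \<open>C (Im u - Q z)\<^sup>-\<^sup>n\<^sup>-\<^sup>2\<close> on the diagonal with a constant \<open>C > 0\<close>
  (\<open>siegel_bergman_kernel\<close>).  For every point \<open>p\<close> of the domain, an explicit polynomial automorphism of
  \<open>\<complex> \<times> \<complex>\<^sup>n\<close> (an affine dilation combined with a shear of \<open>u\<close> by a quadratic polynomial in \<open>z\<close>) carries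
  \<open>{Im u > H z}\<close>, with \<open>H\<close> the Hermitian form \<open>\<partial>\<partial>bar Q\<close>, onto the domain and \<open>(\<i>, 0)\<close> to \<open>p\<close>.  Its real
  Jacobian is the constant \<open>(Im u - Q z)\<^sup>n\<^sup>+\<^sup>2\<close> taken at \<open>p\<close>, and the kernel transforms by that factor
  (\<open>reproduces_transport\<close>).  So only the kernel of \<open>{Im u > H z}\<close> at the single point \<open>(\<i>, 0)\<close> is needed.

  That kernel comes from a mean value property (\<open>model_kernel\<close>).  In the unit ball, a constant function
  represents evaluation at the centre because the Lebesgue measure is invariant under the rotations
  \<open>\<zeta> \<mapsto> e\<^sup>i\<^sup>t \<zeta>\<close>.  Transported by the Cayley transform, the measure becomes, up to a constant,
  \<open>|u + \<i>|\<^sup>-\<^sup>2\<^sup>n\<^sup>-\<^sup>4\<close> times Lebesgue measure and the rotations become explicit fractional linear maps fixing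
  \<open>(\<i>, 0)\<close>.  Their invariance is checked by Fubini, with a complex dilation in the fibres and a conformal
  substitution in \<open>u\<close>; averaging over the circle and the one-variable Cauchy formula then give the
  reproducing function \<open>a (u + \<i>)\<^sup>-\<^sup>n\<^sup>-\<^sup>2\<close>.

  Finally both definitions force the same explicit Hermitian metric \<open>cusp_metric\<close>: the covering map and its
  differential are onto, so each definition determines the metric at every point, and conversely
  \<open>cusp_metric\<close> is \<open>\<Gamma>\<close>-invariant and satisfies both.
\<close>

section \<open>Lebesgue measure under conformal maps and complex dilations\<close>

lemma lborel_complex_real2:
  "distr lborel borel (\<lambda>x::real^2. Complex (x$1) (x$2)) = lborel"
proof (rule lborel_eqI[symmetric])
  have [measurable]: "(\<lambda>x::real^2. Complex (x$1) (x$2)) \<in> borel_measurable borel"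
    by (intro borel_measurable_continuous_onI continuous_intros)
  fix l u :: complex assume lu: "\<And>b. b \<in> Basis \<Longrightarrow> l \<bullet> b \<le> u \<bullet> b"
  have le: "Re l \<le> Re u" "Im l \<le> Im u" using lu[of 1] lu[of \<i>] by (auto simp: Basis_complex_def)
  have "(\<lambda>x::real^2. Complex (x$1) (x$2)) -` box l u = box (vector [Re l, Im l]) (vector [Re u, Im u])"
    by (auto simp: in_box_complex_iff mem_box_cart forall_2)
  moreover have "emeasure lborel (box (vector [Re l, Im l]) (vector [Re u, Im u] :: real^2)) =
      ennreal ((Re u - Re l) * (Im u - Im l))"
  proof -
    have B: "(Basis :: (real^2) set) = {axis 1 1, axis 2 1}"
      by (auto simp: Basis_vec_def UNIV_2)
    have ne: "axis 1 1 \<noteq> (axis 2 1 :: real^2)" by (simp add: axis_eq_axis)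
    show ?thesis using le ne unfolding emeasure_lborel_box_eq B by (simp add: inner_axis)
  qed
  ultimately show "emeasure (distr lborel borel (\<lambda>x::real^2. Complex (x$1) (x$2))) (box l u) =
      ennreal (\<Prod>b\<in>Basis. (u - l) \<bullet> b)"
    by (subst emeasure_distr) (auto simp: Basis_complex_def)
qed simp

text \<open>The Jacobian of a holomorphic map is the squared modulus of its derivative.  Both sides are integrals
  against measures on the plane, so it is enough to compare those measures on boxes; there the
  change of variables in \<open>\<real>\<^sup>2\<close> for sets of finite measure applies.\<close>

lemma nn_integral_conformal_substitution:
  fixes f f' :: "complex \<Rightarrow> complex" and F :: "complex \<Rightarrow> ennreal"
  assumes S: "open S" and der: "\<And>z. z \<in> S \<Longrightarrow> (f has_field_derivative f' z) (at z)"
    and inj: "inj_on f S" and im: "open (f ` S)" and f': "continuous_on S f'"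
    and F[measurable]: "F \<in> borel_measurable borel"
  shows "(\<integral>\<^sup>+z. indicator (f ` S) z * F z \<partial>lborel) =
    (\<integral>\<^sup>+z. indicator S z * ennreal ((cmod (f' z))\<^sup>2) * F (f z) \<partial>lborel)"
proof -
  define g where "g z = (if z \<in> S then f z else 0)" for z
  define j where "j z = (if z \<in> S then (cmod (f' z))\<^sup>2 else 0)" for z
  have contf: "continuous_on S f"
    using der by (meson continuous_at_imp_continuous_on DERIV_isCont)
  have [measurable]: "S \<in> sets borel" "f ` S \<in> sets borel" using S im by auto
  have [measurable]: "g \<in> borel_measurable borel"
    unfolding g_def using contf S by (intro borel_measurable_continuous_on_if) auto
  have [measurable]: "j \<in> borel_measurable borel"
    unfolding j_def using f' S by (intro borel_measurable_continuous_on_if) (auto intro!: continuous_intros)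
  have mj: "(\<lambda>z. j z * indicator (box a b) (g z)) \<in> borel_measurable borel" for a b by measurable
  have j0: "0 \<le> j z" for z by (simp add: j_def)
  define M1 where "M1 = density lborel (indicator (f ` S) :: complex \<Rightarrow> ennreal)"
  define M2 where "M2 = distr (density lborel (\<lambda>z. ennreal (j z))) borel g"
  \<comment> \<open>Transport to \<open>\<real>\<^sup>2\<close>, where the part of a box that lies in the image has measure the integral of the Jacobian.\<close>
  have key: "emeasure M1 (box a b) = emeasure M2 (box a b)" for a b
  proof -
    define r :: "real^2 \<Rightarrow> complex" where "r x = Complex (x$1) (x$2)" for x
    define ri :: "complex \<Rightarrow> real^2" where "ri z = vector [Re z, Im z]" for z
    have rri[simp]: "r (ri z) = z" "ri (r x) = x" for z x
      by (auto simp: r_def ri_def vec_eq_iff forall_2)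
    have linr: "linear r" "linear ri"
      by (auto simp: r_def ri_def linear_iff vec_eq_iff forall_2 complex_eq_iff)
    have rd: "(r has_derivative r) F" "(ri has_derivative ri) G" for F G
      using linr by (auto intro!: bounded_linear_imp_has_derivative simp: linear_conv_bounded_linear)
    have contr: "continuous_on UNIV r" "continuous_on UNIV ri"
      using linr by (auto simp: linear_continuous_on linear_conv_bounded_linear)
    then have [measurable]: "r \<in> borel_measurable borel" "ri \<in> borel_measurable borel"
      by (auto intro: borel_measurable_continuous_onI)
    have dr: "distr lborel borel r = lborel"
      using lborel_complex_real2 by (simp add: r_def[abs_def])
    define A where "A = box a b \<inter> f ` S"
    define S' where "S' = S \<inter> f -` box a b"
    have A_eq: "A = f ` S'" by (auto simp: A_def S'_def)
    have [measurable]: "A \<in> sets borel" by (simp add: A_def)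
    have oS': "open S'" unfolding S'_def
      using contf S by (intro continuous_open_preimage) auto
    define T where "T = r -` S'"
    have oT: "open T" unfolding T_def
      using contr oS' by (simp add: open_vimage)
    define h where "h = ri \<circ> f \<circ> r"
    define h' where "h' x = ri \<circ> (\<lambda>v. f' (r x) * v) \<circ> r" for x
    have hT: "h ` T = r -` A"
    proof -
      have "x \<in> h ` T" if "r x \<in> A" for x
      proof -
        from that obtain z where "r x = f z" "z \<in> S'" unfolding A_eq by (rule imageE)
        then have "ri z \<in> T" "x = h (ri z)"
          by (auto simp: T_def h_def) (metis rri(2))
        then show ?thesis by blast
      qed
      then show ?thesis by (auto simp: T_def A_eq h_def)
    qed
    have emA: "emeasure lborel (r -` A) = emeasure lborel A"
      using emeasure_distr[of r lborel borel A] by (simp add: dr)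
    have finA: "emeasure lborel A < \<infinity>"
      by (rule le_less_trans[OF emeasure_mono[of _ "box a b"]])
         (auto simp: A_def emeasure_lborel_box_eq)
    have [measurable]: "r -` A \<in> sets borel"
      using measurable_sets[OF \<open>r \<in> borel_measurable borel\<close> \<open>A \<in> sets borel\<close>] by simp
    have lm: "r -` A \<in> lmeasurable"
      using finA emA by (intro fmeasurableI) (auto simp: top.not_eq_extremum)
    have det: "\<bar>det (matrix (h' x))\<bar> = (cmod (f' (r x)))\<^sup>2" for x
    proof -
      have "matrix (h' x) $ 1 $ 1 = Re (f' (r x))" "matrix (h' x) $ 2 $ 1 = Im (f' (r x))"
        "matrix (h' x) $ 1 $ 2 = - Im (f' (r x))" "matrix (h' x) $ 2 $ 2 = Re (f' (r x))"
        by (auto simp: matrix_def h'_def ri_def r_def axis_def)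
      then show ?thesis unfolding det_2 cmod_power2 by (simp add: power2_eq_square)
    qed
    have "h ` T \<in> lmeasurable \<and> measure lebesgue (h ` T) = measure lebesgue (r -` A)"
      using lm by (simp add: hT)
    then have hi: "((\<lambda>x. \<bar>det (matrix (h' x))\<bar>) has_integral measure lebesgue (r -` A)) T"
    proof (subst (asm) has_measure_differentiable_image)
      show "T \<in> sets lebesgue" using oT by auto
      show "(h has_derivative h' x) (at x within T)" if "x \<in> T" for x
        unfolding h_def h'_def
        using that der[of "r x"] S
        by (auto intro!: diff_chain_within rd has_derivative_at_withinI[OF der[unfolded has_field_derivative_def]]
           simp: T_def S'_def intro: has_derivative_at_withinI)
      show "inj_on h T"
        using inj unfolding inj_on_def h_def T_def S'_def
        by (auto) (metis rri)
    qed
    have Ieq: "(\<lambda>x. j (r x) * indicator (box a b) (g (r x))) =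
        (\<lambda>x. if x \<in> T then \<bar>det (matrix (h' x))\<bar> else 0)"
      by (auto simp: fun_eq_iff T_def S'_def det j_def g_def indicator_def)
    have hi': "((\<lambda>x. j (r x) * indicator (box a b) (g (r x))) has_integral measure lebesgue (r -` A)) UNIV"
      unfolding Ieq by (subst has_integral_restrict_UNIV) (rule hi)
    have "emeasure M2 (box a b) = (\<integral>\<^sup>+z. ennreal (j z) * indicator (g -` box a b) z \<partial>lborel)"
      unfolding M2_def by (subst emeasure_distr)
        (auto simp: emeasure_density measurable_sets_borel[of g borel])
    also have "\<dots> = (\<integral>\<^sup>+z. ennreal (j z * indicator (box a b) (g z)) \<partial>lborel)"
      by (intro nn_integral_cong) (auto simp: indicator_def)
    also have "\<dots> = (\<integral>\<^sup>+x. ennreal (j (r x) * indicator (box a b) (g (r x))) \<partial>lborel)"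
      by (subst dr[symmetric], subst nn_integral_distr) auto
    also have "\<dots> = ennreal (measure lebesgue (r -` A))"
    proof (rule nn_integral_has_integral_lborel[OF _ _ hi'])
      show "(\<lambda>x. j (r x) * indicator (box a b) (g (r x))) \<in> borel_measurable borel"
        using measurable_compose[OF \<open>r \<in> borel_measurable borel\<close>, of "\<lambda>z. j z * indicator (box a b) (g z)" borel]
        using mj by blast
      show "0 \<le> j (r x) * indicator (box a b) (g (r x))" for x by (simp add: j0)
    qed
    also have "\<dots> = emeasure lborel A"
    proof -
      have "measure lebesgue (r -` A) = measure lborel (r -` A)" by (rule measure_completion) simp
      moreover have "ennreal (measure lborel (r -` A)) = emeasure lborel (r -` A)"
        using finA emA by (intro emeasure_eq_ennreal_measure[symmetric]) auto
      ultimately show ?thesis using emA by simp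
    qed
    also have "\<dots> = (\<integral>\<^sup>+z. indicator A z \<partial>lborel)" by simp
    also have "\<dots> = (\<integral>\<^sup>+z. indicator (f ` S) z * indicator (box a b) z \<partial>lborel)"
      by (intro nn_integral_cong) (auto simp: A_def indicator_def)
    also have "\<dots> = emeasure M1 (box a b)"
      unfolding M1_def by (rule emeasure_density[symmetric]) measurable
    finally show ?thesis by simp
  qed
  have eq: "M1 = M2"
  proof (rule measure_eqI_generator_eq)
    let ?E = "range (\<lambda>(a, b). box a b::complex set)"
    show "Int_stable ?E" by (auto simp: Int_stable_def box_Int_box)
    show "?E \<subseteq> Pow UNIV" "sets M1 = sigma_sets UNIV ?E" "sets M2 = sigma_sets UNIV ?E"
      by (simp_all add: borel_eq_box M1_def M2_def)
    let ?A = "\<lambda>n::nat. box (- (real n *\<^sub>R One)) (real n *\<^sub>R One) :: complex set"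
    show "range ?A \<subseteq> ?E" "(\<Union>i. ?A i) = UNIV" unfolding UN_box_eq_UNIV by auto
    show "emeasure M1 (?A i) \<noteq> \<infinity>" for i
    proof -
      have "emeasure M1 (?A i) = (\<integral>\<^sup>+z. indicator (f ` S) z * indicator (?A i) z \<partial>lborel)"
        unfolding M1_def by (rule emeasure_density) measurable
      also have "\<dots> \<le> (\<integral>\<^sup>+z. indicator (?A i) z \<partial>lborel)"
        by (intro nn_integral_mono) (simp add: indicator_def)
      also have "\<dots> = emeasure lborel (?A i)" by (rule nn_integral_indicator) simp
      also have "\<dots> < \<infinity>" by (rule emeasure_bounded_finite) simp
      finally show ?thesis by simp
    qed
    show "emeasure M1 X = emeasure M2 X" if "X \<in> ?E" for X using that key by auto
  qed
  have "(\<integral>\<^sup>+z. indicator (f ` S) z * F z \<partial>lborel) = (\<integral>\<^sup>+z. F z \<partial>M1)"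
    by (simp add: M1_def nn_integral_density)
  also have "\<dots> = (\<integral>\<^sup>+z. ennreal (j z) * F (g z) \<partial>lborel)"
    unfolding eq M2_def by (subst nn_integral_distr) (auto simp: nn_integral_density)
  also have "\<dots> = (\<integral>\<^sup>+z. indicator S z * ennreal ((cmod (f' z))\<^sup>2) * F (f z) \<partial>lborel)"
    by (intro nn_integral_cong) (auto simp: j_def g_def)
  finally show ?thesis .
qed

lemma borel_measurable_vec_lambda [measurable]:
  "(\<lambda>f. \<chi> i. f i) \<in> measurable (PiM UNIV (\<lambda>_::'n::finite. lborel :: 'a::euclidean_space measure)) borel"
proof (subst borel_measurable_euclidean_space, safe)
  fix b :: "'a^'n" assume "b \<in> Basis"
  then obtain i c where b: "b = axis i c" "c \<in> Basis" by (auto simp: Basis_vec_def)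
  show "(\<lambda>x. (\<chi> i. x i) \<bullet> b) \<in> borel_measurable (PiM UNIV (\<lambda>_::'n. lborel :: 'a measure))"
    unfolding b by (simp add: inner_axis)
qed

text \<open>Splitting the coordinates reduces substitutions that act on each coordinate separately to dimension one.\<close>

lemma lborel_vec:
  "distr (PiM UNIV (\<lambda>_::'n::finite. lborel)) borel (\<lambda>f. \<chi> i. f i) = (lborel :: ('a::euclidean_space^'n) measure)"
proof (rule lborel_eqI[symmetric])
  interpret product_sigma_finite "\<lambda>_::'n. lborel :: 'a measure" ..
  note m = borel_measurable_vec_lambda[where 'a = 'a and 'n = 'n]
  fix l u :: "'a^'n" assume lu: "\<And>b. b \<in> Basis \<Longrightarrow> l \<bullet> b \<le> u \<bullet> b"
  have lu': "l $ i \<bullet> c \<le> u $ i \<bullet> c" if "c \<in> Basis" for i c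
    using lu[of "axis i c"] that by (auto simp: Basis_vec_def inner_axis)
  have pre: "(\<lambda>f. \<chi> i. f i) -` box l u \<inter> space (PiM UNIV (\<lambda>_::'n. lborel :: 'a measure)) =
      PiE UNIV (\<lambda>i. box (l$i) (u$i))"
    by (auto simp: mem_box Basis_vec_def inner_axis space_PiM PiE_def Pi_def)
  have inj: "inj_on (\<lambda>(i, c). axis i c) (UNIV \<times> (Basis::'a set))"
    by (auto simp: inj_on_def axis_eq_axis)
  have B: "(Basis :: ('a^'n) set) = (\<lambda>(i, c). axis i c) ` (UNIV \<times> Basis)"
    by (auto simp: Basis_vec_def)
  have "emeasure (distr (PiM UNIV (\<lambda>_::'n. lborel)) borel (\<lambda>f. \<chi> i. f i)) (box l u) =
      (\<Prod>i\<in>UNIV. emeasure lborel (box (l$i) (u$i)))"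
    by (subst emeasure_distr[OF m]) (auto simp: pre intro!: emeasure_PiM)
  also have "\<dots> = (\<Prod>i\<in>UNIV. ennreal (\<Prod>b\<in>Basis. (u$i - l$i) \<bullet> b))"
    using lu' by (intro prod.cong refl) (simp add: emeasure_lborel_box)
  also have "\<dots> = ennreal (\<Prod>i\<in>UNIV. \<Prod>b\<in>Basis. (u$i - l$i) \<bullet> b)"
    using lu' by (intro prod_ennreal prod_nonneg) (auto simp: inner_diff_left)
  also have "(\<Prod>i\<in>UNIV. \<Prod>b\<in>Basis. (u$i - l$i) \<bullet> b) = (\<Prod>b\<in>Basis. (u - l) \<bullet> b)"
    unfolding B by (subst prod.reindex[OF inj])
      (simp add: prod.cartesian_product inner_axis case_prod_unfold o_def)
  finally show "emeasure (distr (PiM UNIV (\<lambda>_::'n. lborel)) borel (\<lambda>f. \<chi> i. f i)) (box l u) =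
      ennreal (\<Prod>b\<in>Basis. (u - l) \<bullet> b)" .
qed simp

lemma nn_integral_complex_scaling:
  fixes F :: "complex^'n \<Rightarrow> ennreal"
  assumes a: "a \<noteq> 0" and F[measurable]: "F \<in> borel_measurable borel"
  shows "(\<integral>\<^sup>+z. F z \<partial>lborel) = ennreal (cmod a ^ (2 * CARD('n))) * (\<integral>\<^sup>+z. F (\<chi> i. a * z $ i) \<partial>lborel)"
proof -
  interpret product_sigma_finite "\<lambda>_::'n. lborel :: complex measure" ..
  note m = borel_measurable_vec_lambda[where 'a = complex and 'n = 'n]
  have ms[measurable]: "(\<lambda>z::complex^'n. \<chi> i. a * z $ i) \<in> borel_measurable borel"
    by (intro borel_measurable_continuous_onI continuous_intros)
  have one: "emeasure lborel ((\<lambda>z. a * z) -` B) = ennreal ((cmod (inverse a))\<^sup>2) * emeasure lborel B"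
    if [measurable]: "B \<in> sets borel" for B :: "complex set"
  proof -
    have im: "(\<lambda>z. inverse a * z) ` UNIV = UNIV"
    proof -
      have "z = inverse a * (a * z)" for z using a by simp
      then show ?thesis by blast
    qed
    have "(\<integral>\<^sup>+z. indicator ((\<lambda>z. inverse a * z) ` UNIV) z * indicator ((\<lambda>z. a * z) -` B) z \<partial>lborel) =
      (\<integral>\<^sup>+z. indicator UNIV z * ennreal ((cmod (inverse a))\<^sup>2) * indicator ((\<lambda>z. a * z) -` B) (inverse a * z) \<partial>lborel)"
      using a by (intro nn_integral_conformal_substitution)
        (auto intro!: derivative_eq_intros inj_onI measurable_sets_borel[of _ borel] simp: im)
    moreover have "(\<lambda>z. a * z) -` B \<in> sets borel"
      by (rule measurable_sets_borel[of _ borel]) auto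
    ultimately have "(\<integral>\<^sup>+z. indicator ((\<lambda>z. a * z) -` B) z \<partial>lborel) =
      (\<integral>\<^sup>+z. ennreal ((cmod (inverse a))\<^sup>2) * indicator B z \<partial>lborel)"
      using a unfolding im by (simp add: indicator_def mult.assoc[symmetric])
    then show ?thesis using \<open>(\<lambda>z. a * z) -` B \<in> sets borel\<close> by (simp add: nn_integral_cmult)
  qed
  define N where "N = density (distr lborel borel (\<lambda>z::complex^'n. \<chi> i. a * z $ i)) (\<lambda>_. ennreal (cmod a ^ (2 * CARD('n))))"
  have "N = lborel"
  proof (rule lborel_eqI[symmetric])
    fix l u :: "complex^'n" assume lu: "\<And>b. b \<in> Basis \<Longrightarrow> l \<bullet> b \<le> u \<bullet> b"
    let ?B = "\<lambda>i. box (l$i) (u$i)"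
    have box: "box l u = {z. \<forall>i. z $ i \<in> ?B i}"
      by (auto simp: mem_box Basis_vec_def inner_axis)
    have prodset: "emeasure lborel {z::complex^'n. \<forall>i. z $ i \<in> A i} = (\<Prod>i\<in>UNIV. emeasure lborel (A i))"
      if A[measurable]: "\<And>i. A i \<in> sets borel" for A
    proof -
      have [measurable]: "{z::complex^'n. \<forall>i. z $ i \<in> A i} \<in> sets borel"
      proof -
        have "{z::complex^'n. \<forall>i. z $ i \<in> A i} = (\<Inter>i. (\<lambda>z. z $ i) -` A i)" by auto
        also have "\<dots> \<in> sets borel"
          by (intro sets.finite_INT measurable_sets_borel[OF _ A] borel_measurable_continuous_onI continuous_intros) auto
        finally show ?thesis .
      qed
      have "emeasure lborel {z::complex^'n. \<forall>i. z $ i \<in> A i} =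
          emeasure (PiM UNIV (\<lambda>_::'n. lborel)) (PiE UNIV A)"
        by (subst lborel_vec[symmetric], subst emeasure_distr[OF m])
           (auto simp: space_PiM PiE_def Pi_def intro!: arg_cong[of _ _ "emeasure _"])
      then show ?thesis by (simp add: emeasure_PiM)
    qed
    have "emeasure N (box l u) = ennreal (cmod a ^ (2 * CARD('n))) *
        emeasure lborel ((\<lambda>z::complex^'n. \<chi> i. a * z $ i) -` box l u)"
      unfolding N_def
      by (subst emeasure_density) (auto simp: nn_integral_cmult emeasure_distr)
    also have "(\<lambda>z::complex^'n. \<chi> i. a * z $ i) -` box l u = {z. \<forall>i. z $ i \<in> (\<lambda>z. a * z) -` ?B i}"
      by (auto simp: box)
    also have "emeasure lborel \<dots> = (\<Prod>i\<in>UNIV. emeasure lborel ((\<lambda>z. a * z) -` ?B i))"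
      by (intro prodset measurable_sets_borel[of _ borel]) auto
    also have "\<dots> = (\<Prod>i\<in>(UNIV::'n set). ennreal ((cmod (inverse a))\<^sup>2)) * (\<Prod>i\<in>UNIV. emeasure lborel (?B i))"
      unfolding prod.distrib[symmetric] by (intro prod.cong refl one) simp
    also have "(\<Prod>i\<in>UNIV. emeasure lborel (?B i)) = emeasure lborel (box l u)"
      unfolding box by (intro prodset[symmetric]) auto
    also have "(\<Prod>i\<in>(UNIV::'n set). ennreal ((cmod (inverse a))\<^sup>2)) = ennreal (cmod (inverse a) ^ (2 * CARD('n)))"
      by (simp only: prod_constant ennreal_power zero_le_power2 power_mult)
    also have "ennreal (cmod a ^ (2 * CARD('n))) * (ennreal (cmod (inverse a) ^ (2 * CARD('n))) * emeasure lborel (box l u)) =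
      ennreal (cmod a ^ (2 * CARD('n)) * cmod (inverse a) ^ (2 * CARD('n))) * emeasure lborel (box l u)"
      by (subst ennreal_mult) (simp_all only: mult.assoc norm_ge_zero zero_le_power)
    also have "cmod a ^ (2 * CARD('n)) * cmod (inverse a) ^ (2 * CARD('n)) = 1"
      using a by (metis norm_mult norm_one power_mult_distrib power_one right_inverse)
    finally show "emeasure N (box l u) = ennreal (\<Prod>b\<in>Basis. (u - l) \<bullet> b)"
      using lu by (simp add: emeasure_lborel_box)
  qed (simp add: N_def)
  then have "(\<integral>\<^sup>+z. F z \<partial>lborel) = (\<integral>\<^sup>+z. F z \<partial>N)" by simp
  also have "\<dots> = ennreal (cmod a ^ (2 * CARD('n))) * (\<integral>\<^sup>+z. F (\<chi> i. a * z $ i) \<partial>lborel)"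
    unfolding N_def by (simp add: nn_integral_density nn_integral_distr nn_integral_cmult)
  finally show ?thesis .
qed

section \<open>Rotations of the upper half plane about the point i\<close>

lemma holo_on_continuous_on: "holo_on S f \<Longrightarrow> continuous_on S f"
  unfolding holo_on_def
  by (meson continuous_at_imp_continuous_on has_derivative_continuous)

lemma continuous_vscale [continuous_intros]:
  fixes f :: "'a::topological_space \<Rightarrow> complex" and g :: "'a \<Rightarrow> complex^'n"
  assumes "continuous_on S f" "continuous_on S g"
  shows "continuous_on S (\<lambda>x. f x *s g x)"
  unfolding vector_scalar_mult_def using assms by (intro continuous_intros)

lemma borel_measurable_vscale [measurable]:
  fixes f :: "'a \<Rightarrow> complex" and g :: "'a \<Rightarrow> complex^'n"
  assumes "f \<in> borel_measurable M" "g \<in> borel_measurable M"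
  shows "(\<lambda>x. f x *s g x) \<in> borel_measurable M"
proof -
  have "(\<lambda>p. (fst p :: complex) *s (snd p :: complex^'n)) \<in> borel_measurable borel"
    by (intro borel_measurable_continuous_onI continuous_intros)
  then have "(\<lambda>p. (fst p :: complex) *s (snd p :: complex^'n)) \<in> borel_measurable (borel \<Otimes>\<^sub>M borel)"
    by (simp add: borel_prod)
  from measurable_compose[OF measurable_Pair[OF assms] this] show ?thesis by simp
qed

definition moebius_den :: "complex \<Rightarrow> complex \<Rightarrow> complex" where
  "moebius_den l u = (u + \<i>) - l * (u - \<i>)"

text \<open>The rotation \<open>\<zeta> \<mapsto> l \<zeta>\<close> of the disc in the coordinate \<open>\<zeta> = (u - \<i>) / (u + \<i>)\<close>.\<close>

definition moebius_rotation :: "complex \<Rightarrow> complex \<Rightarrow> complex" where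
  "moebius_rotation l u = \<i> * ((u + \<i>) + l * (u - \<i>)) / moebius_den l u"

text \<open>The rotation \<open>(\<zeta>, \<eta>) \<mapsto> (l \<zeta>, l \<eta>)\<close> of the ball in the coordinates \<open>\<zeta> = (u - \<i>) / (u + \<i>)\<close> and
  \<open>\<eta> = z / (u + \<i>)\<close>.\<close>

definition ball_rotation :: "complex \<Rightarrow> complex \<times> (complex^'n) \<Rightarrow> complex \<times> (complex^'n)" where
  "ball_rotation l p = (moebius_rotation l (fst p), (2 * \<i> * l / moebius_den l (fst p)) *s snd p)"

text \<open>This identity says that the half plane is where the Cayley transform \<open>(u - \<i>) / (u + \<i>)\<close> has modulus
  below one.\<close>

lemma cmod_plus_i_sq: "(cmod (u + \<i>))\<^sup>2 = (cmod (u - \<i>))\<^sup>2 + 4 * Im u"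
  unfolding cmod_power2 by (simp add: power2_eq_square algebra_simps)

lemma plus_i_nonzero: "0 < Im u \<Longrightarrow> u + \<i> \<noteq> 0"
  by (auto simp: complex_eq_iff)

lemma moebius_den_nonzero:
  assumes "0 < Im u" "cmod l \<le> 1" shows "moebius_den l u \<noteq> 0"
proof
  assume "moebius_den l u = 0"
  then have "u + \<i> = l * (u - \<i>)" by (simp add: moebius_den_def)
  then have "cmod (u + \<i>) \<le> cmod (u - \<i>)"
    using assms(2) by (metis mult_left_le_one_le norm_ge_zero norm_mult)
  then have "(cmod (u + \<i>))\<^sup>2 \<le> (cmod (u - \<i>))\<^sup>2" by (intro power_mono) auto
  then show False using cmod_plus_i_sq[of u] assms(1) by simp
qed

lemma moebius_rotation_plus_i:
  assumes "moebius_den l u \<noteq> 0" shows "moebius_rotation l u + \<i> = 2 * \<i> * (u + \<i>) / moebius_den l u"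
proof -
  have "moebius_rotation l u + \<i> = (\<i> * ((u + \<i>) + l * (u - \<i>)) + \<i> * moebius_den l u) / moebius_den l u"
    using assms by (simp add: moebius_rotation_def add_divide_distrib)
  also have "\<i> * ((u + \<i>) + l * (u - \<i>)) + \<i> * moebius_den l u = 2 * \<i> * (u + \<i>)"
    by (simp add: moebius_den_def algebra_simps)
  finally show ?thesis .
qed

lemma moebius_rotation_minus_i:
  assumes "moebius_den l u \<noteq> 0" shows "moebius_rotation l u - \<i> = l * (2 * \<i> * (u - \<i>)) / moebius_den l u"
proof -
  have "moebius_rotation l u - \<i> = (\<i> * ((u + \<i>) + l * (u - \<i>)) - \<i> * moebius_den l u) / moebius_den l u"
    using assms by (simp add: moebius_rotation_def diff_divide_distrib)
  also have "\<i> * ((u + \<i>) + l * (u - \<i>)) - \<i> * moebius_den l u = l * (2 * \<i> * (u - \<i>))"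
    by (simp add: moebius_den_def algebra_simps)
  finally show ?thesis .
qed

lemma Im_moebius_rotation:
  assumes "moebius_den l u \<noteq> 0"
  shows "Im (moebius_rotation l u) = ((cmod (u + \<i>))\<^sup>2 - (cmod l)\<^sup>2 * (cmod (u - \<i>))\<^sup>2) / (cmod (moebius_den l u))\<^sup>2"
proof -
  have "4 * Im (moebius_rotation l u) = (cmod (moebius_rotation l u + \<i>))\<^sup>2 - (cmod (moebius_rotation l u - \<i>))\<^sup>2"
    using cmod_plus_i_sq[of "moebius_rotation l u"] by simp
  also have "\<dots> = 4 * (((cmod (u + \<i>))\<^sup>2 - (cmod l)\<^sup>2 * (cmod (u - \<i>))\<^sup>2) / (cmod (moebius_den l u))\<^sup>2)"
    unfolding moebius_rotation_plus_i[OF assms] moebius_rotation_minus_i[OF assms] norm_divide norm_mult power_divide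
    by (simp add: power_mult_distrib diff_divide_distrib)
  finally show ?thesis by (simp only: mult_cancel_left) simp
qed

lemma Im_moebius_rotation_pos:
  assumes "0 < Im u" "cmod l \<le> 1" shows "0 < Im (moebius_rotation l u)"
proof -
  have "(cmod l)\<^sup>2 * (cmod (u - \<i>))\<^sup>2 \<le> (cmod (u - \<i>))\<^sup>2"
    using assms(2) by (simp add: mult_left_le_one_le power_le_one)
  also have "\<dots> < (cmod (u + \<i>))\<^sup>2" using cmod_plus_i_sq[of u] assms(1) by simp
  finally show ?thesis
    using moebius_den_nonzero[OF assms] by (simp add: Im_moebius_rotation)
qed

lemma moebius_rotation_inverse:
  assumes "0 < Im u" "cmod l = 1" shows "moebius_rotation (cnj l) (moebius_rotation l u) = u"
proof -
  have d: "moebius_den l u \<noteq> 0" using assms by (simp add: moebius_den_nonzero)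
  have ll: "cnj l * l = 1" using assms(2) by (simp add: complex_norm_square[symmetric] mult.commute)
  have "moebius_den (cnj l) (moebius_rotation l u) = (2 * \<i> * (u + \<i>) - (cnj l * l) * (2 * \<i> * (u - \<i>))) / moebius_den l u"
    unfolding moebius_den_def[of "cnj l"] moebius_rotation_plus_i[OF d] moebius_rotation_minus_i[OF d]
    by (simp add: diff_divide_distrib mult.assoc)
  also have "\<dots> = - 4 / moebius_den l u" unfolding ll by (simp add: algebra_simps)
  finally have den: "moebius_den (cnj l) (moebius_rotation l u) = - 4 / moebius_den l u" .
  have "(moebius_rotation l u + \<i>) + cnj l * (moebius_rotation l u - \<i>) = (2 * \<i> * (u + \<i>) + (cnj l * l) * (2 * \<i> * (u - \<i>))) / moebius_den l u"
    unfolding moebius_rotation_plus_i[OF d] moebius_rotation_minus_i[OF d]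
    by (simp add: add_divide_distrib mult.assoc)
  also have "\<dots> = 4 * \<i> * u / moebius_den l u" unfolding ll by (simp add: algebra_simps)
  finally show ?thesis unfolding moebius_rotation_def[of "cnj l"] den using d by simp
qed

lemma moebius_rotation_has_field_derivative:
  assumes "moebius_den l u \<noteq> 0"
  shows "(moebius_rotation l has_field_derivative (- 4 * l / (moebius_den l u)\<^sup>2)) (at u)"
proof -
  have "(moebius_rotation l has_field_derivative
     (\<i> * (1 + l) * moebius_den l u - \<i> * ((u + \<i>) + l * (u - \<i>)) * (1 - l)) / (moebius_den l u * moebius_den l u)) (at u)"
    using assms unfolding moebius_rotation_def[abs_def] moebius_den_def
    by (auto intro!: derivative_eq_intros)
  moreover have "\<i> * (1 + l) * moebius_den l u - \<i> * ((u + \<i>) + l * (u - \<i>)) * (1 - l) = - 4 * l"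
    by (simp add: moebius_den_def algebra_simps)
  ultimately show ?thesis by (simp add: power2_eq_square)
qed

lemma moebius_rotation_image:
  assumes "cmod l = 1" shows "moebius_rotation l ` {u. 0 < Im u} = {u. 0 < Im u}"
proof
  show "moebius_rotation l ` {u. 0 < Im u} \<subseteq> {u. 0 < Im u}" using assms by (auto intro!: Im_moebius_rotation_pos)
  show "{u. 0 < Im u} \<subseteq> moebius_rotation l ` {u. 0 < Im u}"
  proof
    fix u assume "u \<in> {u. 0 < Im u}"
    then show "u \<in> moebius_rotation l ` {u. 0 < Im u}"
      using moebius_rotation_inverse[of u "cnj l"] Im_moebius_rotation_pos[of u "cnj l"] assms
      by (intro image_eqI[of _ _ "moebius_rotation (cnj l) u"]) auto
  qed
qed

lemma open_upper_half_plane: "open {u::complex. 0 < Im u}"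
  by (rule open_halfspace_Im_gt)

lemma nn_integral_moebius_rotation:
  fixes F :: "complex \<Rightarrow> ennreal"
  assumes l: "cmod l = 1" and [measurable]: "F \<in> borel_measurable borel"
  shows "(\<integral>\<^sup>+u. indicator {u. 0 < Im u} u * F u \<partial>lborel) =
    (\<integral>\<^sup>+u. indicator {u. 0 < Im u} u * ennreal (16 / cmod (moebius_den l u) ^ 4) * F (moebius_rotation l u) \<partial>lborel)"
proof -
  let ?S = "{u::complex. 0 < Im u}"
  have "(\<integral>\<^sup>+u. indicator (moebius_rotation l ` ?S) u * F u \<partial>lborel) =
    (\<integral>\<^sup>+u. indicator ?S u * ennreal ((cmod (- 4 * l / (moebius_den l u)\<^sup>2))\<^sup>2) * F (moebius_rotation l u) \<partial>lborel)"
  proof (rule nn_integral_conformal_substitution)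
    show "(moebius_rotation l has_field_derivative - 4 * l / (moebius_den l u)\<^sup>2) (at u)" if "u \<in> ?S" for u
      using that l by (intro moebius_rotation_has_field_derivative moebius_den_nonzero) auto
    show "inj_on (moebius_rotation l) ?S"
      using l by (intro inj_on_inverseI[of _ "moebius_rotation (cnj l)"]) (auto simp: moebius_rotation_inverse)
    have "\<forall>u\<in>?S. moebius_den l u \<noteq> 0" using l by (simp add: moebius_den_nonzero)
    then show "continuous_on ?S (\<lambda>u. - 4 * l / (moebius_den l u)\<^sup>2)"
      unfolding moebius_den_def by (intro continuous_intros) auto
  qed (use l in \<open>auto simp: moebius_rotation_image open_upper_half_plane \<close>)
  moreover have "(cmod (- 4 * l / (moebius_den l u)\<^sup>2))\<^sup>2 = 16 / cmod (moebius_den l u) ^ 4" for u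
    using l by (simp add: norm_divide norm_mult norm_power power_divide)
  ultimately show ?thesis using l by (simp add: moebius_rotation_image)
qed

text \<open>Up to the factor 4, the integrand is the Jacobian of the Cayley transform onto the unit disc, so the integral
  is a quarter of the area of the disc.\<close>

lemma nn_integral_half_plane_finite:
  "(\<integral>\<^sup>+u. indicator {u. 0 < Im u} u * ennreal (1 / cmod (u + \<i>) ^ 4) \<partial>lborel) < \<infinity>"
proof -
  let ?S = "{u::complex. 0 < Im u}"
  let ?f = "\<lambda>u. (u - \<i>) / (u + \<i>)"
  have nz: "u + \<i> \<noteq> 0" if "u \<in> ?S" for u using plus_i_nonzero that by simp
  have im: "?f ` ?S = ball 0 1"
  proof
    show "?f ` ?S \<subseteq> ball 0 1"
    proof clarsimp
      fix u :: complex assume u: "0 < Im u"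
      have "(cmod (u - \<i>))\<^sup>2 < (cmod (u + \<i>))\<^sup>2" using u cmod_plus_i_sq[of u] by simp
      then have "cmod (u - \<i>) < cmod (u + \<i>)" by (rule power2_less_imp_less) simp
      then show "cmod (?f u) < 1" using nz[of u] u by (simp add: norm_divide)
    qed
    show "ball 0 1 \<subseteq> ?f ` ?S"
    proof
      fix w :: complex assume "w \<in> ball 0 1"
      then have w: "cmod w < 1" by simp
      then have w1: "1 - w \<noteq> 0" by auto
      define u where "u = \<i> * (1 + w) / (1 - w)"
      have a: "u + \<i> = 2 * \<i> / (1 - w)" "u - \<i> = 2 * \<i> * w / (1 - w)"
        using w1 by (auto simp: u_def field_simps)
      have "4 * Im u = (cmod (u + \<i>))\<^sup>2 - (cmod (u - \<i>))\<^sup>2" using cmod_plus_i_sq[of u] by simp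
      also have "\<dots> = 4 * (1 - (cmod w)\<^sup>2) / (cmod (1 - w))\<^sup>2"
        unfolding a by (simp add: norm_divide norm_mult power_divide power_mult_distrib diff_divide_distrib)
      also have "\<dots> > 0" using w w1 by (simp add: power_less_one_iff abs_square_less_1)
      finally have "u \<in> ?S" by simp
      moreover have "w = ?f u" unfolding a using w1 by simp
      ultimately show "w \<in> ?f ` ?S" by blast
    qed
  qed
  have d: "(?f has_field_derivative 2 * \<i> / (u + \<i>)\<^sup>2) (at u)" if "u \<in> ?S" for u
    using nz[OF that] by (auto intro!: derivative_eq_intros simp: power2_eq_square)
  have "(\<integral>\<^sup>+u. indicator (?f ` ?S) u * 1 \<partial>lborel) =
    (\<integral>\<^sup>+u. indicator ?S u * ennreal ((cmod (2 * \<i> / (u + \<i>)\<^sup>2))\<^sup>2) * 1 \<partial>lborel)"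
  proof (rule nn_integral_conformal_substitution)
    show "inj_on ?f ?S"
    proof (rule inj_onI)
      fix u v assume "u \<in> ?S" "v \<in> ?S" "?f u = ?f v"
      then have "(u - \<i>) * (v + \<i>) = (v - \<i>) * (u + \<i>)" using nz by (simp add: frac_eq_eq)
      then show "u = v" by (simp add: algebra_simps)
    qed
    show "continuous_on ?S (\<lambda>u. 2 * \<i> / (u + \<i>)\<^sup>2)"
      using nz by (intro continuous_intros) auto
  qed (use d in \<open>auto simp: im open_upper_half_plane\<close>)
  moreover have "(cmod (2 * \<i> / (u + \<i>)\<^sup>2))\<^sup>2 = 4 * (1 / cmod (u + \<i>) ^ 4)" for u
    by (simp add: norm_divide norm_mult norm_power power_divide)
  ultimately have "(\<integral>\<^sup>+u. indicator ?S u * ennreal (4 * (1 / cmod (u + \<i>) ^ 4)) \<partial>lborel) =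
      emeasure lborel (ball (0::complex) 1)"
    unfolding im by simp
  also have "\<dots> < \<infinity>" by (rule emeasure_bounded_finite) simp
  finally have fin: "(\<integral>\<^sup>+u. indicator ?S u * ennreal (4 * (1 / cmod (u + \<i>) ^ 4)) \<partial>lborel) < \<infinity>" .
  show ?thesis
    by (rule le_less_trans[OF nn_integral_mono fin]) (auto simp: indicator_def intro!: ennreal_leI divide_right_mono)
qed

section \<open>A rotation-invariant measure on a model domain\<close>

text \<open>Homogeneity under complex scalars makes the rotations automorphisms of \<open>{Im u > H z}\<close>; positivity makes the
  measure that they preserve finite.\<close>

locale circled_gauge =
  fixes H :: "complex^'n \<Rightarrow> real"
  assumes H_cont: "continuous_on UNIV H"
    and H_scale: "H (a *s z) = (cmod a)\<^sup>2 * H z"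
    and H_pos: "z \<noteq> 0 \<Longrightarrow> 0 < H z"
begin

definition model_domain :: "(complex \<times> (complex^'n)) set" where
  "model_domain = {p. H (snd p) < Im (fst p)}"

text \<open>The Jacobian of the Cayley transform onto the ball, up to a constant factor.\<close>

definition weight :: "complex \<Rightarrow> real" where
  "weight u = 1 / cmod (u + \<i>) ^ (2 * CARD('n) + 4)"

definition model_measure :: "(complex \<times> (complex^'n)) measure" where
  "model_measure = density lborel (\<lambda>p. indicator model_domain p * ennreal (weight (fst p)))"

lemma H_zero: "H 0 = 0"
  using H_scale[of 0 0] by simp

lemma H_nonneg: "0 \<le> H z"
  using H_pos[of z] H_zero by (cases "z = 0") auto

lemma open_model_domain: "open model_domain"
  unfolding model_domain_def
  by (intro open_Collect_less continuous_intros continuous_on_compose2[OF H_cont]) auto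

lemma model_domain_borel [measurable]: "model_domain \<in> sets borel"
  using open_model_domain by simp

lemma weight_nonneg: "0 \<le> weight u" by (simp add: weight_def)

lemma weight_pos: "0 < Im u \<Longrightarrow> 0 < weight u"
  using plus_i_nonzero[of u] by (simp add: weight_def)

lemma weight_borel [measurable]: "weight \<in> borel_measurable borel"
  unfolding weight_def[abs_def] by measurable

lemma model_density_borel [measurable]:
  "(\<lambda>p. indicator model_domain p * ennreal (weight (fst p))) \<in> borel_measurable borel"
proof -
  have [measurable]: "model_domain \<in> sets (borel \<Otimes>\<^sub>M borel)"
    using model_domain_borel unfolding borel_prod .
  have "(\<lambda>p. indicator model_domain p * ennreal (weight (fst p))) \<in> borel_measurable (borel \<Otimes>\<^sub>M borel)"
    by measurable
  then show ?thesis unfolding borel_prod .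
qed

lemma sets_model_measure [simp, measurable_cong]: "sets model_measure = sets borel"
  by (simp add: model_measure_def)

lemma space_model_measure [simp]: "space model_measure = UNIV"
  by (simp add: model_measure_def)

lemma model_domainD:
  assumes "p \<in> model_domain" shows "0 < Im (fst p)"
  using assms H_nonneg[of "snd p"] by (auto simp: model_domain_def)

lemma base_point_in_model_domain: "(\<i>, 0) \<in> model_domain"
  by (simp add: model_domain_def H_zero)

text \<open>All of the closed disc of parameters acts, not only the circle: in ball coordinates the map is
  multiplication by \<open>l\<close>.  This makes the circle average a mean value over a disc with centre \<open>l = 0\<close>.\<close>

lemma ball_rotation_in_model_domain:
  assumes p: "p \<in> model_domain" and l: "cmod l \<le> 1"
  shows "ball_rotation l p \<in> model_domain"
proof -
  obtain u z where p_eq: "p = (u, z)" by force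
  have u: "0 < Im u" and Hz: "H z < Im u" using model_domainD[OF p] p by (auto simp: p_eq model_domain_def)
  note d = moebius_den_nonzero[OF u l]
  define L where "L = (cmod l)\<^sup>2"
  have L: "0 \<le> L" "L \<le> 1" using l by (auto simp: L_def power_le_one)
  define m where "m = (cmod (u + \<i>))\<^sup>2"
  have m: "(cmod (u - \<i>))\<^sup>2 = m - 4 * Im u" "0 < m"
    using cmod_plus_i_sq[of u] plus_i_nonzero[OF u] zero_less_power2[of "cmod (u + \<i>)"]
    unfolding m_def by (linarith, simp)
  have "0 < m * (1 - L) + 4 * L * (Im u - H z)"
  proof (cases "L = 1")
    case False
    then have "0 < m * (1 - L)" using L m by simp
    moreover have "0 \<le> 4 * L * (Im u - H z)" using L Hz by simp
    ultimately show ?thesis by linarith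
  qed (use Hz in simp)
  then have "4 * L * H z < m - L * (m - 4 * Im u)" by (simp add: algebra_simps)
  moreover have "H ((2 * \<i> * l / moebius_den l u) *s z) = 4 * L * H z / (cmod (moebius_den l u))\<^sup>2"
    unfolding H_scale by (simp add: L_def norm_divide norm_mult power_divide power_mult_distrib)
  moreover have "Im (moebius_rotation l u) = (m - L * (m - 4 * Im u)) / (cmod (moebius_den l u))\<^sup>2"
    unfolding Im_moebius_rotation[OF d] m(1)[symmetric] by (simp add: m_def L_def)
  ultimately show ?thesis
    using d by (simp add: p_eq model_domain_def ball_rotation_def divide_strict_right_mono)
qed

lemma ball_rotation_model_domain_iff:
  assumes u: "0 < Im u" and l: "cmod l = 1"
  shows "ball_rotation l (u, z) \<in> model_domain \<longleftrightarrow> (u, z) \<in> model_domain"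
proof -
  have d: "moebius_den l u \<noteq> 0" using moebius_den_nonzero[OF u] l by simp
  have "Im (moebius_rotation l u) = 4 * Im u / (cmod (moebius_den l u))\<^sup>2"
    using Im_moebius_rotation[OF d] l cmod_plus_i_sq[of u] by simp
  moreover have "H ((2 * \<i> * l / moebius_den l u) *s z) = 4 * H z / (cmod (moebius_den l u))\<^sup>2"
    unfolding H_scale using l by (simp add: norm_divide norm_mult power_divide power_mult_distrib)
  ultimately show ?thesis
    using d by (simp add: model_domain_def ball_rotation_def divide_less_cancel)
qed

lemma ball_rotation_borel [measurable (raw)]:
  fixes f :: "'a \<Rightarrow> complex" and g :: "'a \<Rightarrow> complex \<times> (complex^'n)"
  assumes [measurable]: "f \<in> borel_measurable M" "g \<in> borel_measurable M"
  shows "(\<lambda>x. ball_rotation (f x) (g x)) \<in> borel_measurable M"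
proof -
  have [measurable]: "(\<lambda>x. fst (g x)) \<in> borel_measurable M" "(\<lambda>x. snd (g x)) \<in> borel_measurable M"
    using measurable_compose[OF assms(2)[folded borel_prod] measurable_fst]
      measurable_compose[OF assms(2)[folded borel_prod] measurable_snd] by auto
  show ?thesis unfolding ball_rotation_def moebius_rotation_def moebius_den_def
    by (intro borel_measurable_Pair borel_measurable_vscale) measurable
qed

text \<open>On the fibre over \<open>u\<close> the rotation is a complex dilation, on the base it is a Moebius map.  The exponent in
  the weight is the one for which the two Jacobians cancel.\<close>

lemma nn_integral_model_rotation:
  fixes F :: "complex \<times> (complex^'n) \<Rightarrow> ennreal"
  assumes l: "cmod l = 1" and F[measurable]: "F \<in> borel_measurable borel"
  shows "(\<integral>\<^sup>+p. F (ball_rotation l p) \<partial>model_measure) = (\<integral>\<^sup>+p. F p \<partial>model_measure)"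
proof -
  have [measurable]: "F \<in> borel_measurable (borel \<Otimes>\<^sub>M borel)" "model_domain \<in> sets (borel \<Otimes>\<^sub>M borel)"
    using F model_domain_borel unfolding borel_prod by auto
  let ?I = "indicator model_domain :: _ \<Rightarrow> ennreal"
  let ?h = "indicator {u::complex. 0 < Im u} :: complex \<Rightarrow> ennreal"
  define \<Psi> where "\<Psi> u = ennreal (weight u) * (\<integral>\<^sup>+z. ?I (u, z) * F (u, z) \<partial>lborel)" for u
  have [measurable]: "\<Psi> \<in> borel_measurable borel"
    unfolding \<Psi>_def by measurable
  have split: "(\<integral>\<^sup>+p. G p \<partial>model_measure) = (\<integral>\<^sup>+u. ?h u * (ennreal (weight u) * (\<integral>\<^sup>+z. ?I (u, z) * G (u, z) \<partial>lborel)) \<partial>lborel)"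
    if G[measurable]: "G \<in> borel_measurable borel" for G :: "complex \<times> (complex^'n) \<Rightarrow> ennreal"
  proof -
    have [measurable]: "G \<in> borel_measurable (borel \<Otimes>\<^sub>M borel)" using G unfolding borel_prod .
    have "(\<integral>\<^sup>+p. G p \<partial>model_measure) = (\<integral>\<^sup>+p. ?I p * ennreal (weight (fst p)) * G p \<partial>(lborel \<Otimes>\<^sub>M lborel))"
      unfolding model_measure_def lborel_prod
      using G model_density_borel by (intro nn_integral_density) simp_all
    also have "\<dots> = (\<integral>\<^sup>+u. (\<integral>\<^sup>+z. ?I (u, z) * ennreal (weight u) * G (u, z) \<partial>lborel) \<partial>lborel)"
      by (subst lborel.nn_integral_fst[symmetric]) auto
    also have "\<dots> = (\<integral>\<^sup>+u. ?h u * (ennreal (weight u) * (\<integral>\<^sup>+z. ?I (u, z) * G (u, z) \<partial>lborel)) \<partial>lborel)"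
    proof (intro nn_integral_cong)
      fix u :: complex
      have "(\<integral>\<^sup>+z. ?I (u, z) * ennreal (weight u) * G (u, z) \<partial>lborel) =
        (\<integral>\<^sup>+z. ?h u * ennreal (weight u) * (?I (u, z) * G (u, z)) \<partial>lborel)"
        using model_domainD[of "(u, _)"]
        by (intro nn_integral_cong) (auto simp: indicator_def)
      also have "\<dots> = ?h u * ennreal (weight u) * (\<integral>\<^sup>+z. ?I (u, z) * G (u, z) \<partial>lborel)"
        by (rule nn_integral_cmult) measurable
      finally show "(\<integral>\<^sup>+z. ?I (u, z) * ennreal (weight u) * G (u, z) \<partial>lborel) =
        ?h u * (ennreal (weight u) * (\<integral>\<^sup>+z. ?I (u, z) * G (u, z) \<partial>lborel))" by (simp add: mult.assoc)
    qed
    finally show ?thesis .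
  qed
  \<comment> \<open>\<open>n\<close> fibre coordinates give \<open>|a|\<^sup>2\<^sup>n\<close>; the weight leaves exactly \<open>16 / |den|\<^sup>4\<close>, the Jacobian on the base.\<close>
  have fibre: "ennreal (weight u) * (\<integral>\<^sup>+z. ?I (u, z) * F (ball_rotation l (u, z)) \<partial>lborel) =
      ennreal (16 / cmod (moebius_den l u) ^ 4) * \<Psi> (moebius_rotation l u)" if u: "0 < Im u" for u
  proof -
    let ?d = "moebius_den l u"
    have d: "?d \<noteq> 0" using moebius_den_nonzero[OF u] l by simp
    define a where "a = 2 * \<i> * l / ?d"
    have a: "a \<noteq> 0" "cmod a = 2 / cmod ?d" using d l by (auto simp: a_def norm_divide norm_mult)
    have ui: "cmod (u + \<i>) > 0" using plus_i_nonzero[OF u] by simp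
    have "(16 / cmod ?d ^ 4) * weight (moebius_rotation l u) * cmod a ^ (2 * CARD('n)) =
        (2 / cmod ?d) ^ (2 * CARD('n) + 4) / (2 * cmod (u + \<i>) / cmod ?d) ^ (2 * CARD('n) + 4)"
      unfolding weight_def moebius_rotation_plus_i[OF d] norm_divide norm_mult a(2)
      by (simp add: power_add[of _ _ 4] power_divide)
    also have "\<dots> = (1 / cmod (u + \<i>)) ^ (2 * CARD('n) + 4)"
      unfolding power_divide[symmetric] using d ui by simp
    also have "\<dots> = weight u" by (simp only: weight_def power_one_over)
    finally have w: "weight u = (16 / cmod ?d ^ 4) * weight (moebius_rotation l u) * cmod a ^ (2 * CARD('n))" by simp
    have wE: "ennreal (weight u) = ennreal (16 / cmod ?d ^ 4) * ennreal (weight (moebius_rotation l u)) * ennreal (cmod a ^ (2 * CARD('n)))"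
    proof -
      have n: "0 \<le> 16 / cmod ?d ^ 4" "0 \<le> cmod a ^ (2 * CARD('n))" by simp_all
      show ?thesis
        by (subst w) (simp only: ennreal_mult[OF mult_nonneg_nonneg[OF n(1) weight_nonneg] n(2)]
          ennreal_mult[OF n(1) weight_nonneg])
    qed
    have I1: "(\<integral>\<^sup>+z. ?I (u, z) * F (ball_rotation l (u, z)) \<partial>lborel) =
      (\<integral>\<^sup>+z. ?I (moebius_rotation l u, \<chi> i. a * z $ i) * F (moebius_rotation l u, \<chi> i. a * z $ i) \<partial>lborel)"
      using ball_rotation_model_domain_iff[OF u l]
      by (intro nn_integral_cong) (auto simp: indicator_def ball_rotation_def a_def vector_scalar_mult_def)
    have I2: "ennreal (cmod a ^ (2 * CARD('n))) *
        (\<integral>\<^sup>+z. ?I (moebius_rotation l u, \<chi> i. a * z $ i) * F (moebius_rotation l u, \<chi> i. a * z $ i) \<partial>lborel) =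
        (\<integral>\<^sup>+z. ?I (moebius_rotation l u, z) * F (moebius_rotation l u, z) \<partial>lborel)"
      by (rule nn_integral_complex_scaling[symmetric, OF a(1)]) measurable
    show ?thesis unfolding \<Psi>_def wE I1 by (simp only: mult.assoc I2)
  qed
  have "(\<integral>\<^sup>+p. F (ball_rotation l p) \<partial>model_measure) =
     (\<integral>\<^sup>+u. ?h u * ennreal (16 / cmod (moebius_den l u) ^ 4) * \<Psi> (moebius_rotation l u) \<partial>lborel)"
    by (subst split) (auto simp: fibre mult.assoc split: split_indicator intro!: nn_integral_cong)
  also have "\<dots> = (\<integral>\<^sup>+u. ?h u * \<Psi> u \<partial>lborel)"
    by (rule nn_integral_moebius_rotation[OF l, symmetric]) measurable
  also have "\<dots> = (\<integral>\<^sup>+p. F p \<partial>model_measure)"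
    unfolding \<Psi>_def by (rule split[symmetric]) measurable
  finally show ?thesis .
qed

lemma distr_model_rotation:
  assumes l: "cmod l = 1"
  shows "distr model_measure borel (ball_rotation l) = model_measure"
proof (rule measure_eqI)
  fix A assume "A \<in> sets (distr model_measure borel (ball_rotation l))"
  then have [measurable]: "A \<in> sets borel" by simp
  have "emeasure (distr model_measure borel (ball_rotation l)) A =
      (\<integral>\<^sup>+p. indicator A p \<partial>distr model_measure borel (ball_rotation l))" by simp
  also have "\<dots> = (\<integral>\<^sup>+p. indicator A (ball_rotation l p) \<partial>model_measure)"
    by (rule nn_integral_distr) measurable
  also have "\<dots> = (\<integral>\<^sup>+p. indicator A p \<partial>model_measure)"
    by (rule nn_integral_model_rotation[OF l]) measurable
  finally show "emeasure (distr model_measure borel (ball_rotation l)) A = emeasure model_measure A"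
    by simp
qed simp

lemma H_lower_bound: "\<exists>k>0. \<forall>z. k * (norm z)\<^sup>2 \<le> H z"
proof -
  have "compact (sphere (0::complex^'n) 1)" by simp
  moreover have "sphere (0::complex^'n) 1 \<noteq> {}"
  proof -
    obtain x :: "complex^'n" where "norm x = 1" by (rule vector_choose_size[of 1]) auto
    then have "x \<in> sphere 0 1" by simp
    then show ?thesis by blast
  qed
  ultimately obtain x where x: "x \<in> sphere 0 1" "\<forall>y\<in>sphere 0 1. H x \<le> H y"
    using continuous_attains_inf[of "sphere 0 1" H] H_cont continuous_on_subset by blast
  show ?thesis
  proof (intro exI[of _ "H x"] conjI allI)
    show "0 < H x" using x(1) by (intro H_pos) auto
    fix z
    show "H x * (norm z)\<^sup>2 \<le> H z"
    proof (cases "z = 0")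
      case False
      let ?w = "complex_of_real (1 / norm z) *s z"
      have w: "?w = (1 / norm z) *\<^sub>R z"
        by (simp add: vec_eq_iff scaleR_conv_of_real[where 'a=complex])
      have "?w \<in> sphere 0 1" unfolding w using False by simp
      then have "H x \<le> H ?w" using x(2) by blast
      also have "\<dots> = H z / (norm z)\<^sup>2" unfolding H_scale by (simp add: norm_divide power_divide)
      finally show ?thesis using False by (simp add: pos_le_divide_eq)
    qed (simp add: H_zero)
  qed
qed

text \<open>The fibre over \<open>u\<close> lies in a ball of radius a multiple of \<open>\<surd>(Im u)\<close>, so its volume is absorbed by \<open>2n\<close> of
  the factors of the weight.  The remaining four are integrable over the half plane.\<close>

lemma model_measure_finite: "emeasure model_measure UNIV < \<infinity>"
proof -
  obtain k where k: "0 < k" "\<And>z. k * (norm z)\<^sup>2 \<le> H z" using H_lower_bound by blast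
  define V where "V = unit_ball_vol (real (DIM(complex^'n)))"
  have V: "0 \<le> V" by (simp add: V_def)
  have [measurable]: "model_domain \<in> sets (borel \<Otimes>\<^sub>M borel)"
    using model_domain_borel unfolding borel_prod .
  let ?I = "indicator model_domain :: _ \<Rightarrow> ennreal"
  let ?h = "indicator {u::complex. 0 < Im u} :: complex \<Rightarrow> ennreal"
  have "emeasure model_measure UNIV = (\<integral>\<^sup>+p. ?I p * ennreal (weight (fst p)) \<partial>(lborel \<Otimes>\<^sub>M lborel))"
    unfolding model_measure_def lborel_prod using model_density_borel by (subst emeasure_density) simp_all
  also have "\<dots> = (\<integral>\<^sup>+u. (\<integral>\<^sup>+z. ?I (u, z) * ennreal (weight u) \<partial>lborel) \<partial>lborel)"
    by (subst lborel.nn_integral_fst[symmetric]) auto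
  also have "\<dots> \<le> (\<integral>\<^sup>+u. ennreal (V / k ^ CARD('n)) * (?h u * ennreal (1 / cmod (u + \<i>) ^ 4)) \<partial>lborel)"
  proof (intro nn_integral_mono)
    fix u :: complex
    show "(\<integral>\<^sup>+z. ?I (u, z) * ennreal (weight u) \<partial>lborel) \<le> ennreal (V / k ^ CARD('n)) * (?h u * ennreal (1 / cmod (u + \<i>) ^ 4))"
    proof (cases "0 < Im u")
      case False
      then have "?I (u, z) = 0" for z using model_domainD[of "(u, z)"] by (auto simp: indicator_def)
      then show ?thesis by simp
    next
      case True
      define r where "r = sqrt (Im u / k)"
      have r: "0 < r" "r\<^sup>2 = Im u / k" 
        unfolding r_def using divide_pos_pos[OF True k(1)] by (simp_all only: real_sqrt_gt_zero real_sqrt_pow2 less_imp_le)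
      have sub: "z \<in> cball 0 r" if "(u, z) \<in> model_domain" for z
      proof -
        have "H z < Im u" using that by (simp add: model_domain_def)
        with k(2)[of z] have "k * (norm z)\<^sup>2 \<le> Im u" by linarith
        then have "(norm z)\<^sup>2 \<le> Im u / k" by (subst pos_le_divide_eq[OF k(1)]) (simp only: mult.commute)
        then have "norm z \<le> r" unfolding r(2)[symmetric] by (rule power2_le_imp_le) (rule less_imp_le[OF r(1)])
        then show ?thesis by simp
      qed
      have "(\<integral>\<^sup>+z. ?I (u, z) * ennreal (weight u) \<partial>lborel) \<le> (\<integral>\<^sup>+z. ennreal (weight u) * indicator (cball (0::complex^'n) r) z \<partial>lborel)"
        by (intro nn_integral_mono) (use sub in \<open>auto split: split_indicator\<close>)
      also have "\<dots> = ennreal (weight u) * emeasure lborel (cball (0::complex^'n) r)"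
        by (rule nn_integral_cmult_indicator) simp
      also have "emeasure lborel (cball (0::complex^'n) r) = ennreal (V * r ^ (2 * CARD('n)))"
        using r(1) by (subst emeasure_cball) (simp_all add: V_def mult.commute)
      also have "ennreal (weight u) * \<dots> = ennreal (weight u * (V * r ^ (2 * CARD('n))))"
        using V r by (intro ennreal_mult[symmetric] weight_nonneg) auto
      also have "\<dots> \<le> ennreal (V / k ^ CARD('n) * (1 / cmod (u + \<i>) ^ 4))"
      proof (rule ennreal_leI)
        let ?c = "cmod (u + \<i>)"
        have c: "0 < ?c" using plus_i_nonzero[OF True] by simp
        have "Im u \<le> (1 + Im u)\<^sup>2" using True by (simp add: power2_eq_square algebra_simps)
        also have "\<dots> \<le> ?c\<^sup>2" unfolding cmod_power2 by (simp add: add.commute)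
        finally have "Im u ^ CARD('n) \<le> (?c\<^sup>2) ^ CARD('n)" using True by (intro power_mono) auto
        then have "Im u ^ CARD('n) / (?c\<^sup>2) ^ CARD('n) \<le> 1"
          using c by (subst pos_divide_le_eq) simp_all
        moreover have "weight u * (V * r ^ (2 * CARD('n))) =
            (V / k ^ CARD('n) * (1 / ?c ^ 4)) * (Im u ^ CARD('n) / (?c\<^sup>2) ^ CARD('n))"
          unfolding power_mult[of _ 2 "CARD('n)"] r(2) weight_def power_add[of _ _ 4] power_divide by simp
        moreover have "0 \<le> V / k ^ CARD('n) * (1 / ?c ^ 4)" using V k(1) by simp
        ultimately show "weight u * (V * r ^ (2 * CARD('n))) \<le> V / k ^ CARD('n) * (1 / ?c ^ 4)"
          by (simp only: mult_left_le)
      qed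
      also have "\<dots> = ennreal (V / k ^ CARD('n)) * (?h u * ennreal (1 / cmod (u + \<i>) ^ 4))"
      proof -
        have n: "0 \<le> V / k ^ CARD('n)" "0 \<le> 1 / cmod (u + \<i>) ^ 4" using V k(1) by simp_all
        show ?thesis using True unfolding ennreal_mult[OF n] by simp
      qed
      finally show ?thesis .
    qed
  qed
  also have "\<dots> = ennreal (V / k ^ CARD('n)) * (\<integral>\<^sup>+u. ?h u * ennreal (1 / cmod (u + \<i>) ^ 4) \<partial>lborel)"
    by (rule nn_integral_cmult) measurable
  also have "\<dots> < \<infinity>"
    using nn_integral_half_plane_finite by (simp add: ennreal_mult_less_top)
  finally show ?thesis .
qed

lemma model_measure_positive: "0 < emeasure model_measure UNIV"
proof (rule ccontr)
  assume "\<not> 0 < emeasure model_measure UNIV"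
  then have "(\<integral>\<^sup>+p. indicator model_domain p * ennreal (weight (fst p)) \<partial>lborel) = 0"
    unfolding model_measure_def using model_density_borel by (subst (asm) emeasure_density) simp_all
  then have "AE p in lborel. indicator model_domain p * ennreal (weight (fst p)) = 0"
    using model_density_borel by (subst (asm) nn_integral_0_iff_AE) simp_all
  moreover have wp: "0 < weight (fst p)" if "p \<in> model_domain" for p
    using that by (intro weight_pos model_domainD)
  ultimately have "AE p in lborel. p \<notin> model_domain"
  proof (elim eventually_mono)
    fix p assume *: "indicator model_domain p * ennreal (weight (fst p)) = 0"
    show "p \<notin> model_domain"
    proof
      assume "p \<in> model_domain"
      with * wp[of p] show False by simp
    qed
  qed
  then have "emeasure lborel model_domain = 0"
    by (subst (asm) AE_iff_measurable[OF _ refl]) auto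
  then have "model_domain \<in> null_sets lborel" by (auto simp: null_sets_def)
  then have "negligible model_domain"
    by (simp add: negligible_iff_null_sets null_sets_completionI)
  then show False
    using open_not_negligible[OF open_model_domain] base_point_in_model_domain by blast
qed

end

section \<open>Reproducing functions of Bergman spaces\<close>

lemma J_complex: "J (x::complex) = \<i> * x" by (simp add: J_complex_def)

lemma J_pair: "J (a, b) = (J a, J b)" by (simp add: J_prod_def)

lemma J_cvec: "J (v::complex^'n) = \<i> *s v"
  by (simp add: J_vec_def vec_eq_iff J_complex)

definition holo_map_on :: "'a::complex_structure set \<Rightarrow> ('a \<Rightarrow> 'b::complex_structure) \<Rightarrow> bool" where
  "holo_map_on S \<phi> \<longleftrightarrow> (\<forall>p\<in>S. \<exists>D. (\<phi> has_derivative D) (at p) \<and> (\<forall>v. D (J v) = J (D v)))"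

lemma holo_on_iff_holo_map_on: "holo_on S f \<longleftrightarrow> holo_map_on S f"
  by (simp add: holo_on_def holo_map_on_def J_complex)

lemma holo_map_on_subset: "holo_map_on S f \<Longrightarrow> T \<subseteq> S \<Longrightarrow> holo_map_on T f"
  by (auto simp: holo_map_on_def)

lemma holo_map_on_divide_const:
  fixes f :: "'a::complex_structure \<Rightarrow> complex"
  assumes "holo_map_on S f" shows "holo_map_on S (\<lambda>x. f x / c)"
  unfolding holo_map_on_def
proof
  fix p assume "p \<in> S"
  then obtain D where D: "(f has_derivative D) (at p)" "\<And>v. D (J v) = J (D v)"
    using assms unfolding holo_map_on_def by blast
  have "((\<lambda>x. f x * inverse c) has_derivative (\<lambda>v. D v * inverse c)) (at p)"
    by (rule has_derivative_mult_left[OF D(1)])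
  then show "\<exists>D. ((\<lambda>x. f x / c) has_derivative D) (at p) \<and> (\<forall>v. D (J v) = J (D v))"
    using D(2) by (intro exI[of _ "\<lambda>v. D v * inverse c"]) (simp add: J_complex divide_inverse)
qed

lemma holo_map_on_compose:
  assumes f: "holo_map_on S f" and g: "holo_map_on T g" and sub: "\<And>p. p \<in> T \<Longrightarrow> g p \<in> S"
  shows "holo_map_on T (\<lambda>p. f (g p))"
  unfolding holo_map_on_def
proof
  fix p assume p: "p \<in> T"
  obtain D where D: "(g has_derivative D) (at p)" "\<And>v. D (J v) = J (D v)"
    using g p unfolding holo_map_on_def by blast
  obtain E where E: "(f has_derivative E) (at (g p))" "\<And>v. E (J v) = J (E v)"
    using f sub[OF p] unfolding holo_map_on_def by blast
  show "\<exists>D. ((\<lambda>p. f (g p)) has_derivative D) (at p) \<and> (\<forall>v. D (J v) = J (D v))"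
    using has_derivative_compose[OF D(1) E(1)] D(2) E(2) by (intro exI[of _ "\<lambda>v. E (D v)"]) auto
qed

lemma field_differentiable_iff_holo:
  fixes f :: "complex \<Rightarrow> complex"
  shows "f field_differentiable (at z) \<longleftrightarrow> holo_map_on {z} f"
proof
  assume "f field_differentiable (at z)"
  then obtain c where "(f has_derivative (*) c) (at z)"
    by (auto simp: field_differentiable_def has_field_derivative_def)
  then show "holo_map_on {z} f"
    by (auto simp: holo_map_on_def J_complex intro!: exI[of _ "(*) c"])
next
  assume "holo_map_on {z} f"
  then obtain D where D: "(f has_derivative D) (at z)" "\<And>v. D (\<i> * v) = \<i> * D v"
    by (auto simp: holo_map_on_def J_complex)
  have lin: "linear D" using D(1) has_derivative_linear by blast
  have "D v = D 1 * v" for v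
  proof -
    have "D v = D (Re v *\<^sub>R 1 + Im v *\<^sub>R (\<i> * 1))"
      by (rule arg_cong[of _ _ D]) (simp add: complex_eq_iff)
    also have "\<dots> = Re v *\<^sub>R D 1 + Im v *\<^sub>R (\<i> * D 1)"
      by (simp only: linear_add[OF lin] linear_scale[OF lin] D(2))
    also have "\<dots> = D 1 * v" by (simp add: complex_eq_iff algebra_simps)
    finally show ?thesis .
  qed
  then obtain c where "\<And>v. D v = c * v" by blast
  then have "D = (*) c" by (intro ext)
  from D(1)[unfolded this] show "f field_differentiable (at z)"
    unfolding field_differentiable_def has_field_derivative_def by (rule exI)
qed

lemma has_integral_circle_mean:
  assumes c: "continuous_on (cball 0 1) f" and h: "f holomorphic_on ball 0 1"
  shows "((\<lambda>t. f (exp (2 * of_real pi * \<i> * of_real t))) has_integral f 0) {0..1}"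
proof -
  let ?e = "\<lambda>t::real. exp (2 * of_real pi * \<i> * of_real t)"
  have "((\<lambda>u. f u / (u - 0)) has_contour_integral 2 * of_real pi * \<i> * f 0) (circlepath 0 1)"
    using c h by (intro Cauchy_integral_circlepath) auto
  then have "((\<lambda>x. f (circlepath 0 1 x) / (circlepath 0 1 x - 0) *
      vector_derivative (circlepath 0 1) (at x within {0..1})) has_integral 2 * of_real pi * \<i> * f 0) {0..1}"
    by (simp add: has_contour_integral_def)
  then have "((\<lambda>x. 2 * of_real pi * \<i> * f (?e x)) has_integral 2 * of_real pi * \<i> * f 0) {0..1}"
    by (rule has_integral_eq[rotated]) (simp add: vector_derivative_circlepath01, simp add: circlepath)
  then have "((\<lambda>x. (1 / (2 * of_real pi * \<i>)) * (2 * of_real pi * \<i> * f (?e x))) has_integral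
      (1 / (2 * of_real pi * \<i>)) * (2 * of_real pi * \<i> * f 0)) {0..1}"
    by (rule has_integral_mult_right)
  then show ?thesis by simp
qed

lemma holo_on_borel:
  fixes D :: "'a::{complex_structure, euclidean_space} set"
  assumes "open D" "holo_on D f"
  shows "(\<lambda>x. if x \<in> D then f x else 0) \<in> borel_measurable borel"
  using assms by (intro borel_measurable_continuous_on_if) (auto intro: holo_on_continuous_on)

definition reproduces :: "'a::{complex_structure, euclidean_space} set \<Rightarrow> 'a \<Rightarrow> ('a \<Rightarrow> complex) \<Rightarrow> bool" where
  "reproduces D y k \<longleftrightarrow> k \<in> bergman_space D \<and>
     (\<forall>f\<in>bergman_space D. f y = (LINT \<xi>:D|lborel. f \<xi> * cnj (k \<xi>)))"

lemma borel_measurable_cnj [measurable (raw)]: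
  assumes "f \<in> borel_measurable M" shows "(\<lambda>x. cnj (f x)) \<in> borel_measurable M"
  using assms by (rule borel_measurable_continuous_on[rotated]) (intro continuous_intros)

lemma bergman_space_product_integrable:
  assumes D: "open D" and f: "f \<in> bergman_space D" and k: "k \<in> bergman_space D"
  shows "set_integrable lborel D (\<lambda>x. f x * cnj (k x))"
  unfolding set_integrable_def
proof (rule Bochner_Integration.integrable_bound)
  define f0 where "f0 x = (if x \<in> D then f x else 0)" for x
  define k0 where "k0 x = (if x \<in> D then k x else 0)" for x
  have [measurable]: "f0 \<in> borel_measurable borel" "k0 \<in> borel_measurable borel"
    unfolding f0_def k0_def using f k D by (simp_all add: bergman_space_def holo_on_borel)
  show "integrable lborel (\<lambda>x. indicator D x *\<^sub>R (cmod (f x))\<^sup>2 + indicator D x *\<^sub>R (cmod (k x))\<^sup>2)"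
    using f k by (auto simp: bergman_space_def set_integrable_def)
  have "(\<lambda>x. indicator D x *\<^sub>R (f x * cnj (k x))) = (\<lambda>x. f0 x * cnj (k0 x))"
    by (auto simp: indicator_def f0_def k0_def)
  also have "\<dots> \<in> borel_measurable lborel" by measurable
  finally show "(\<lambda>x. indicator D x *\<^sub>R (f x * cnj (k x))) \<in> borel_measurable lborel" .
  show "AE x in lborel. norm (indicator D x *\<^sub>R (f x * cnj (k x))) \<le>
      norm (indicator D x *\<^sub>R (cmod (f x))\<^sup>2 + indicator D x *\<^sub>R (cmod (k x))\<^sup>2)"
  proof (intro AE_I2)
    fix x
    have "2 * (cmod (f x) * cmod (k x)) \<le> (cmod (f x))\<^sup>2 + (cmod (k x))\<^sup>2"
      using sum_squares_bound[of "cmod (f x)" "cmod (k x)"] by (simp only: mult.assoc)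
    moreover have "0 \<le> cmod (f x) * cmod (k x)" by simp
    ultimately have "cmod (f x) * cmod (k x) \<le> (cmod (f x))\<^sup>2 + (cmod (k x))\<^sup>2" by linarith
    then show "norm (indicator D x *\<^sub>R (f x * cnj (k x))) \<le>
      norm (indicator D x *\<^sub>R (cmod (f x))\<^sup>2 + indicator D x *\<^sub>R (cmod (k x))\<^sup>2)"
      by (auto simp: indicator_def norm_mult)
  qed
qed

lemma bergman_space_diff:
  assumes D: "open D" and f: "f \<in> bergman_space D" and k: "k \<in> bergman_space D"
  shows "(\<lambda>x. f x - k x) \<in> bergman_space D"
proof -
  have hf: "holo_on D f" and hk: "holo_on D k" using f k by (auto simp: bergman_space_def)
  have hd: "holo_on D (\<lambda>x. f x - k x)"
    unfolding holo_on_def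
  proof
    fix p assume "p \<in> D"
    then obtain F K where "(f has_derivative F) (at p)" "\<And>v. F (J v) = \<i> * F v"
      "(k has_derivative K) (at p)" "\<And>v. K (J v) = \<i> * K v"
      using hf hk unfolding holo_on_def by meson
    then show "\<exists>D. ((\<lambda>x. f x - k x) has_derivative D) (at p) \<and> (\<forall>v. D (J v) = \<i> * D v)"
      by (intro exI[of _ "\<lambda>v. F v - K v"]) (auto intro!: has_derivative_diff simp: right_diff_distrib)
  qed
  have "set_integrable lborel D (\<lambda>x. (cmod (f x - k x))\<^sup>2)"
    unfolding set_integrable_def
  proof (rule Bochner_Integration.integrable_bound)
    let ?d = "\<lambda>x. if x \<in> D then f x - k x else 0"
    have [measurable]: "?d \<in> borel_measurable borel" using hd D by (intro holo_on_borel)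
    show "integrable lborel (\<lambda>x. 2 * (indicator D x *\<^sub>R (cmod (f x))\<^sup>2 + indicator D x *\<^sub>R (cmod (k x))\<^sup>2))"
      using f k by (auto simp: bergman_space_def set_integrable_def)
    have "(\<lambda>x. indicator D x *\<^sub>R (cmod (f x - k x))\<^sup>2) = (\<lambda>x. (cmod (?d x))\<^sup>2)"
      by (auto simp: indicator_def)
    also have "\<dots> \<in> borel_measurable lborel" by measurable
    finally show "(\<lambda>x. indicator D x *\<^sub>R (cmod (f x - k x))\<^sup>2) \<in> borel_measurable lborel" .
    show "AE x in lborel. norm (indicator D x *\<^sub>R (cmod (f x - k x))\<^sup>2) \<le>
        norm (2 * (indicator D x *\<^sub>R (cmod (f x))\<^sup>2 + indicator D x *\<^sub>R (cmod (k x))\<^sup>2))"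
    proof (intro AE_I2)
      fix x
      have "(cmod (f x - k x))\<^sup>2 \<le> (cmod (f x) + cmod (k x))\<^sup>2"
        by (intro power_mono norm_triangle_ineq4) simp
      also have "\<dots> \<le> 2 * ((cmod (f x))\<^sup>2 + (cmod (k x))\<^sup>2)"
        using sum_squares_bound[of "cmod (f x)" "cmod (k x)"] by (simp add: power2_sum)
      finally show "norm (indicator D x *\<^sub>R (cmod (f x - k x))\<^sup>2) \<le>
        norm (2 * (indicator D x *\<^sub>R (cmod (f x))\<^sup>2 + indicator D x *\<^sub>R (cmod (k x))\<^sup>2))"
        by (auto simp: indicator_def)
    qed
  qed
  with hd show ?thesis by (simp add: bergman_space_def)
qed

lemma AE_zero_imp_zero_on_open:
  fixes D :: "'a::euclidean_space set" and f :: "'a \<Rightarrow> 'b::real_normed_vector"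
  assumes D: "open D" and c: "continuous_on D f" and ae: "AE x in lborel. x \<in> D \<longrightarrow> f x = 0"
    and x: "x \<in> D"
  shows "f x = 0"
proof (rule ccontr)
  assume "f x \<noteq> 0"
  define U where "U = D \<inter> f -` (- {0})"
  have "open U" unfolding U_def using D c by (intro continuous_open_preimage) auto
  have "x \<in> U" using x \<open>f x \<noteq> 0\<close> by (simp add: U_def)
  have "AE x in lborel. x \<notin> U" using ae by eventually_elim (auto simp: U_def)
  then have "emeasure lborel U = 0"
    using \<open>open U\<close> by (subst (asm) AE_iff_measurable[OF _ refl]) auto
  then have "negligible U"
    using \<open>open U\<close> by (simp add: negligible_iff_null_sets null_sets_completionI null_sets_def)
  then show False using open_not_negligible[OF \<open>open U\<close>] \<open>x \<in> U\<close> by blast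
qed

text \<open>The difference of two reproducing functions is orthogonal to itself, hence zero almost everywhere, and by
  continuity everywhere on the domain.\<close>

lemma reproduces_unique:
  assumes D: "open D" and k: "reproduces D y k" and k': "reproduces D y k'" and x: "x \<in> D"
  shows "k x = k' x"
proof -
  define d where "d = (\<lambda>x. k x - k' x)"
  have K: "k \<in> bergman_space D" "k' \<in> bergman_space D" using k k' by (auto simp: reproduces_def)
  have d: "d \<in> bergman_space D" unfolding d_def using D K by (rule bergman_space_diff)
  have "(LINT \<xi>:D|lborel. d \<xi> * cnj (k \<xi>)) = d y" "(LINT \<xi>:D|lborel. d \<xi> * cnj (k' \<xi>)) = d y"
    using k k' d by (auto simp: reproduces_def)
  then have "(LINT \<xi>:D|lborel. d \<xi> * cnj (k \<xi>) - d \<xi> * cnj (k' \<xi>)) = 0"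
    using bergman_space_product_integrable[OF D d] K by (subst set_integral_diff) auto
  moreover have "d \<xi> * cnj (k \<xi>) - d \<xi> * cnj (k' \<xi>) = of_real ((cmod (d \<xi>))\<^sup>2)" for \<xi>
    unfolding complex_norm_square by (simp add: d_def algebra_simps)
  ultimately have "(LINT \<xi>|lborel. complex_of_real (indicator D \<xi> * (cmod (d \<xi>))\<^sup>2)) = 0"
    by (simp add: set_lebesgue_integral_def scaleR_conv_of_real)
  then have z: "(LINT \<xi>|lborel. indicator D \<xi> * (cmod (d \<xi>))\<^sup>2) = 0"
    by (simp only: integral_complex_of_real of_real_eq_0_iff)
  have "integrable lborel (\<lambda>\<xi>. indicator D \<xi> * (cmod (d \<xi>))\<^sup>2)"
    using d by (simp add: bergman_space_def set_integrable_def)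
  then have "AE \<xi> in lborel. indicator D \<xi> * (cmod (d \<xi>))\<^sup>2 = 0"
    using z by (subst (asm) integral_nonneg_eq_0_iff_AE) auto
  then have "AE \<xi> in lborel. \<xi> \<in> D \<longrightarrow> d \<xi> = 0" by eventually_elim auto
  moreover have "continuous_on D d" using d by (auto simp: bergman_space_def intro: holo_on_continuous_on)
  ultimately have "d x = 0" using AE_zero_imp_zero_on_open[OF D] x by blast
  then show ?thesis by (simp add: d_def)
qed

lemma bergman_kernel_eqI:
  assumes "open D" "reproduces D y k" "x \<in> D"
  shows "bergman_kernel D x y = k x"
  unfolding bergman_kernel_def
proof (rule the_equality)
  show "\<exists>k'\<in>bergman_space D. (\<forall>f\<in>bergman_space D. f y = (LINT \<xi>:D|lborel. f \<xi> * cnj (k' \<xi>))) \<and> k x = k' x"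
    using assms(2) by (auto simp: reproduces_def)
  show "c = k x" if "\<exists>k'\<in>bergman_space D. (\<forall>f\<in>bergman_space D. f y = (LINT \<xi>:D|lborel. f \<xi> * cnj (k' \<xi>))) \<and> c = k' x" for c
    using that reproduces_unique[OF assms(1) _ assms(2,3)] by (auto simp: reproduces_def)
qed

text \<open>Because the real Jacobian is a constant \<open>c\<close>, composition with \<open>\<Psi>\<close> is a multiple of an isometry between the
  Bergman spaces, and it turns evaluation at \<open>\<Psi> y\<close> into evaluation at \<open>y\<close>.\<close>

lemma reproduces_transport:
  fixes \<Psi> \<Psi>' :: "'a::{complex_structure, euclidean_space} \<Rightarrow> 'a"
  assumes inv: "\<And>p. \<Psi> (\<Psi>' p) = p" "\<And>p. \<Psi>' (\<Psi> p) = p"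
    and holo: "holo_map_on UNIV \<Psi>" "holo_map_on UNIV \<Psi>'"
    and J: "0 < c" "lborel = density (distr lborel borel \<Psi>) (\<lambda>_. ennreal c)"
    and D: "open D"
    and rep: "reproduces (\<Psi> -` D) y k"
  shows "reproduces D (\<Psi> y) (\<lambda>p. k (\<Psi>' p) / of_real c)"
proof -
  have "continuous_on UNIV \<Psi>"
    using holo(1) unfolding holo_map_on_def
    by (meson continuous_at_imp_continuous_on has_derivative_continuous)
  then have \<Psi>[measurable]: "\<Psi> \<in> borel_measurable borel" by (rule borel_measurable_continuous_onI)
  have I: "integrable lborel F \<longleftrightarrow> integrable lborel (\<lambda>x. F (\<Psi> x))"
    "(LINT x|lborel. F x) = c *\<^sub>R (LINT x|lborel. F (\<Psi> x))"
    if F[measurable]: "F \<in> borel_measurable borel" for F :: "'a \<Rightarrow> 'b::{banach, second_countable_topology}"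
  proof -
    show "integrable lborel F \<longleftrightarrow> integrable lborel (\<lambda>x. F (\<Psi> x))"
    proof -
      have "integrable lborel F \<longleftrightarrow> integrable lborel (\<lambda>x. c *\<^sub>R F (\<Psi> x))"
        using J(1) by (subst J(2)) (simp add: integrable_density integrable_distr_eq)
      also have "\<dots> \<longleftrightarrow> integrable lborel (\<lambda>x. F (\<Psi> x))"
        using J(1) integrable_scaleR_right[of "inverse c" lborel "\<lambda>x. c *\<^sub>R F (\<Psi> x)"] by auto
      finally show ?thesis .
    qed
    show "(LINT x|lborel. F x) = c *\<^sub>R (LINT x|lborel. F (\<Psi> x))"
      using J(1) by (subst J(2)) (simp add: integral_density integral_distr)
  qed
  have k: "k \<in> bergman_space (\<Psi> -` D)" using rep by (simp add: reproduces_def)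
  let ?k = "\<lambda>p. k (\<Psi>' p) / of_real c"
  have "holo_map_on D (\<lambda>p. k (\<Psi>' p))"
  proof (rule holo_map_on_compose[where S = "\<Psi> -` D" and f = k and g = \<Psi>'])
    show "holo_map_on (\<Psi> -` D) k" using k by (simp add: bergman_space_def holo_on_iff_holo_map_on)
    show "holo_map_on D \<Psi>'" using holo(2) by (rule holo_map_on_subset) simp
  qed (simp add: inv)
  then have hk: "holo_on D ?k"
    unfolding holo_on_iff_holo_map_on by (rule holo_map_on_divide_const)
  have meas: "(\<lambda>x. indicator D x *\<^sub>R g x) \<in> borel_measurable borel" if "continuous_on D g"
    for g :: "'a \<Rightarrow> 'b::{banach, second_countable_topology}"
    using borel_measurable_continuous_on_indicator[OF _ that] D by simp
  have ck: "continuous_on D ?k" using hk by (rule holo_on_continuous_on)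
  have "integrable lborel (\<lambda>x. indicator (\<Psi> -` D) x *\<^sub>R (cmod (k x))\<^sup>2)"
    using k by (auto simp: bergman_space_def set_integrable_def)
  then have "integrable lborel (\<lambda>x. (indicator (\<Psi> -` D) x *\<^sub>R (cmod (k x))\<^sup>2) / c\<^sup>2)" by simp
  also have "(\<lambda>x. (indicator (\<Psi> -` D) x *\<^sub>R (cmod (k x))\<^sup>2) / c\<^sup>2) =
     (\<lambda>x. indicator D (\<Psi> x) *\<^sub>R (cmod (?k (\<Psi> x)))\<^sup>2)"
    by (auto simp: inv indicator_def norm_divide power_divide)
  finally have "integrable lborel (\<lambda>x. indicator D x *\<^sub>R (cmod (?k x))\<^sup>2)"
    using I(1)[OF meas[OF continuous_on_power[OF continuous_on_norm[OF ck]]]] by blast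
  with hk have kD: "?k \<in> bergman_space D" by (simp add: bergman_space_def set_integrable_def)
  have "f (\<Psi> y) = (LINT \<xi>:D|lborel. f \<xi> * cnj (?k \<xi>))" if f: "f \<in> bergman_space D" for f
  proof -
    have hf: "holo_on D f" using f by (simp add: bergman_space_def)
    have cf: "continuous_on D f" using hf by (rule holo_on_continuous_on)
    have "holo_map_on (\<Psi> -` D) (\<lambda>p. f (\<Psi> p))"
    proof (rule holo_map_on_compose[where S = D and f = f and g = \<Psi>])
      show "holo_map_on D f" using hf by (simp add: holo_on_iff_holo_map_on)
      show "holo_map_on (\<Psi> -` D) \<Psi>" using holo(1) by (rule holo_map_on_subset) simp
    qed simp
    moreover have "integrable lborel (\<lambda>x. indicator D x *\<^sub>R (cmod (f x))\<^sup>2)"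
      using f by (auto simp: bergman_space_def set_integrable_def)
    then have "integrable lborel (\<lambda>x. indicator D (\<Psi> x) *\<^sub>R (cmod (f (\<Psi> x)))\<^sup>2)"
      using I(1)[OF meas[OF continuous_on_power[OF continuous_on_norm[OF cf]]]] by blast
    ultimately have "(\<lambda>p. f (\<Psi> p)) \<in> bergman_space (\<Psi> -` D)"
      by (simp add: bergman_space_def holo_on_iff_holo_map_on set_integrable_def indicator_def)
    then have "f (\<Psi> y) = (LINT \<xi>:\<Psi> -` D|lborel. f (\<Psi> \<xi>) * cnj (k \<xi>))"
      using rep by (simp add: reproduces_def)
    also have "\<dots> = c *\<^sub>R (LINT \<xi>|lborel. indicator D (\<Psi> \<xi>) *\<^sub>R (f (\<Psi> \<xi>) * cnj (?k (\<Psi> \<xi>))))"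
      unfolding set_lebesgue_integral_def integral_scaleR_right[symmetric]
      using J(1) by (intro Bochner_Integration.integral_cong) (auto simp: inv indicator_def scaleR_conv_of_real)
    also have "\<dots> = (LINT \<xi>|lborel. indicator D \<xi> *\<^sub>R (f \<xi> * cnj (?k \<xi>)))"
      by (rule I(2)[OF meas[OF continuous_on_mult[OF cf continuous_on_cnj[OF ck]]], symmetric])
    finally show ?thesis unfolding set_lebesgue_integral_def .
  qed
  with kD show ?thesis by (simp add: reproduces_def)
qed

section \<open>The mean value property and the Bergman kernel at the base point\<close>

lemma has_derivative_vscale:
  fixes c :: "'a::real_normed_vector \<Rightarrow> complex" and z :: "complex^'n"
  assumes "(c has_derivative c') F"
  shows "((\<lambda>x. c x *s z) has_derivative (\<lambda>h. c' h *s z)) F"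
proof -
  have "linear (\<lambda>c. c *s z)" by (auto simp: linear_iff vec_eq_iff algebra_simps)
  then have "bounded_linear (\<lambda>c. c *s z)" by (simp add: linear_conv_bounded_linear)
  from bounded_linear.has_derivative[OF this assms] show ?thesis .
qed

lemma ball_rotation_holo:
  assumes d: "moebius_den l (fst p) \<noteq> 0"
  shows "holo_map_on {l} (\<lambda>l. ball_rotation l p)"
proof -
  have "(\<lambda>l. moebius_rotation l (fst p)) field_differentiable (at l)"
    using d unfolding moebius_rotation_def moebius_den_def
    by (intro field_differentiable_divide field_differentiable_mult field_differentiable_add
        field_differentiable_diff field_differentiable_const field_differentiable_ident)
  then obtain a where a: "((\<lambda>l. moebius_rotation l (fst p)) has_derivative (*) a) (at l)"
    by (auto simp: field_differentiable_def has_field_derivative_def)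
  have "(\<lambda>l. 2 * \<i> * l / moebius_den l (fst p)) field_differentiable (at l)"
    using d unfolding moebius_den_def
    by (intro field_differentiable_divide field_differentiable_mult field_differentiable_add
        field_differentiable_diff field_differentiable_const field_differentiable_ident)
  then obtain b where "((\<lambda>l. 2 * \<i> * l / moebius_den l (fst p)) has_derivative (*) b) (at l)"
    by (auto simp: field_differentiable_def has_field_derivative_def)
  from has_derivative_Pair[OF a has_derivative_vscale[OF this]]
  have "((\<lambda>l. ball_rotation l p) has_derivative (\<lambda>h. (a * h, (b * h) *s snd p))) (at l)"
    unfolding ball_rotation_def .
  moreover have "(a * J h, (b * J h) *s snd p) = J (a * h, (b * h) *s snd p)" for h
    by (simp add: J_pair J_complex J_cvec vector_smult_assoc mult_ac)
  ultimately show ?thesis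
    unfolding holo_map_on_def by (intro ballI exI[of _ "\<lambda>h. (a * h, (b * h) *s snd p)"]) auto
qed

context circled_gauge
begin

text \<open>The parameter \<open>0\<close> sends every point to the base point.  So the circle average of the holomorphic function
  \<open>l \<mapsto> G (ball_rotation l p)\<close> does not depend on \<open>p\<close>.\<close>

lemma model_rotation_mean:
  assumes G: "holo_on model_domain G" and p: "p \<in> model_domain"
  shows "((\<lambda>t. G (ball_rotation (exp (2 * of_real pi * \<i> * of_real t)) p)) has_integral G (\<i>, 0)) {0..1}"
proof -
  define f where "f l = G (ball_rotation l p)" for l
  have fd: "f field_differentiable (at l)" if "cmod l \<le> 1" for l
    unfolding field_differentiable_iff_holo f_def[abs_def]
  proof (rule holo_map_on_compose[where S = model_domain and f = G])
    show "holo_map_on model_domain G" using G by (simp add: holo_on_iff_holo_map_on)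
    show "holo_map_on {l} (\<lambda>l. ball_rotation l p)"
      by (rule ball_rotation_holo[OF moebius_den_nonzero[OF model_domainD[OF p] that]])
    show "ball_rotation m p \<in> model_domain" if "m \<in> {l}" for m
      using ball_rotation_in_model_domain[OF p \<open>cmod l \<le> 1\<close>] that by simp
  qed
  have "continuous_on (cball 0 1) f"
    by (rule continuous_at_imp_continuous_on) (simp add: field_differentiable_imp_continuous_at fd)
  moreover have "f holomorphic_on ball 0 1"
    unfolding holomorphic_on_def by (simp add: field_differentiable_at_within fd)
  ultimately have "((\<lambda>t. f (exp (2 * of_real pi * \<i> * of_real t))) has_integral f 0) {0..1}"
    by (rule has_integral_circle_mean)
  moreover have "f 0 = G (\<i>, 0)"
    using plus_i_nonzero[OF model_domainD[OF p]]
    by (simp add: f_def ball_rotation_def moebius_rotation_def moebius_den_def)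
  ultimately show ?thesis by (simp add: f_def)
qed

lemma finite_model_measure: "finite_measure model_measure"
  using model_measure_finite by (intro finite_measureI) auto

lemma AE_model_measure: "AE p in model_measure. p \<in> model_domain"
proof -
  have "AE p in lborel. 0 < indicator model_domain p * ennreal (weight (fst p)) \<longrightarrow> p \<in> model_domain"
    by (auto split: split_indicator)
  then show ?thesis
    unfolding model_measure_def using model_density_borel by (subst AE_density) auto
qed

text \<open>Invariance of the measure allows each rotated copy of \<open>G\<close> to replace \<open>G\<close> under the integral; the average
  over all rotations is the constant \<open>G (\<i>, 0)\<close>.\<close>

lemma model_mean_value:
  assumes G: "holo_on model_domain G"
    and int: "integrable model_measure (\<lambda>p. if p \<in> model_domain then G p else 0)"
  shows "(LINT p|model_measure. (if p \<in> model_domain then G p else 0)) =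
    of_real (measure model_measure UNIV) * G (\<i>, 0)"
proof -
  interpret m: finite_measure model_measure by (rule finite_model_measure)
  interpret pair_sigma_finite lborel model_measure ..
  define g where "g p = (if p \<in> model_domain then G p else 0)" for p
  define e where "e t = exp (2 * of_real pi * \<i> * of_real t)" for t :: real
  have ce: "continuous_on UNIV e" unfolding e_def by (intro continuous_intros)
  have e[measurable]: "e \<in> borel_measurable borel" using ce by (rule borel_measurable_continuous_onI)
  have norm_e: "cmod (e t) = 1" for t by (simp add: e_def)
  have g[measurable]: "g \<in> borel_measurable borel"
    unfolding g_def using G open_model_domain by (intro holo_on_borel)
  have gint: "integrable model_measure g" using int by (simp add: g_def[abs_def])
  have rotm: "(\<lambda>p. ball_rotation (e t) p) \<in> measurable model_measure borel" for t
    by measurable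
  have rot_int: "integrable model_measure (\<lambda>p. k (ball_rotation (e t) p)) \<longleftrightarrow> integrable model_measure k"
    "(LINT p|model_measure. k (ball_rotation (e t) p)) = (LINT p|model_measure. k p)"
    if "k \<in> borel_measurable borel" for k :: "_ \<Rightarrow> 'b::{banach, second_countable_topology}" and t
    using integrable_distr_eq[OF rotm that] integral_distr[OF rotm that]
    by (simp_all add: distr_model_rotation[OF norm_e])
  \<comment> \<open>Averaging over \<open>t \<in> {0..1}\<close>: integrate one function on the product in both orders.\<close>
  define K where "K = (\<lambda>(t, p). indicator {0..1::real} t *\<^sub>R g (ball_rotation (e t) p))"
  have Km[measurable]: "K \<in> borel_measurable (lborel \<Otimes>\<^sub>M model_measure)"
    unfolding K_def by measurable
  have Kn: "(\<lambda>p. norm (K (t, p))) = (\<lambda>p. indicator {0..1} t * norm (g (ball_rotation (e t) p)))" for t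
    by (simp add: K_def fun_eq_iff)
  have KI: "integrable (lborel \<Otimes>\<^sub>M model_measure) K"
  proof (rule Fubini_integrable[OF Km])
    have "(LINT p|model_measure. norm (K (t, p))) = indicator {0..1} t * (LINT p|model_measure. norm (g p))" for t
      unfolding Kn by (simp add: rot_int(2)[of "\<lambda>p. norm (g p)"])
    then show "integrable lborel (\<lambda>t. LINT p|model_measure. norm (K (t, p)))"
      by simp
    show "AE t in lborel. integrable model_measure (\<lambda>p. K (t, p))"
      using gint by (auto simp: K_def rot_int(1)[OF g])
  qed
  have inner: "(LINT t|lborel. K (t, p)) = G (\<i>, 0)" if p: "p \<in> model_domain" for p
  proof -
    let ?f = "\<lambda>t. G (ball_rotation (e t) p)"
    have "continuous_on {0..1} ?f"
    proof (rule continuous_on_compose2[OF holo_on_continuous_on[OF G]])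
      have "moebius_den (e t) (fst p) \<noteq> 0" for t
        by (intro moebius_den_nonzero model_domainD p) (simp add: norm_e)
      then show "continuous_on {0..1} (\<lambda>t. ball_rotation (e t) p)"
        unfolding ball_rotation_def moebius_rotation_def moebius_den_def
        by (intro continuous_intros continuous_on_subset[OF ce]) auto
      show "(\<lambda>t. ball_rotation (e t) p) ` {0..1} \<subseteq> model_domain"
        using p norm_e by (auto intro!: ball_rotation_in_model_domain)
    qed
    then have "set_integrable lborel {0..1} ?f" by (rule borel_integrable_atLeastAtMost')
    then have "(LINT t:{0..1}|lborel. ?f t) = integral {0..1} ?f"
      by (rule set_borel_integral_eq_integral)
    also have "\<dots> = G (\<i>, 0)"
      using model_rotation_mean[OF G p] by (simp add: e_def integral_unique)
    also have "(LINT t:{0..1}|lborel. ?f t) = (LINT t|lborel. K (t, p))"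
      unfolding set_lebesgue_integral_def K_def
      using ball_rotation_in_model_domain[OF p] norm_e
      by (intro Bochner_Integration.integral_cong) (auto simp: g_def)
    finally show ?thesis .
  qed
  have "(LINT p|model_measure. K (t, p)) = indicator {0..1} t *\<^sub>R (LINT p|model_measure. g p)" for t
    unfolding K_def by (simp add: rot_int(2)[OF g])
  then have "(LINT t|lborel. (LINT p|model_measure. K (t, p))) = (LINT t:{0..1::real}|lborel. (LINT p|model_measure. g p))"
    unfolding set_lebesgue_integral_def by (simp only:)
  also have "\<dots> = (LINT p|model_measure. g p)"
    by (subst set_integral_const) simp_all
  finally have "(LINT p|model_measure. g p) = (LINT t|lborel. (LINT p|model_measure. K (t, p)))" by (rule sym)
  also have "\<dots> = (LINT p|model_measure. (LINT t|lborel. K (t, p)))"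
    using KI by (intro Fubini_integral[symmetric]) (simp add: case_prod_eta)
  also have "\<dots> = (LINT p|model_measure. G (\<i>, 0))"
    using AE_model_measure by (intro integral_cong_AE) (auto elim!: eventually_mono simp: inner)
  also have "\<dots> = of_real (measure model_measure UNIV) * G (\<i>, 0)"
    by (simp add: scaleR_conv_of_real)
  finally show ?thesis by (simp add: g_def[abs_def])
qed

text \<open>The mean value property for \<open>G p = f p * (fst p + \<i>) ^ (n + 2)\<close> reads as a reproducing formula for \<open>f\<close> once
  the weight is factored as \<open>(u + \<i>)\<^sup>-\<^sup>n\<^sup>-\<^sup>2\<close> times its conjugate.\<close>

lemma model_kernel:
  "\<exists>k C. 0 < C \<and> reproduces model_domain (\<i>, 0) k \<and> k (\<i>, 0) = complex_of_real C"
proof -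
  define N where "N = CARD('n) + 2"
  define m where "m = measure model_measure UNIV"
  interpret m: finite_measure model_measure by (rule finite_model_measure)
  have m: "0 < m"
    using model_measure_positive unfolding m_def by (simp add: m.emeasure_eq_measure)
  \<comment> \<open>\<open>2 \<i>\<close> is the value of \<open>u + \<i>\<close> at the base point; its conjugate normalises \<open>k\<close>.\<close>
  define k where "k p = 1 / (of_real m * (- 2 * \<i>) ^ N * (fst p + \<i>) ^ N)" for p :: "complex \<times> (complex^'n)"
  have w: "weight u = 1 / (cmod (u + \<i>))^(2 * N)" for u
  proof -
    have "2 * N = 2 * CARD('n) + 4" by (simp add: N_def)
    then show ?thesis by (simp only: weight_def)
  qed
  have nz: "fst p + \<i> \<noteq> 0" if "p \<in> model_domain" for p
    using plus_i_nonzero model_domainD[OF that] by blast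
  have hol: "holo_on model_domain (\<lambda>p. f (fst p))"
    if "\<And>p. p \<in> model_domain \<Longrightarrow> f field_differentiable (at (fst p))" for f
    unfolding holo_on_iff_holo_map_on
  proof (rule holo_map_on_compose[where S = "fst ` model_domain" and f = f and g = fst])
    show "holo_map_on (fst ` model_domain) f"
      using that field_differentiable_iff_holo[of f] by (auto simp: holo_map_on_def)
    show "holo_map_on model_domain (fst :: complex \<times> (complex^'n) \<Rightarrow> _)"
      unfolding holo_map_on_def by (auto intro!: exI[of _ fst] has_derivative_fst has_derivative_ident simp: J_prod_def)
  qed auto
  have kh: "holo_on model_domain k"
    unfolding k_def
  proof (rule hol)
    fix p assume "p \<in> model_domain"
    then have "of_real m * (- 2 * \<i>) ^ N * (fst p + \<i>) ^ N \<noteq> 0" using nz m by simp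
    then show "(\<lambda>u. 1 / (of_real m * (- 2 * \<i>) ^ N * (u + \<i>) ^ N)) field_differentiable (at (fst p))"
      by (intro field_differentiable_divide field_differentiable_mult field_differentiable_power
          field_differentiable_add field_differentiable_const field_differentiable_ident)
  qed
  have kn: "(cmod (k p))\<^sup>2 = weight (fst p) / (m\<^sup>2 * 2 ^ (2 * N))" for p
    unfolding k_def w using m
    by (simp add: norm_divide norm_mult norm_power power_divide power_mult_distrib power_mult[symmetric] mult.commute)
  have int_m: "integrable model_measure f \<longleftrightarrow> integrable lborel (\<lambda>p. (indicator model_domain p * weight (fst p)) *\<^sub>R f p)"
    "(LINT p|model_measure. f p) = (LINT p|lborel. (indicator model_domain p * weight (fst p)) *\<^sub>R f p)"
    if [measurable]: "f \<in> borel_measurable borel" for f :: "_ \<Rightarrow> 'b::{banach, second_countable_topology}"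
  proof -
    have meq: "model_measure = density lborel (\<lambda>p. ennreal (indicator model_domain p * weight (fst p)))"
      unfolding model_measure_def by (intro arg_cong[of _ _ "density lborel"]) (auto split: split_indicator)
    have "(\<lambda>p. indicator model_domain p * weight (fst p)) \<in> borel_measurable (borel \<Otimes>\<^sub>M borel)"
      using model_domain_borel[folded borel_prod] by measurable
    then have wm: "(\<lambda>p. indicator model_domain p * weight (fst p)) \<in> borel_measurable lborel"
      unfolding borel_prod by simp
    have nn: "AE p in lborel. 0 \<le> indicator model_domain p * weight (fst p)"
      by (simp add: weight_nonneg)
    have fm: "f \<in> borel_measurable lborel" by simp
    show "integrable model_measure f \<longleftrightarrow> integrable lborel (\<lambda>p. (indicator model_domain p * weight (fst p)) *\<^sub>R f p)"
      unfolding meq by (rule integrable_density[OF fm wm nn])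
    show "(LINT p|model_measure. f p) = (LINT p|lborel. (indicator model_domain p * weight (fst p)) *\<^sub>R f p)"
      unfolding meq by (rule integral_density[OF fm wm nn])
  qed
  have "integrable model_measure (\<lambda>p. 1 / (m\<^sup>2 * 2 ^ (2 * N)) :: real)" by simp
  then have "integrable lborel (\<lambda>p. (indicator model_domain p * weight (fst p)) *\<^sub>R (1 / (m\<^sup>2 * 2 ^ (2 * N)) :: real))"
    by (subst (asm) int_m(1)) auto
  also have "(\<lambda>p. (indicator model_domain p * weight (fst p)) *\<^sub>R (1 / (m\<^sup>2 * 2 ^ (2 * N)) :: real)) =
      (\<lambda>p. indicator model_domain p *\<^sub>R (cmod (k p))\<^sup>2)"
    by (simp add: kn fun_eq_iff)
  finally have kB: "k \<in> bergman_space model_domain"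
    using kh by (simp add: bergman_space_def set_integrable_def)
  have "f (\<i>, 0) = (LINT p:model_domain|lborel. f p * cnj (k p))" if f: "f \<in> bergman_space model_domain" for f
  proof -
    define G where "G p = f p * (fst p + \<i>) ^ N" for p
    define g where "g p = (if p \<in> model_domain then G p else 0)" for p
    have Gh: "holo_on model_domain G"
      unfolding holo_on_def
    proof
      fix p assume p: "p \<in> model_domain"
      obtain F where F: "(f has_derivative F) (at p)" "\<And>v. F (J v) = \<i> * F v"
        using f p unfolding bergman_space_def holo_on_def by blast
      have "holo_on model_domain (\<lambda>p. (fst p + \<i>) ^ N)"
        by (rule hol) (intro field_differentiable_power
          field_differentiable_add field_differentiable_const field_differentiable_ident)
      then obtain E where E: "((\<lambda>p. (fst p + \<i>) ^ N) has_derivative E) (at p)" "\<And>v. E (J v) = \<i> * E v"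
        using p unfolding holo_on_def by blast
      show "\<exists>D. (G has_derivative D) (at p) \<and> (\<forall>v. D (J v) = \<i> * D v)"
        unfolding G_def using has_derivative_mult[OF F(1) E(1)] F(2) E(2)
        by (intro exI[of _ "\<lambda>v. f p * E v + F v * (fst p + \<i>) ^ N"]) (auto simp: algebra_simps)
    qed
    have gm: "g \<in> borel_measurable borel"
      unfolding g_def using Gh open_model_domain by (intro holo_on_borel)
    define c where "c = of_real m * (2 * \<i>) ^ N"
    have c: "c \<noteq> 0" using m by (simp add: c_def)
    have eq: "(indicator model_domain p * weight (fst p)) *\<^sub>R g p =
        c * (indicator model_domain p *\<^sub>R (f p * cnj (k p)))" for p
    proof (cases "p \<in> model_domain")
      case True
      define a where "a = fst p + \<i>"
      have a: "a \<noteq> 0" using nz[OF True] by (simp add: a_def)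
      have "of_real (weight (fst p)) * a ^ N = 1 / cnj a ^ N"
      proof -
        have "complex_of_real (cmod a ^ (2 * N)) = (a * cnj a) ^ N"
          unfolding power_mult of_real_power[of "(cmod a)\<^sup>2" N] complex_norm_square ..
        then show ?thesis
          unfolding w a_def[symmetric] of_real_divide of_real_1 power_mult_distrib using a by simp
      qed
      moreover have "cnj (k p) = 1 / (c * cnj a ^ N)"
        by (simp add: k_def a_def[symmetric] c_def)
      ultimately show ?thesis
        using True c by (simp add: g_def G_def a_def[symmetric] scaleR_conv_of_real mult_ac)
    qed simp
    have gi: "integrable model_measure g"
      unfolding int_m(1)[OF gm] eq
      by (intro integrable_mult_right bergman_space_product_integrable[OF open_model_domain f kB, unfolded set_integrable_def])
    have "of_real m * G (\<i>, 0) = (LINT p|model_measure. g p)"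
      using model_mean_value[OF Gh] gi by (simp add: g_def[abs_def] m_def)
    also have "\<dots> = c * (LINT p:model_domain|lborel. f p * cnj (k p))"
      unfolding int_m(2)[OF gm] eq set_lebesgue_integral_def by (rule integral_mult_right_zero)
    finally show ?thesis using c by (simp add: G_def c_def)
  qed
  then have rep: "reproduces model_domain (\<i>, 0) k" using kB by (simp add: reproduces_def)
  have "(- 2 * \<i>) ^ N * (\<i> + \<i>) ^ N = (4::complex) ^ N"
    unfolding power_mult_distrib[symmetric] by simp
  then have "k (\<i>, 0) = complex_of_real (1 / (m * 4 ^ N))"
    unfolding k_def mult.assoc by simp
  moreover have "0 < 1 / (m * 4 ^ N)" using m by simp
  ultimately show ?thesis using rep by blast
qed

end

section \<open>The Bergman kernel of a Siegel domain\<close>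

definition cnj_vec :: "complex^'n \<Rightarrow> complex^'n" where "cnj_vec v = (\<chi> i. cnj (v $ i))"

definition im_vec :: "complex^'n \<Rightarrow> complex^'n" where "im_vec v = (\<chi> i. complex_of_real (Im (v $ i)))"

lemma cnj_vec_add: "cnj_vec (v + w) = cnj_vec v + cnj_vec w"
  by (simp add: cnj_vec_def vec_eq_iff)

lemma cnj_vec_scale: "cnj_vec (a *s v) = cnj a *s cnj_vec v"
  by (simp add: cnj_vec_def vec_eq_iff)

lemma cnj_vec_cnj_vec [simp]: "cnj_vec (cnj_vec v) = v"
  by (simp add: cnj_vec_def vec_eq_iff)

lemma im_vec_add: "im_vec (v + w) = im_vec v + im_vec w"
  by (simp add: im_vec_def vec_eq_iff)

lemma im_vec_conv: "im_vec v = (- \<i> / 2) *s (v + (- 1) *s cnj_vec v)"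
  by (simp add: im_vec_def cnj_vec_def vec_eq_iff complex_eq_iff)

lemma cnj_vec_im_vec [simp]: "cnj_vec (im_vec v) = im_vec v"
  by (simp add: im_vec_def cnj_vec_def vec_eq_iff)

lemma im_vec_scaleR: "im_vec (of_real a *s v) = of_real a *s im_vec v"
  by (simp add: im_vec_def vec_eq_iff)

lemma linear_im_vec: "linear (im_vec :: complex^'n \<Rightarrow> _)"
  by (auto simp: linear_iff im_vec_def vec_eq_iff scaleR_conv_of_real[where 'a=complex])

lemma nn_integral_affine:
  fixes F :: "'a::euclidean_space \<Rightarrow> ennreal"
  assumes c: "c \<noteq> 0" and F[measurable]: "F \<in> borel_measurable borel"
  shows "(\<integral>\<^sup>+x. F x \<partial>lborel) = ennreal (\<bar>c\<bar> ^ DIM('a)) * (\<integral>\<^sup>+x. F (t + c *\<^sub>R x) \<partial>lborel)"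
proof -
  have "(\<integral>\<^sup>+x. F x \<partial>lborel) =
      (\<integral>\<^sup>+x. F x \<partial>density (distr lborel borel (\<lambda>x. t + c *\<^sub>R x)) (\<lambda>_. ennreal (\<bar>c\<bar> ^ DIM('a))))"
    using lborel_affine[OF c, of t] by simp
  also have "\<dots> = ennreal (\<bar>c\<bar> ^ DIM('a)) * (\<integral>\<^sup>+x. F (t + c *\<^sub>R x) \<partial>lborel)"
    by (simp add: nn_integral_density nn_integral_distr nn_integral_cmult)
  finally show ?thesis .
qed

text \<open>For fixed \<open>z\<close> the shear is a translation of \<open>u\<close>, so by Fubini only the dilations contribute, whatever the
  function \<open>g\<close>.\<close>

lemma lborel_triangular_affine:
  fixes g :: "complex^'n \<Rightarrow> complex" and z0 :: "complex^'n"
  assumes a: "0 < a" and s: "0 < s" and g: "continuous_on UNIV g"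
  shows "(lborel :: (complex \<times> (complex^'n)) measure) =
    density (distr lborel borel (\<lambda>p. (g (snd p) + a *\<^sub>R fst p, z0 + s *\<^sub>R snd p))) (\<lambda>_. ennreal (a\<^sup>2 * s ^ (2 * CARD('n))))"
    (is "_ = ?D")
proof (rule measure_eqI)
  let ?\<Psi> = "\<lambda>p::complex \<times> (complex^'n). (g (snd p) + a *\<^sub>R fst p, z0 + s *\<^sub>R snd p)"
  have \<Psi>[measurable]: "?\<Psi> \<in> borel_measurable borel"
    by (intro borel_measurable_continuous_onI continuous_intros continuous_on_compose2[OF g]) auto
  fix A :: "(complex \<times> (complex^'n)) set" assume "A \<in> sets lborel"
  then have A[measurable]: "A \<in> sets borel" by simp
  let ?F = "indicator A :: _ \<Rightarrow> ennreal"
  have AF[measurable]: "A \<in> sets (borel \<Otimes>\<^sub>M borel)" using A unfolding borel_prod .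
  have [measurable]: "g \<in> borel_measurable borel" using g by (rule borel_measurable_continuous_onI)
  have swap: "(\<integral>\<^sup>+p. G p \<partial>lborel) = (\<integral>\<^sup>+z. \<integral>\<^sup>+u. G (u, z) \<partial>lborel \<partial>lborel)"
    if G: "G \<in> borel_measurable borel" for G :: "complex \<times> (complex^'n) \<Rightarrow> ennreal"
  proof -
    have "G \<in> borel_measurable (lborel \<Otimes>\<^sub>M lborel)" using G unfolding lborel_prod by simp
    from lborel_pair.nn_integral_snd[OF this] show ?thesis unfolding lborel_prod by simp
  qed
  have A\<Psi>: "(\<lambda>p. ?F (?\<Psi> p)) \<in> borel_measurable borel"
    using measurable_compose[OF \<Psi>, of ?F borel] by simp
  have "(\<integral>\<^sup>+p. ?F p \<partial>lborel) = (\<integral>\<^sup>+z. \<integral>\<^sup>+u. ?F (u, z) \<partial>lborel \<partial>lborel)"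
    by (rule swap) simp
  also have "\<dots> = ennreal (s ^ (2 * CARD('n))) * (\<integral>\<^sup>+z. \<integral>\<^sup>+u. ?F (u, z0 + s *\<^sub>R z) \<partial>lborel \<partial>lborel)"
    using s by (subst nn_integral_affine[of s _ z0]) (simp_all add: mult.commute)
  also have "\<dots> = ennreal (s ^ (2 * CARD('n))) * (\<integral>\<^sup>+z. ennreal (a\<^sup>2) * (\<integral>\<^sup>+u. ?F (g z + a *\<^sub>R u, z0 + s *\<^sub>R z) \<partial>lborel) \<partial>lborel)"
  proof (intro arg_cong[of _ _ "\<lambda>x. ennreal (s ^ (2 * CARD('n))) * x"] nn_integral_cong)
    fix z
    have "(\<lambda>u. ?F (u, z0 + s *\<^sub>R z)) \<in> borel_measurable borel" by measurable
    from nn_integral_affine[of a, OF _ this, of "g z"] a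
    show "(\<integral>\<^sup>+u. ?F (u, z0 + s *\<^sub>R z) \<partial>lborel) = ennreal (a\<^sup>2) * (\<integral>\<^sup>+u. ?F (g z + a *\<^sub>R u, z0 + s *\<^sub>R z) \<partial>lborel)"
      by simp
  qed
  also have "\<dots> = ennreal (s ^ (2 * CARD('n))) * (ennreal (a\<^sup>2) * (\<integral>\<^sup>+z. (\<integral>\<^sup>+u. ?F (g z + a *\<^sub>R u, z0 + s *\<^sub>R z) \<partial>lborel) \<partial>lborel))"
    by (subst nn_integral_cmult) measurable
  also have "\<dots> = ennreal (a\<^sup>2 * s ^ (2 * CARD('n))) * (\<integral>\<^sup>+z. (\<integral>\<^sup>+u. ?F (g z + a *\<^sub>R u, z0 + s *\<^sub>R z) \<partial>lborel) \<partial>lborel)"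
    using a s by (simp add: ennreal_mult mult_ac)
  also have "(\<integral>\<^sup>+z. (\<integral>\<^sup>+u. ?F (g z + a *\<^sub>R u, z0 + s *\<^sub>R z) \<partial>lborel) \<partial>lborel) = (\<integral>\<^sup>+p. ?F (?\<Psi> p) \<partial>lborel)"
    using swap[OF A\<Psi>] by simp
  finally have "emeasure lborel A = ennreal (a\<^sup>2 * s ^ (2 * CARD('n))) * (\<integral>\<^sup>+p. ?F (?\<Psi> p) \<partial>lborel)" by simp
  also have "(\<integral>\<^sup>+p. ?F (?\<Psi> p) \<partial>lborel) = (\<integral>\<^sup>+p. ?F p \<partial>distr lborel borel ?\<Psi>)"
    using \<Psi> by (intro nn_integral_distr[symmetric]) simp_all
  also have "\<dots> = emeasure (distr lborel borel ?\<Psi>) A" by simp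
  also have "ennreal (a\<^sup>2 * s ^ (2 * CARD('n))) * \<dots> = emeasure ?D A"
    by (simp add: emeasure_density nn_integral_cmult_indicator)
  finally show "emeasure lborel A = emeasure ?D A" .
qed simp

locale positive_form =
  fixes P :: "real^'n^'n" and c :: "real^'n"
  assumes P_sym: "P $ i $ j = P $ j $ i"
    and P_pos: "v \<noteq> 0 \<Longrightarrow> 0 < (\<Sum>i\<in>UNIV. \<Sum>j\<in>UNIV. P $ i $ j * (v $ i * v $ j))"
begin

definition bil :: "complex^'n \<Rightarrow> complex^'n \<Rightarrow> complex" where
  "bil v w = (\<Sum>i\<in>UNIV. \<Sum>j\<in>UNIV. of_real (P $ i $ j) * (v $ i * w $ j))"

text \<open>A real vector, but complex-valued so that the complex bilinear form applies to it.\<close>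

definition shifted_im :: "complex^'n \<Rightarrow> complex^'n" where
  "shifted_im z = im_vec z + (\<chi> i. of_real (c $ i))"

text \<open>The form takes a real value here; \<open>Re\<close> only changes the type.\<close>

definition im_form :: "complex^'n \<Rightarrow> real" where "im_form z = Re (bil (shifted_im z) (shifted_im z))"

text \<open>The Hermitian form \<open>\<partial>\<partial>bar im_form\<close>, evaluated on \<open>(z, z)\<close>.\<close>

definition H :: "complex^'n \<Rightarrow> real" where "H z = Re (bil z (cnj_vec z)) / 2"

definition siegel :: "(complex \<times> (complex^'n)) set" where
  "siegel = {p. im_form (snd p) < Im (fst p)}"

lemma bil_add: "bil (v + v') w = bil v w + bil v' w" "bil v (w + w') = bil v w + bil v w'"
  by (simp_all add: bil_def algebra_simps sum.distrib)

lemma bil_scale: "bil (a *s v) w = a * bil v w" "bil v (a *s w) = a * bil v w"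
  by (simp_all add: bil_def sum_distrib_left mult_ac)

lemma bil_scaleR: "bil (a *\<^sub>R v) w = a *\<^sub>R bil v w" "bil v (a *\<^sub>R w) = a *\<^sub>R bil v w"
  by (simp_all add: bil_def scaleR_sum_right)

lemma bil_commute: "bil v w = bil w v"
  unfolding bil_def by (subst sum.swap) (simp add: P_sym mult.commute)

lemma bil_conj: "cnj (bil v w) = bil (cnj_vec v) (cnj_vec w)"
  by (simp add: bil_def cnj_vec_def)

lemma bounded_bilinear_bil: "bounded_bilinear bil"
  by (subst bilinear_conv_bounded_bilinear[symmetric])
     (auto simp: bilinear_def linear_iff bil_add bil_scaleR)

text \<open>The quadratic form of the imaginary part splits into the Hermitian form and a pluriharmonic part.  Subtracting
  the latter is what identifies the Siegel domain below with the model domain.\<close>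

lemma bil_im_vec: "Re (bil (im_vec v) (im_vec v)) = H v - Re (bil v v) / 2"
proof -
  have "bil (im_vec v) (im_vec v) = - (1/4) * (bil v v - 2 * bil v (cnj_vec v) + cnj (bil v v))"
    unfolding im_vec_conv bil_scale bil_add bil_conj bil_commute[of "cnj_vec v" v]
    by (simp add: algebra_simps)
  then show ?thesis by (simp add: H_def) (simp add: field_simps)
qed

lemma shifted_im_add: "shifted_im (z + v) = shifted_im z + im_vec v"
  by (simp add: shifted_im_def im_vec_add)

lemma cnj_vec_shifted_im [simp]: "cnj_vec (shifted_im z) = shifted_im z"
  by (simp add: shifted_im_def cnj_vec_add) (simp add: cnj_vec_def vec_eq_iff)

lemma bil_self_conj_pos:
  assumes "v \<noteq> 0" shows "0 < Re (bil v (cnj_vec v))"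
proof -
  define a b :: "real^'n" where "a = (\<chi> i. Re (v $ i))" and "b = (\<chi> i. Im (v $ i))"
  have "Re (bil v (cnj_vec v)) = (\<Sum>i\<in>UNIV. \<Sum>j\<in>UNIV. P $ i $ j * (a $ i * a $ j)) + (\<Sum>i\<in>UNIV. \<Sum>j\<in>UNIV. P $ i $ j * (b $ i * b $ j))"
    by (simp add: bil_def cnj_vec_def a_def b_def sum.distrib[symmetric] distrib_left)
  moreover have nn: "0 \<le> (\<Sum>i\<in>UNIV. \<Sum>j\<in>UNIV. P $ i $ j * (x $ i * x $ j))" for x
    using P_pos[of x] by (cases "x = 0") auto
  moreover have "a \<noteq> 0 \<or> b \<noteq> 0"
    using assms by (auto simp: a_def b_def vec_eq_iff complex_eq_iff)
  ultimately show ?thesis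
    using P_pos[of a] P_pos[of b] nn[of a] nn[of b] by (auto intro: add_pos_nonneg add_nonneg_pos)
qed

lemma continuous_on_bil [continuous_intros]:
  "continuous_on S f \<Longrightarrow> continuous_on S g \<Longrightarrow> continuous_on S (\<lambda>x. bil (f x) (g x))"
  by (rule bounded_bilinear.continuous_on[OF bounded_bilinear_bil])

lemma continuous_on_cnj_vec [continuous_intros]:
  fixes f :: "'a::topological_space \<Rightarrow> complex^'n"
  shows "continuous_on S f \<Longrightarrow> continuous_on S (\<lambda>x. cnj_vec (f x))"
  unfolding cnj_vec_def by (intro continuous_intros)

lemma continuous_on_shifted_im [continuous_intros]:
  fixes f :: "'a::topological_space \<Rightarrow> complex^'n"
  shows "continuous_on S f \<Longrightarrow> continuous_on S (\<lambda>x. shifted_im (f x))"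
  unfolding shifted_im_def im_vec_def by (intro continuous_intros)

sublocale circled_gauge H
proof
  show "continuous_on UNIV H" unfolding H_def by (intro continuous_intros) auto
  show "H (a *s z) = (cmod a)\<^sup>2 * H z" for a z
  proof -
    have "bil (a *s z) (cnj_vec (a *s z)) = of_real ((cmod a)\<^sup>2) * bil z (cnj_vec z)"
      unfolding cnj_vec_scale bil_scale complex_norm_square by (simp add: mult_ac)
    then show ?thesis by (simp only: H_def Re_complex_of_real times_divide_eq_right) simp
  qed
  show "0 < H z" if "z \<noteq> 0" for z using bil_self_conj_pos[OF that] by (simp add: H_def)
qed

lemma im_form_shift: "im_form (z0 + of_real s *s z) = im_form z0 + 2 * s * Re (bil (shifted_im z0) (im_vec z)) + s\<^sup>2 * (H z - Re (bil z z) / 2)"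
proof -
  have "bil (shifted_im (z0 + of_real s *s z)) (shifted_im (z0 + of_real s *s z)) =
    bil (shifted_im z0) (shifted_im z0) + 2 * of_real s * bil (shifted_im z0) (im_vec z) + (of_real s)\<^sup>2 * bil (im_vec z) (im_vec z)"
    unfolding shifted_im_add im_vec_scaleR bil_add bil_scale bil_commute[of "im_vec z" "shifted_im z0"]
    by (simp add: algebra_simps power2_eq_square)
  then show ?thesis
    unfolding im_form_def bil_im_vec[symmetric] by (simp add: power2_eq_square flip: of_real_power of_real_mult)
qed

lemma bil_shifted_im_im_vec: "Re (bil (shifted_im z0) (im_vec z)) = Im (bil (shifted_im z0) z)"
proof -
  have "bil (shifted_im z0) (im_vec z) = (- \<i> / 2) * (bil (shifted_im z0) z - cnj (bil (shifted_im z0) z))"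
    unfolding im_vec_conv bil_scale bil_add bil_conj by simp
  then show ?thesis by simp
qed

lemma open_siegel: "open siegel"
  unfolding siegel_def im_form_def by (intro open_Collect_less continuous_intros)

text \<open>The domain is homogeneous under volume-scaling polynomial maps, so its kernel is known on the whole diagonal
  as soon as it is known at one point.\<close>

theorem siegel_bergman_kernel:
  "\<exists>C>0. \<forall>p\<in>siegel. bergman_kernel siegel p p =
     complex_of_real (C / (Im (fst p) - im_form (snd p)) ^ (CARD('n) + 2))"
proof -
  obtain k C where C: "0 < C" "reproduces model_domain (\<i>, 0) k" "k (\<i>, 0) = complex_of_real C"
    using model_kernel by blast
  show ?thesis
  proof (intro exI[of _ C] conjI ballI C(1))
    fix p assume p: "p \<in> siegel"
    obtain u0 z0 where p_eq: "p = (u0, z0)" by force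
    define \<rho> where "\<rho> = Im u0 - im_form z0"
    have \<rho>: "0 < \<rho>" using p by (simp add: siegel_def p_eq \<rho>_def)
    define s where "s = sqrt \<rho>"
    have s: "0 < s" "s\<^sup>2 = \<rho>" using \<rho> by (auto simp: s_def)
    \<comment> \<open>The linear term in \<open>g\<close> recentres the form at \<open>z0\<close>, and the quadratic one removes its pluriharmonic part.\<close>
    define g where "g z = of_real (Re u0) + \<i> * of_real (im_form z0) + 2 * of_real s * bil (shifted_im z0) z - (\<i> / 2) * of_real \<rho> * bil z z" for z
    define \<Psi> where "\<Psi> x = (g (snd x) + \<rho> *\<^sub>R fst x, z0 + s *\<^sub>R snd x)" for x :: "complex \<times> (complex^'n)"
    define \<Psi>' where "\<Psi>' x = ((1 / \<rho>) *\<^sub>R (fst x - g ((1 / s) *\<^sub>R (snd x - z0))), (1 / s) *\<^sub>R (snd x - z0))" for x :: "complex \<times> (complex^'n)"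
    have inv: "\<Psi> (\<Psi>' x) = x" "\<Psi>' (\<Psi> x) = x" for x
      using \<rho> s by (auto simp: \<Psi>_def \<Psi>'_def prod_eq_iff)
    have gd: "(g has_derivative (\<lambda>v. 2 * of_real s * bil (shifted_im z0) v - (\<i> / 2) * of_real \<rho> * (bil z v + bil v z))) (at z)" for z
    proof -
      have b2: "((\<lambda>z. bil z z) has_derivative (\<lambda>v. bil z v + bil v z)) (at z)"
        by (rule bounded_bilinear.FDERIV[OF bounded_bilinear_bil has_derivative_ident has_derivative_ident])
      have b1: "(bil (shifted_im z0) has_derivative bil (shifted_im z0)) (at z)"
        by (intro bounded_linear_imp_has_derivative bounded_bilinear.bounded_linear_right[OF bounded_bilinear_bil])
      show ?thesis unfolding g_def
        by (rule has_derivative_eq_rhs[OF has_derivative_diff[OF has_derivative_add[OF has_derivative_const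
            has_derivative_mult_right[OF b1]] has_derivative_mult_right[OF b2]]]) simp
    qed
    have gJ: "2 * of_real s * bil (shifted_im z0) (J v) - (\<i> / 2) * of_real \<rho> * (bil z (J v) + bil (J v) z) =
        \<i> * (2 * of_real s * bil (shifted_im z0) v - (\<i> / 2) * of_real \<rho> * (bil z v + bil v z))" for z v
      by (simp add: J_cvec bil_scale algebra_simps)
    have gh: "holo_map_on UNIV g"
      unfolding holo_map_on_def J_complex using gd gJ by blast
    have gc: "continuous_on UNIV g" unfolding g_def by (intro continuous_intros)
    have h\<Psi>: "holo_map_on UNIV \<Psi>"
      unfolding holo_map_on_def
    proof
      fix x :: "complex \<times> (complex^'n)"
      obtain D where D: "(g has_derivative D) (at (snd x))" "\<And>v. D (J v) = J (D v)"
        using gh unfolding holo_map_on_def by blast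
      have "((\<lambda>x. g (snd x)) has_derivative (\<lambda>v. D (snd v))) (at x)"
        using has_derivative_compose[OF has_derivative_snd[OF has_derivative_ident] D(1)] .
      then have "(\<Psi> has_derivative (\<lambda>v. (D (snd v) + \<rho> *\<^sub>R fst v, s *\<^sub>R snd v))) (at x)"
        unfolding \<Psi>_def by (auto intro!: derivative_eq_intros)
      moreover have "(D (snd (J v)) + \<rho> *\<^sub>R fst (J v), s *\<^sub>R snd (J v)) = J (D (snd v) + \<rho> *\<^sub>R fst v, s *\<^sub>R snd v)" for v
        by (simp add: J_prod_def D(2) J_add J_scaleR)
      ultimately show "\<exists>D. (\<Psi> has_derivative D) (at x) \<and> (\<forall>v. D (J v) = J (D v))" by blast
    qed
    have h\<Psi>': "holo_map_on UNIV \<Psi>'"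
      unfolding holo_map_on_def
    proof
      fix x :: "complex \<times> (complex^'n)"
      obtain D where D: "(g has_derivative D) (at ((1 / s) *\<^sub>R (snd x - z0)))" "\<And>v. D (J v) = J (D v)"
        using gh unfolding holo_map_on_def by blast
      have "((\<lambda>x. (1 / s) *\<^sub>R (snd x - z0)) has_derivative (\<lambda>v. (1 / s) *\<^sub>R snd v)) (at x)"
        by (auto intro!: derivative_eq_intros)
      from has_derivative_compose[OF this D(1)]
      have "((\<lambda>x. g ((1 / s) *\<^sub>R (snd x - z0))) has_derivative (\<lambda>v. D ((1 / s) *\<^sub>R snd v))) (at x)" .
      then have "(\<Psi>' has_derivative (\<lambda>v. ((1 / \<rho>) *\<^sub>R (fst v - D ((1 / s) *\<^sub>R snd v)), (1 / s) *\<^sub>R snd v))) (at x)"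
        unfolding \<Psi>'_def by (auto intro!: derivative_eq_intros)
      moreover have "((1 / \<rho>) *\<^sub>R (fst (J v) - D ((1 / s) *\<^sub>R snd (J v))), (1 / s) *\<^sub>R snd (J v)) =
          J ((1 / \<rho>) *\<^sub>R (fst v - D ((1 / s) *\<^sub>R snd v)), (1 / s) *\<^sub>R snd v)" for v
        unfolding J_prod_def fst_conv snd_conv J_scaleR[symmetric] D(2)
        by (simp add: J_scaleR J_complex algebra_simps)
      ultimately show "\<exists>D. (\<Psi>' has_derivative D) (at x) \<and> (\<forall>v. D (J v) = J (D v))" by blast
    qed
    have pre: "\<Psi> -` siegel = model_domain"
    proof -
      have "Im (g z + \<rho> *\<^sub>R u) - im_form (z0 + s *\<^sub>R z) = \<rho> * (Im u - H z)" for u z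
      proof -
        have sc: "s *\<^sub>R z = of_real s *s z"
          by (simp add: vec_eq_iff scaleR_conv_of_real[where 'a=complex])
        show ?thesis unfolding sc im_form_shift bil_shifted_im_im_vec s(2) g_def
          by (simp add: algebra_simps)
      qed
      then have "im_form (z0 + s *\<^sub>R z) < Im (g z + \<rho> *\<^sub>R u) \<longleftrightarrow> H z < Im u" for u z
        using \<rho> by (metis diff_gt_0_iff_gt zero_less_mult_pos mult_pos_pos)
      then show ?thesis by (auto simp: \<Psi>_def siegel_def model_domain_def)
    qed
    have \<Psi>0: "\<Psi> (\<i>, 0) = p"
      by (simp add: \<Psi>_def p_eq g_def complex_eq_iff \<rho>_def bil_def)
    have "reproduces siegel (\<Psi> (\<i>, 0)) (\<lambda>x. k (\<Psi>' x) / of_real (\<rho>\<^sup>2 * s ^ (2 * CARD('n))))"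
    proof (rule reproduces_transport[OF inv h\<Psi> h\<Psi>' _ _ open_siegel])
      show "0 < \<rho>\<^sup>2 * s ^ (2 * CARD('n))" using \<rho> s by simp
      show "lborel = density (distr lborel borel \<Psi>) (\<lambda>_. ennreal (\<rho>\<^sup>2 * s ^ (2 * CARD('n))))"
        unfolding \<Psi>_def[abs_def] by (rule lborel_triangular_affine[OF \<rho> s(1) gc])
      show "reproduces (\<Psi> -` siegel) (\<i>, 0) k" using C(2) by (simp add: pre)
    qed
    then have "bergman_kernel siegel p p = k (\<Psi>' p) / of_real (\<rho>\<^sup>2 * s ^ (2 * CARD('n)))"
      unfolding \<Psi>0 by (rule bergman_kernel_eqI[OF open_siegel _ p])
    also have "\<Psi>' p = (\<i>, 0)" using inv(2)[of "(\<i>, 0)"] unfolding \<Psi>0 .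
    also have "\<rho>\<^sup>2 * s ^ (2 * CARD('n)) = \<rho> ^ (CARD('n) + 2)"
      unfolding power_mult s(2) by (simp add: power_add power2_eq_square)
    finally show "bergman_kernel siegel p p = complex_of_real (C / (Im (fst p) - im_form (snd p)) ^ (CARD('n) + 2))"
      by (simp add: C(3) \<rho>_def p_eq)
  qed
qed

end

section \<open>The Kaehler form of the logarithm of the norm\<close>

text \<open>The chain rule \<open>\<partial>\<partial>bar (F \<circ> s) = F' \<partial>\<partial>bar s + F'' \<partial>s \<and> \<partial>bar s\<close>.  Here \<open>\<theta>\<close> is \<open>\<partial>s\<close>, so that its
  conjugate is \<open>\<partial>bar s\<close>, and \<open>T\<close> is the \<open>(1,0)\<close>-part of the derivative of the latter.\<close>

lemma i_ddbar_compose: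
  fixes s G :: "'a::complex_structure \<Rightarrow> real" and \<theta> :: "'a \<Rightarrow> 'a \<Rightarrow> complex"
  assumes S: "open S" "p \<in> S"
    and s: "\<And>x. x \<in> S \<Longrightarrow> (s has_derivative (\<lambda>v. 2 * Re (\<theta> x v))) (at x)"
    and \<theta>J: "\<And>x v. x \<in> S \<Longrightarrow> \<theta> x (J v) = \<i> * \<theta> x v"
    and L: "\<And>w. ((\<lambda>x. cnj (\<theta> x w)) has_derivative L w) (at p)"
    and F: "\<And>x. x \<in> S \<Longrightarrow> (F has_real_derivative F' (s x)) (at (s x))"
    and F': "(F' has_real_derivative F'') (at (s p))"
    and G: "\<And>x. x \<in> S \<Longrightarrow> G x = F (s x)"
    and T: "\<And>v w. (L w v - \<i> * L w (J v)) / 2 = T v w"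
  shows "i_ddbar G p v w = \<i> * (of_real (F' (s p)) * (T v w - T w v) +
      of_real F'' * (\<theta> p v * cnj (\<theta> p w) - \<theta> p w * cnj (\<theta> p v)))"
proof -
  have db: "delbar (\<lambda>y. complex_of_real (G y)) x w = of_real (F' (s x)) * cnj (\<theta> x w)" if x: "x \<in> S" for x w
  proof -
    have "((\<lambda>y. F (s y)) has_derivative (\<lambda>v. F' (s x) * (2 * Re (\<theta> x v)))) (at x)"
      using has_derivative_compose[OF s[OF x] F[OF x, unfolded has_field_derivative_def]] .
    then have "(G has_derivative (\<lambda>v. F' (s x) * (2 * Re (\<theta> x v)))) (at x)"
      by (rule has_derivative_transform_within_open[OF _ S(1) x]) (simp add: G)
    then have "((\<lambda>y. complex_of_real (G y)) has_derivative (\<lambda>v. of_real (F' (s x) * (2 * Re (\<theta> x v))))) (at x)"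
      by (rule has_derivative_of_real)
    then have fd: "frechet_derivative (\<lambda>y. complex_of_real (G y)) (at x) = (\<lambda>v. of_real (F' (s x) * (2 * Re (\<theta> x v))))"
      by (rule frechet_derivative_at[symmetric])
    show ?thesis unfolding delbar_def fd \<theta>J[OF x] by (simp add: complex_eq_iff)
  qed
  have dd: "del (\<lambda>x. delbar (\<lambda>y. complex_of_real (G y)) x w) p v =
      of_real (F' (s p)) * T v w + of_real F'' * (\<theta> p v * cnj (\<theta> p w))" for v w
  proof -
    have "((\<lambda>x. F' (s x)) has_derivative (\<lambda>v. F'' * (2 * Re (\<theta> p v)))) (at p)"
      using has_derivative_compose[OF s[OF S(2)] F'[unfolded has_field_derivative_def]] .
    then have "((\<lambda>x. complex_of_real (F' (s x))) has_derivative (\<lambda>v. of_real (F'' * (2 * Re (\<theta> p v))))) (at p)"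
      by (rule has_derivative_of_real)
    from has_derivative_mult[OF this L[of w]]
    have "((\<lambda>x. delbar (\<lambda>y. complex_of_real (G y)) x w) has_derivative
       (\<lambda>v. of_real (F' (s p)) * L w v + of_real (F'' * (2 * Re (\<theta> p v))) * cnj (\<theta> p w))) (at p)"
      by (rule has_derivative_transform_within_open[OF _ S]) (simp add: db)
    then have fd: "frechet_derivative (\<lambda>x. delbar (\<lambda>y. complex_of_real (G y)) x w) (at p) =
       (\<lambda>v. of_real (F' (s p)) * L w v + of_real (F'' * (2 * Re (\<theta> p v))) * cnj (\<theta> p w))"
      by (rule frechet_derivative_at[symmetric])
    have "del (\<lambda>x. delbar (\<lambda>y. complex_of_real (G y)) x w) p v =
      of_real (F' (s p)) * ((L w v - \<i> * L w (J v)) / 2) +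
      of_real F'' * (of_real (Re (\<theta> p v)) - \<i> * of_real (Re (\<i> * \<theta> p v))) * cnj (\<theta> p w)"
      unfolding del_def fd \<theta>J[OF S(2)] by (simp add: field_simps)
    also have "of_real (Re (\<theta> p v)) - \<i> * of_real (Re (\<i> * \<theta> p v)) = \<theta> p v"
      by (simp add: complex_eq_iff)
    finally show ?thesis by (simp add: T)
  qed
  show ?thesis unfolding i_ddbar_def dd by (simp add: algebra_simps)
qed

lemma ln_cmod_sq_has_derivative:
  assumes "w \<noteq> 0"
  shows "((\<lambda>w. ln ((cmod w)\<^sup>2)) has_derivative (\<lambda>a. 2 * Re (a / w))) (at w)"
proof -
  have pos: "0 < (Re w)\<^sup>2 + (Im w)\<^sup>2" using assms complex_neq_0 by blast
  have "((\<lambda>w. (Re w)\<^sup>2 + (Im w)\<^sup>2) has_derivative (\<lambda>a. 2 * (Re w * Re a + Im w * Im a))) (at w)"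
    by (auto intro!: derivative_eq_intros simp: fun_eq_iff)
  moreover have "(ln has_derivative (\<lambda>x. x / ((Re w)\<^sup>2 + (Im w)\<^sup>2))) (at ((Re w)\<^sup>2 + (Im w)\<^sup>2))"
    by (rule has_derivative_eq_rhs[OF DERIV_ln_divide[OF pos, unfolded has_field_derivative_def]])
       (simp add: fun_eq_iff)
  ultimately have "((\<lambda>w. ln ((Re w)\<^sup>2 + (Im w)\<^sup>2)) has_derivative
      (\<lambda>a. 2 * (Re w * Re a + Im w * Im a) / ((Re w)\<^sup>2 + (Im w)\<^sup>2))) (at w)"
    by (rule has_derivative_compose)
  moreover have "2 * (Re w * Re a + Im w * Im a) / ((Re w)\<^sup>2 + (Im w)\<^sup>2) = 2 * Re (a / w)" for a
    by (simp add: Re_divide mult.commute)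
  ultimately show ?thesis unfolding cmod_power2 by simp
qed

context positive_form
begin

lemma bil_J: "bil (J v) w = \<i> * bil v w" "bil v (J w) = \<i> * bil v w"
  by (simp_all add: J_cvec bil_scale)

lemma cnj_vec_J: "cnj_vec (J v) = (- \<i>) *s cnj_vec v"
  by (simp add: J_cvec cnj_vec_scale)

lemma bil_cnj_vec_swap: "bil w (cnj_vec v) = cnj (bil v (cnj_vec w))"
  by (simp add: bil_conj bil_commute)

lemma shifted_im_has_derivative: "(shifted_im has_derivative im_vec) (at z)"
proof -
  have "(im_vec has_derivative im_vec) (at z)"
    using linear_im_vec by (intro bounded_linear_imp_has_derivative) (simp add: linear_conv_bounded_linear)
  then show ?thesis unfolding shifted_im_def[abs_def] by (rule has_derivative_add_const)
qed

lemma im_form_has_derivative: "(im_form has_derivative (\<lambda>v. 2 * Re (- \<i> * bil (shifted_im z) v))) (at z)"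
proof -
  have "((\<lambda>z. bil (shifted_im z) (shifted_im z)) has_derivative (\<lambda>v. bil (shifted_im z) (im_vec v) + bil (im_vec v) (shifted_im z))) (at z)"
    by (rule bounded_bilinear.FDERIV[OF bounded_bilinear_bil shifted_im_has_derivative shifted_im_has_derivative])
  then have "(im_form has_derivative (\<lambda>v. Re (bil (shifted_im z) (im_vec v) + bil (im_vec v) (shifted_im z)))) (at z)"
    unfolding im_form_def[abs_def] by (rule bounded_linear.has_derivative[OF bounded_linear_Re])
  moreover have "Re (bil (shifted_im z) (im_vec v) + bil (im_vec v) (shifted_im z)) = 2 * Re (- \<i> * bil (shifted_im z) v)" for v
    by (simp add: bil_commute[of "im_vec v"] bil_shifted_im_im_vec)
  ultimately show ?thesis by simp
qed

lemma cnj_del_im_form_has_derivative: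
  "((\<lambda>z. cnj (- \<i> * bil (shifted_im z) w)) has_derivative (\<lambda>v. \<i> * bil (im_vec v) (cnj_vec w))) (at z)"
proof -
  have "((\<lambda>z. bil (shifted_im z) (cnj_vec w)) has_derivative (\<lambda>v. bil (im_vec v) (cnj_vec w))) (at z)"
    using bounded_linear.has_derivative[OF bounded_bilinear.bounded_linear_left[OF bounded_bilinear_bil] shifted_im_has_derivative] .
  from has_derivative_mult_right[OF this, of "\<i>"]
  show ?thesis by (simp add: bil_conj)
qed

text \<open>\<open>v = im_vec (J v) + \<i> im_vec v\<close>, so the \<open>(1,0)\<close>-part of the differential of \<open>z \<mapsto> \<i> bil (shifted_im z) w\<close> is
  half of \<open>bil v w\<close>.\<close>

lemma del_delbar_im_form: "(\<i> * bil (im_vec v) w - \<i> * (\<i> * bil (im_vec (J v)) w)) / 2 = bil v w / 2"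
proof -
  have "im_vec (J v) = (1/2) *s (v + cnj_vec v)"
    by (simp add: im_vec_conv cnj_vec_J J_cvec vec_eq_iff cnj_vec_def algebra_simps)
  then show ?thesis unfolding im_vec_conv[of v] bil_scale bil_add
    by (simp add: bil_scale bil_add algebra_simps)
qed

text \<open>Rewrites the output of the chain rule in terms of imaginary parts, which shows that all forms involved
  are real.\<close>

lemma i_ddbar_form:
  assumes "D = \<i> * (of_real a * (bil v (cnj_vec w) / 2 - bil w (cnj_vec v) / 2) + of_real b * (x * cnj y - y * cnj x))"
  shows "D = of_real (- a * Im (bil v (cnj_vec w)) - 2 * b * Im (x * cnj y))"
proof -
  have "bil v (cnj_vec w) / 2 - bil w (cnj_vec v) / 2 = \<i> * of_real (Im (bil v (cnj_vec w)))"
    unfolding bil_cnj_vec_swap[of w v] by (simp add: complex_eq_iff)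
  moreover have "x * cnj y - y * cnj x = 2 * \<i> * of_real (Im (x * cnj y))"
    by (simp add: complex_eq_iff)
  ultimately show ?thesis unfolding assms by (simp add: complex_eq_iff)
qed

lemma i_ddbar_im_form: "i_ddbar im_form z v w = of_real (- Im (bil v (cnj_vec w)))"
proof -
  have "i_ddbar im_form z v w = \<i> * (of_real 1 * (bil v (cnj_vec w) / 2 - bil w (cnj_vec v) / 2) +
      of_real 0 * ((- \<i> * bil (shifted_im z) v) * cnj (- \<i> * bil (shifted_im z) w) - (- \<i> * bil (shifted_im z) w) * cnj (- \<i> * bil (shifted_im z) v)))"
    by (rule i_ddbar_compose[where S = UNIV and s = im_form and \<theta> = "\<lambda>z v. - \<i> * bil (shifted_im z) v"
        and F = "\<lambda>x. x" and F' = "\<lambda>_. 1",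
        OF _ _ im_form_has_derivative _ cnj_del_im_form_has_derivative _ _ _ del_delbar_im_form])
      (auto simp: bil_J)
  from i_ddbar_form[OF this] show ?thesis by simp
qed

definition log_norm :: "complex \<times> (complex^'n) \<Rightarrow> real" where
  "log_norm p = ln ((cmod (fst p))\<^sup>2) + im_form (snd p)"

text \<open>The form \<open>\<partial> log_norm\<close>: the two terms come from \<open>\<partial> log |w|\<^sup>2 = dw / w\<close> and \<open>\<partial> im_form\<close>.\<close>

definition del_log_norm :: "complex \<times> (complex^'n) \<Rightarrow> complex \<times> (complex^'n) \<Rightarrow> complex" where
  "del_log_norm p v = fst v / fst p - \<i> * bil (shifted_im (snd p)) (snd v)"

text \<open>The Riemannian metric whose Kaehler form is \<open>-(n+2) \<surd>-1 \<partial>\<partial>bar log |log_norm|\<close>.\<close>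

definition cusp_metric :: "complex \<times> (complex^'n) \<Rightarrow> complex \<times> (complex^'n) \<Rightarrow> complex \<times> (complex^'n) \<Rightarrow> real" where
  "cusp_metric p v w = (real CARD('n) + 2) *
     (Re (bil (snd v) (cnj_vec (snd w))) / (- log_norm p) +
      2 * Re (del_log_norm p v * cnj (del_log_norm p w)) / (log_norm p)\<^sup>2)"

lemma log_norm_has_derivative:
  assumes "fst p \<noteq> 0"
  shows "(log_norm has_derivative (\<lambda>v. 2 * Re (del_log_norm p v))) (at p)"
proof -
  have a: "((\<lambda>p. ln ((cmod (fst p))\<^sup>2)) has_derivative (\<lambda>v. 2 * Re (fst v / fst p))) (at p)"
    using has_derivative_compose[OF has_derivative_fst[OF has_derivative_ident] ln_cmod_sq_has_derivative[OF assms]] .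
  have b: "((\<lambda>p. im_form (snd p)) has_derivative (\<lambda>v. 2 * Re (- \<i> * bil (shifted_im (snd p)) (snd v)))) (at p)"
    using has_derivative_compose[OF has_derivative_snd[OF has_derivative_ident] im_form_has_derivative] .
  show ?thesis
    using has_derivative_add[OF a b] unfolding log_norm_def[abs_def] del_log_norm_def
    by (simp add: algebra_simps)
qed

lemma del_log_norm_J: "del_log_norm p (J v) = \<i> * del_log_norm p v"
  by (simp add: del_log_norm_def J_prod_def J_complex bil_J algebra_simps)

lemma log_norm_i_ddbar:
  assumes S: "open S" "p \<in> S" "\<And>x. x \<in> S \<Longrightarrow> fst x \<noteq> 0"
    and F: "\<And>x. x \<in> S \<Longrightarrow> (F has_real_derivative F' (log_norm x)) (at (log_norm x))"
    and F': "(F' has_real_derivative F'') (at (log_norm p))"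
    and G: "\<And>x. x \<in> S \<Longrightarrow> G x = F (log_norm x)"
  shows "i_ddbar G p v w = of_real (- F' (log_norm p) * Im (bil (snd v) (cnj_vec (snd w))) -
     2 * F'' * Im (del_log_norm p v * cnj (del_log_norm p w)))"
proof (rule i_ddbar_form)
  define L where "L w v = cnj (- fst w * fst v / (fst p)\<^sup>2) + \<i> * bil (im_vec (snd v)) (cnj_vec (snd w))" for w v :: "complex \<times> (complex^'n)"
  have p0: "fst p \<noteq> 0" using S by blast
  have Ld: "((\<lambda>x. cnj (del_log_norm x w)) has_derivative L w) (at p)" for w
  proof -
    have "((\<lambda>z. fst w / z) has_derivative (\<lambda>h. (- fst w / (fst p)\<^sup>2) * h)) (at (fst p))"
      unfolding has_field_derivative_def[symmetric] using p0
      by (auto intro!: derivative_eq_intros simp: power2_eq_square)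
    from bounded_linear.has_derivative[OF bounded_linear_cnj
      has_derivative_compose[OF has_derivative_fst[OF has_derivative_ident] this]]
    have a: "((\<lambda>x. cnj (fst w / fst x)) has_derivative (\<lambda>v. cnj ((- fst w / (fst p)\<^sup>2) * fst v))) (at p)" .
    have b: "((\<lambda>x. cnj (- \<i> * bil (shifted_im (snd x)) (snd w))) has_derivative (\<lambda>v. \<i> * bil (im_vec (snd v)) (cnj_vec (snd w)))) (at p)"
      using has_derivative_compose[OF has_derivative_snd[OF has_derivative_ident] cnj_del_im_form_has_derivative] .
    show ?thesis using has_derivative_add[OF a b] unfolding L_def del_log_norm_def by simp
  qed
  have T: "(L w v - \<i> * L w (J v)) / 2 = bil (snd v) (cnj_vec (snd w)) / 2" for v w
  proof -
    have "L w v - \<i> * L w (J v) = \<i> * bil (im_vec (snd v)) (cnj_vec (snd w)) - \<i> * (\<i> * bil (im_vec (J (snd v))) (cnj_vec (snd w)))"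
      by (simp add: L_def J_prod_def J_complex algebra_simps)
    then show ?thesis by (simp only: del_delbar_im_form)
  qed
  show "i_ddbar G p v w = \<i> * (of_real (F' (log_norm p)) * (bil (snd v) (cnj_vec (snd w)) / 2 - bil (snd w) (cnj_vec (snd v)) / 2) +
     of_real F'' * (del_log_norm p v * cnj (del_log_norm p w) - del_log_norm p w * cnj (del_log_norm p v)))"
    by (rule i_ddbar_compose[OF S(1,2) log_norm_has_derivative[OF S(3)] del_log_norm_J Ld F F' G T])
qed

text \<open>The counterpart upstairs of the formula for functions of \<open>log_norm\<close>.  It needs a separate proof because the
  kernel function is only given on the covering domain, where \<open>u\<close> replaces \<open>w\<close>.\<close>

lemma siegel_i_ddbar:
  assumes p: "p \<in> siegel"
    and F: "\<And>t. t < 0 \<Longrightarrow> (F has_real_derivative F' t) (at t)"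
    and F': "(F' has_real_derivative F'') (at (im_form (snd p) - Im (fst p)))"
    and G: "\<And>x. x \<in> siegel \<Longrightarrow> G x = F (im_form (snd x) - Im (fst x))"
  defines "\<theta> \<equiv> \<lambda>v. \<i> * fst v / 2 - \<i> * bil (shifted_im (snd p)) (snd v)"
  shows "i_ddbar G p v w = of_real (- F' (im_form (snd p) - Im (fst p)) * Im (bil (snd v) (cnj_vec (snd w))) -
     2 * F'' * Im (\<theta> v * cnj (\<theta> w)))"
proof (rule i_ddbar_form)
  let ?\<theta> = "\<lambda>p v. \<i> * fst v / 2 - \<i> * bil (shifted_im (snd p)) (snd v)"
  let ?s = "\<lambda>x. im_form (snd x) - Im (fst x)"
  have F0: "(F has_real_derivative F' (?s x)) (at (?s x))" if "x \<in> siegel" for x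
    using that by (intro F) (simp add: siegel_def)
  have sd: "(?s has_derivative (\<lambda>v. 2 * Re (?\<theta> x v))) (at x)" for x
  proof -
    have b: "((\<lambda>p. im_form (snd p)) has_derivative (\<lambda>v. 2 * Re (- \<i> * bil (shifted_im (snd x)) (snd v)))) (at x)"
      using has_derivative_compose[OF has_derivative_snd[OF has_derivative_ident] im_form_has_derivative] .
    have a: "((\<lambda>p. Im (fst p)) has_derivative (\<lambda>v. Im (fst v))) (at x)"
      by (intro bounded_linear.has_derivative[OF bounded_linear_Im] has_derivative_fst has_derivative_ident)
    show ?thesis using has_derivative_diff[OF b a] by (simp add: algebra_simps)
  qed
  have \<theta>J: "?\<theta> x (J v) = \<i> * ?\<theta> x v" for x v
    by (simp add: J_prod_def J_complex bil_J algebra_simps)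
  have Ld: "((\<lambda>x. cnj (?\<theta> x w)) has_derivative (\<lambda>v. \<i> * bil (im_vec (snd v)) (cnj_vec (snd w)))) (at p)" for w
  proof -
    have b: "((\<lambda>x. cnj (- \<i> * bil (shifted_im (snd x)) (snd w))) has_derivative (\<lambda>v. \<i> * bil (im_vec (snd v)) (cnj_vec (snd w)))) (at p)"
      using has_derivative_compose[OF has_derivative_snd[OF has_derivative_ident] cnj_del_im_form_has_derivative] .
    from has_derivative_add_const[OF this, of "cnj (\<i> * fst w / 2)"] show ?thesis by (simp add: algebra_simps)
  qed
  have T: "(\<i> * bil (im_vec (snd v)) (cnj_vec (snd w)) - \<i> * (\<i> * bil (im_vec (snd (J v))) (cnj_vec (snd w)))) / 2 =
      bil (snd v) (cnj_vec (snd w)) / 2" for v w :: "complex \<times> (complex^'n)"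
    by (simp only: J_prod_def snd_conv del_delbar_im_form)
  have "i_ddbar G p v w = \<i> * (of_real (F' (?s p)) * (bil (snd v) (cnj_vec (snd w)) / 2 - bil (snd w) (cnj_vec (snd v)) / 2) +
     of_real F'' * (?\<theta> p v * cnj (?\<theta> p w) - ?\<theta> p w * cnj (?\<theta> p v)))"
    by (rule i_ddbar_compose[where s = ?s and \<theta> = ?\<theta>, OF open_siegel p sd \<theta>J Ld F0 F' G T])
  then show "i_ddbar G p v w = \<i> * (of_real (F' (?s p)) * (bil (snd v) (cnj_vec (snd w)) / 2 - bil (snd w) (cnj_vec (snd v)) / 2) +
     of_real F'' * (\<theta> v * cnj (\<theta> w) - \<theta> w * cnj (\<theta> v)))"
    by (simp only: \<theta>_def)
qed

lemma kaehler_form_cusp_metric: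
  "kaehler_form cusp_metric p v w = of_real ((real CARD('n) + 2) *
     (Im (bil (snd v) (cnj_vec (snd w))) / log_norm p -
      2 * Im (del_log_norm p v * cnj (del_log_norm p w)) / (log_norm p)\<^sup>2))"
proof -
  have r: "Re (\<i> * a) = - Im a" for a by simp
  have gen: "(- a) / (- l) + 2 * (- b) / m = a / l - 2 * b / m" for a b l m :: real by simp
  show ?thesis
    unfolding kaehler_form_def cusp_metric_def del_log_norm_J
    unfolding J_prod_def snd_conv bil_J mult.assoc r by (simp only: gen mult.assoc)
qed

lemma punctured_disc_open: "open {p. fst p \<noteq> 0 \<and> log_norm p < 0}"
proof -
  have "continuous_on {p::complex \<times> (complex^'n). fst p \<noteq> 0} log_norm"
    by (intro continuous_at_imp_continuous_on ballI has_derivative_continuous[OF log_norm_has_derivative]) simp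
  moreover have "open {p::complex \<times> (complex^'n). fst p \<noteq> 0}"
    by (intro open_Collect_neq continuous_intros)
  ultimately have "open ({p. fst p \<noteq> 0} \<inter> log_norm -` {..<0})"
    by (intro continuous_open_preimage) auto
  also have "{p. fst p \<noteq> 0} \<inter> log_norm -` {..<0} = {p. fst p \<noteq> 0 \<and> log_norm p < 0}" by auto
  finally show ?thesis .
qed

text \<open>The linear term \<open>b\<close> serves the Calabi potential, where it is \<open>- 1\<close>; without it one gets the form
  \<open>\<surd>-1 \<partial>\<partial>bar log |log r|\<close>.\<close>

lemma i_ddbar_log_potential:
  assumes p: "fst p \<noteq> 0" "log_norm p < 0"
    and G: "\<And>x. fst x \<noteq> 0 \<Longrightarrow> log_norm x < 0 \<Longrightarrow> G x = a * ln \<bar>log_norm x\<bar> + b * log_norm x"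
  shows "i_ddbar G p v w = of_real (- (a / log_norm p + b) * Im (bil (snd v) (cnj_vec (snd w))) +
     2 * a / (log_norm p)\<^sup>2 * Im (del_log_norm p v * cnj (del_log_norm p w)))"
proof -
  have "i_ddbar G p v w = of_real (- (a / log_norm p + b) * Im (bil (snd v) (cnj_vec (snd w))) -
     2 * (- a / (log_norm p)\<^sup>2) * Im (del_log_norm p v * cnj (del_log_norm p w)))"
  proof (rule log_norm_i_ddbar[where F = "\<lambda>t. a * ln (- t) + b * t" and F' = "\<lambda>t. a / t + b",
        OF punctured_disc_open])
    show "((\<lambda>t. a * ln (- t) + b * t) has_real_derivative a / log_norm x + b) (at (log_norm x))"
      if "x \<in> {p. fst p \<noteq> 0 \<and> log_norm p < 0}" for x
      using that by (auto intro!: derivative_eq_intros)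
    show "((\<lambda>t. a / t + b) has_real_derivative - a / (log_norm p)\<^sup>2) (at (log_norm p))"
      using p by (auto intro!: derivative_eq_intros simp: power2_eq_square)
  qed (use p G in auto)
  then show ?thesis by simp
qed

lemma i_ddbar_log_abs_log_norm:
  assumes p: "fst p \<noteq> 0" "log_norm p < 0"
    and G: "\<And>x. fst x \<noteq> 0 \<Longrightarrow> log_norm x < 0 \<Longrightarrow> G x = ln \<bar>log_norm x\<bar>"
  shows "kaehler_form cusp_metric p v w = - (of_nat CARD('n) + 2) * i_ddbar G p v w"
proof -
  have "i_ddbar G p v w = of_real (- (1 / log_norm p + 0) * Im (bil (snd v) (cnj_vec (snd w))) +
     2 * 1 / (log_norm p)\<^sup>2 * Im (del_log_norm p v * cnj (del_log_norm p w)))"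
    using G by (intro i_ddbar_log_potential[OF p]) simp
  moreover define A where "A = Im (bil (snd v) (cnj_vec (snd w)))"
  moreover define B where "B = Im (del_log_norm p v * cnj (del_log_norm p w))"
  moreover have "(real CARD('n) + 2) * (A / log_norm p - 2 * B / (log_norm p)\<^sup>2) =
      - (real CARD('n) + 2) * (- (1 / log_norm p + 0) * A + 2 * 1 / (log_norm p)\<^sup>2 * B)"
    by (simp only: divide_inverse) (simp add: algebra_simps)
  ultimately show ?thesis
    unfolding kaehler_form_cusp_metric
    by (simp only: of_real_mult of_real_minus of_real_add of_real_of_nat_eq of_real_numeral)
qed

text \<open>The term \<open>- s\<close> of the Calabi potential cancels the pull-back of the form on the base, because \<open>s\<close> and the
  function \<open>im_form\<close> differ by the pluriharmonic \<open>log |w|\<^sup>2\<close>.\<close>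

lemma cusp_metric_calabi:
  assumes p: "fst p \<noteq> 0" "log_norm p < 0"
    and G: "\<And>x. fst x \<noteq> 0 \<Longrightarrow> log_norm x < 0 \<Longrightarrow> G x = calabi_potential CARD('n) (log_norm x)"
  shows "kaehler_form cusp_metric p v w = pullback snd (i_ddbar im_form) p v w + i_ddbar G p v w"
proof -
  have "i_ddbar G p v w = of_real (- (- (real CARD('n) + 2) / log_norm p + (- 1)) * Im (bil (snd v) (cnj_vec (snd w))) +
     2 * (- (real CARD('n) + 2)) / (log_norm p)\<^sup>2 * Im (del_log_norm p v * cnj (del_log_norm p w)))"
    using G by (intro i_ddbar_log_potential[OF p]) (simp add: calabi_potential_def)
  moreover have "frechet_derivative snd (at p) = (snd :: complex \<times> (complex^'n) \<Rightarrow> _)"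
    by (intro frechet_derivative_at[symmetric] has_derivative_snd has_derivative_ident)
  then have "pullback snd (i_ddbar im_form) p v w = of_real (- Im (bil (snd v) (cnj_vec (snd w))))"
    by (simp add: pullback_def i_ddbar_im_form)
  moreover define A where "A = Im (bil (snd v) (cnj_vec (snd w)))"
  moreover define B where "B = Im (del_log_norm p v * cnj (del_log_norm p w))"
  moreover have "(real CARD('n) + 2) * (A / log_norm p - 2 * B / (log_norm p)\<^sup>2) =
      - A + (- (- (real CARD('n) + 2) / log_norm p + (- 1)) * A + 2 * (- (real CARD('n) + 2)) / (log_norm p)\<^sup>2 * B)"
    by (simp only: divide_inverse) (simp add: algebra_simps)
  ultimately show ?thesis
    unfolding kaehler_form_cusp_metric by (simp only: of_real_add[symmetric])
qed

text \<open>Positivity: the first summand sees every vector with a component along the base, and on vertical vectors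
  the second one is a positive multiple of \<open>|dw / w|\<^sup>2\<close>.\<close>

lemma cusp_metric_hermitian:
  assumes "\<And>p. p \<in> S \<Longrightarrow> fst p \<noteq> 0 \<and> log_norm p < 0"
  shows "hermitian_metric_on S cusp_metric"
  unfolding hermitian_metric_on_def
proof (intro ballI conjI allI impI)
  fix p assume "p \<in> S"
  then have p: "fst p \<noteq> 0" "log_norm p < 0" using assms by auto
  let ?d = "del_log_norm p"
  have lin: "?d (v + v') = ?d v + ?d v'" "?d (a *\<^sub>R v) = a *\<^sub>R ?d v" for v v' a
    by (simp_all add: del_log_norm_def bil_add bil_scaleR algebra_simps add_divide_distrib scaleR_conv_of_real[where 'a=complex])
  have cv: "cnj_vec (v + v') = cnj_vec v + cnj_vec v'" "cnj_vec (a *\<^sub>R v) = a *\<^sub>R cnj_vec v" for v v' :: "complex^'n" and a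
    by (simp_all add: cnj_vec_add) (simp add: cnj_vec_def vec_eq_iff)
  show "bilinear (cusp_metric p)"
    unfolding bilinear_def linear_iff cusp_metric_def
    by (simp add: lin cv bil_add bil_scaleR algebra_simps add_divide_distrib)
  fix v w
  show "cusp_metric p v w = cusp_metric p w v"
    unfolding cusp_metric_def bil_cnj_vec_swap[of "snd v" "snd w"] by (simp add: mult.commute)
  show "cusp_metric p (J v) (J w) = cusp_metric p v w"
    unfolding cusp_metric_def del_log_norm_J
    unfolding J_prod_def snd_conv cnj_vec_J bil_J bil_scale by simp
  show "0 < cusp_metric p v v" if "v \<noteq> 0"
  proof -
    have "?d v * cnj (?d v) = of_real ((cmod (?d v))\<^sup>2)" by (rule complex_norm_square[symmetric])
    then have e: "Re (?d v * cnj (?d v)) = (cmod (?d v))\<^sup>2" by (simp only: Re_complex_of_real)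
    have "0 < Re (bil (snd v) (cnj_vec (snd v))) / (- log_norm p) + 2 * (cmod (?d v))\<^sup>2 / (log_norm p)\<^sup>2"
    proof (cases "snd v = 0")
      case True
      then have "fst v \<noteq> 0" using that by (simp add: prod_eq_iff)
      then have "?d v \<noteq> 0" using True p by (simp add: del_log_norm_def bil_def)
      then show ?thesis using True p by (simp add: bil_def)
    next
      case False
      then have "0 < Re (bil (snd v) (cnj_vec (snd v))) / (- log_norm p)"
        using bil_self_conj_pos p by (intro divide_pos_pos) auto
      then show ?thesis by (intro add_pos_nonneg) auto
    qed
    then show ?thesis unfolding cusp_metric_def e by (intro mult_pos_pos) auto
  qed
qed

lemma cover_map_has_derivative:
  "(cover_map has_derivative (\<lambda>v. (exp (\<i> * fst p / 2) * (\<i> * fst v / 2), snd v))) (at (p :: complex \<times> (complex^'n)))"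
proof -
  have "((\<lambda>u. exp (\<i> * u / 2)) has_derivative (\<lambda>h. (exp (\<i> * fst p / 2) * (\<i> / 2)) * h)) (at (fst p))"
    unfolding has_field_derivative_def[symmetric] by (auto intro!: derivative_eq_intros)
  from has_derivative_compose[OF has_derivative_fst[OF has_derivative_ident] this]
  have "((\<lambda>p. exp (\<i> * fst p / 2)) has_derivative (\<lambda>v. exp (\<i> * fst p / 2) * (\<i> / 2) * fst v)) (at p)" .
  from has_derivative_Pair[OF this has_derivative_snd[OF has_derivative_ident]]
  show ?thesis unfolding cover_map_def[abs_def] by (simp add: mult.assoc)
qed

lemma log_norm_cover_map: "log_norm (cover_map p) = im_form (snd p) - Im (fst p)"
proof -
  have "(cmod (exp (\<i> * fst p / 2)))\<^sup>2 = exp (- Im (fst p))"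
    by (simp add: power2_eq_square exp_add[symmetric])
  then show ?thesis by (simp add: log_norm_def cover_map_def)
qed

text \<open>The logarithm of the kernel is \<open>log C - (n + 2) log (- s)\<close> with \<open>s = log r\<close> pulled back by the covering map;
  the constant \<open>C\<close> is invisible to the operator.\<close>

lemma cusp_metric_bergman:
  assumes p: "p \<in> siegel"
  shows "kaehler_form cusp_metric (cover_map p) (exp (\<i> * fst p / 2) * (\<i> * fst v / 2), snd v)
      (exp (\<i> * fst p / 2) * (\<i> * fst w / 2), snd w) =
    i_ddbar (\<lambda>x. ln (Re (bergman_kernel siegel x x))) p v w"
proof -
  obtain C where C: "0 < C" "\<And>p. p \<in> siegel \<Longrightarrow> bergman_kernel siegel p p =
     complex_of_real (C / (Im (fst p) - im_form (snd p)) ^ (CARD('n) + 2))"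
    using siegel_bergman_kernel by blast
  let ?N = "real CARD('n) + 2"
  let ?s = "im_form (snd p) - Im (fst p)"
  let ?\<theta> = "\<lambda>v. \<i> * fst v / 2 - \<i> * bil (shifted_im (snd p)) (snd v)"
  have s: "?s < 0" using p by (simp add: siegel_def)
  have "i_ddbar (\<lambda>x. ln (Re (bergman_kernel siegel x x))) p v w =
    of_real (- (- ?N / ?s) * Im (bil (snd v) (cnj_vec (snd w))) - 2 * (?N / ?s\<^sup>2) * Im (?\<theta> v * cnj (?\<theta> w)))"
  proof (rule siegel_i_ddbar[OF p, where F = "\<lambda>t. ln C - ?N * ln (- t)" and F' = "\<lambda>t. - ?N / t"])
    show "((\<lambda>t. ln C - ?N * ln (- t)) has_real_derivative - ?N / t) (at t)" if "t < 0" for t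
      using that by (auto intro!: derivative_eq_intros simp: field_simps)
    show "((\<lambda>t. - ?N / t) has_real_derivative ?N / ?s\<^sup>2) (at ?s)"
      using s by (auto intro!: derivative_eq_intros simp: power2_eq_square)
    show "ln (Re (bergman_kernel siegel x x)) = ln C - ?N * ln (- (im_form (snd x) - Im (fst x)))" if x: "x \<in> siegel" for x
    proof -
      have "0 < Im (fst x) - im_form (snd x)" using x by (simp add: siegel_def)
      then show ?thesis
        unfolding C(2)[OF x] Re_complex_of_real using C(1) ln_realpow[of "Im (fst x) - im_form (snd x)" "CARD('n) + 2"]
        by (subst ln_divide_pos) simp_all
    qed
  qed
  moreover have "del_log_norm (cover_map p) (exp (\<i> * fst p / 2) * (\<i> * fst v / 2), snd v) = ?\<theta> v" for v
    by (simp add: del_log_norm_def cover_map_def)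
  moreover define A where "A = Im (bil (snd v) (cnj_vec (snd w)))"
  moreover define B where "B = Im (?\<theta> v * cnj (?\<theta> w))"
  moreover have "?N * (A / ?s - 2 * B / ?s\<^sup>2) = - (- ?N / ?s) * A - 2 * (?N / ?s\<^sup>2) * B"
    by (simp only: divide_inverse) (simp add: algebra_simps)
  ultimately show ?thesis
    unfolding kaehler_form_cusp_metric log_norm_cover_map by (simp only: snd_conv)
qed

end

section \<open>Metrics on the punctured disc bundle\<close>

lemma i_ddbar_const: "i_ddbar (\<lambda>x::'a::complex_structure. k) z v w = 0"
proof -
  have fc: "frechet_derivative (\<lambda>x::'a. a) (at y) = (\<lambda>_. 0)" for a :: complex and y
    by (intro frechet_derivative_at[symmetric] has_derivative_const)
  show ?thesis unfolding i_ddbar_def del_def delbar_def by (simp add: fc)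
qed

text \<open>The situation of the theorem in coordinates: the action of \<open>\<Gamma>\<close> is holomorphic and preserves a Hermitian metric whose
  logarithm is quadratic in the imaginary part of \<open>z\<close>.\<close>

locale cusp_bundle = positive_form P c for P :: "real^'n^'n" and c :: "real^'n" +
  fixes \<Gamma> :: "(complex^'n) set" and e :: "'n factor" and h :: "complex^'n \<Rightarrow> real"
  assumes h_eq: "h z = exp (im_form z)"
    and zero_in: "0 \<in> \<Gamma>" and e_zero: "e 0 z = 1"
    and e_holo: "\<gamma> \<in> \<Gamma> \<Longrightarrow> holo_on UNIV (e \<gamma>)"
    and h_invariant: "\<gamma> \<in> \<Gamma> \<Longrightarrow> (cmod (e \<gamma> z))\<^sup>2 * h (z + \<gamma>) = h z"
begin

abbreviation "punctured_disc \<equiv> {p :: complex \<times> (complex^'n). fst p \<noteq> 0 \<and> log_norm p < 0}"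

lemma sq_norm_eq_exp: "fst p \<noteq> 0 \<Longrightarrow> sq_norm h p = exp (log_norm p)"
  by (simp add: sq_norm_def h_eq log_norm_def exp_add)

lemma ln_sq_norm: "fst p \<noteq> 0 \<Longrightarrow> ln (sq_norm h p) = log_norm p"
  by (simp add: sq_norm_eq_exp)

lemma sq_norm_act: "\<gamma> \<in> \<Gamma> \<Longrightarrow> sq_norm h (act e \<gamma> p) = sq_norm h p"
  using h_invariant[of \<gamma> "snd p"]
  by (simp add: sq_norm_def act_def norm_mult power_mult_distrib mult_ac)

lemma punctured_disc_iff: "p \<in> punctured_disc \<longleftrightarrow> 0 < sq_norm h p \<and> sq_norm h p < 1"
proof (cases "fst p = 0")
  case False
  then show ?thesis by (simp add: sq_norm_eq_exp)
qed (simp add: sq_norm_def)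

text \<open>The condition on the norm is invariant under the action, so being in an orbit that meets the set is the
  same as being in the set.\<close>

lemma preim_disc_bundle: "preim \<Gamma> e (disc_bundle \<Gamma> e h 0) = punctured_disc"
proof
  show "punctured_disc \<subseteq> preim \<Gamma> e (disc_bundle \<Gamma> e h 0)"
    using punctured_disc_iff by (auto simp: preim_def disc_bundle_def)
  show "preim \<Gamma> e (disc_bundle \<Gamma> e h 0) \<subseteq> punctured_disc"
  proof
    fix p assume "p \<in> preim \<Gamma> e (disc_bundle \<Gamma> e h 0)"
    then obtain p' where p': "bundle_proj \<Gamma> e p = bundle_proj \<Gamma> e p'" "0 < sq_norm h p'" "sq_norm h p' < 1"
      by (auto simp: preim_def disc_bundle_def)
    have "act e 0 p = p" by (simp add: act_def e_zero)
    then have "p \<in> bundle_proj \<Gamma> e p" using zero_in unfolding bundle_proj_def by force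
    then obtain \<gamma> where "\<gamma> \<in> \<Gamma>" "p = act e \<gamma> p'" unfolding p'(1) by (auto simp: bundle_proj_def)
    then show "p \<in> punctured_disc" using p' by (subst punctured_disc_iff) (simp add: sq_norm_act)
  qed
qed

lemma e_nonzero: "\<gamma> \<in> \<Gamma> \<Longrightarrow> e \<gamma> z \<noteq> 0"
  using h_invariant[of \<gamma> z] by (auto simp: h_eq)

lemma act_punctured_disc: "\<gamma> \<in> \<Gamma> \<Longrightarrow> p \<in> punctured_disc \<Longrightarrow> act e \<gamma> p \<in> punctured_disc"
  unfolding punctured_disc_iff by (simp add: sq_norm_act)

lemma log_norm_act:
  assumes "\<gamma> \<in> \<Gamma>" "fst p \<noteq> 0" shows "log_norm (act e \<gamma> p) = log_norm p"
proof -
  have "fst (act e \<gamma> p) \<noteq> 0" using assms by (simp add: act_def e_nonzero)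
  then show ?thesis using sq_norm_act[OF assms(1), of p] assms(2) by (simp add: sq_norm_eq_exp)
qed

lemma act_has_derivative:
  assumes "\<gamma> \<in> \<Gamma>"
  shows "\<exists>D. (act e \<gamma> has_derivative D) (at p) \<and> (\<forall>v. D (J v) = J (D v)) \<and> (\<forall>v. snd (D v) = snd v)"
proof -
  obtain E where E: "(e \<gamma> has_derivative E) (at (snd p))" "\<And>v. E (J v) = \<i> * E v"
    using e_holo[OF assms] unfolding holo_on_def by blast
  have "((\<lambda>p. e \<gamma> (snd p)) has_derivative (\<lambda>v. E (snd v))) (at p)"
    using has_derivative_compose[OF has_derivative_snd[OF has_derivative_ident] E(1)] .
  from has_derivative_mult[OF this has_derivative_fst[OF has_derivative_ident]]
  have a: "((\<lambda>p. e \<gamma> (snd p) * fst p) has_derivative (\<lambda>v. e \<gamma> (snd p) * fst v + E (snd v) * fst p)) (at p)" .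
  have b: "((\<lambda>p. snd p + \<gamma>) has_derivative snd) (at p)"
    by (intro has_derivative_add_const has_derivative_snd has_derivative_ident)
  have "(act e \<gamma> has_derivative (\<lambda>v. (e \<gamma> (snd p) * fst v + E (snd v) * fst p, snd v))) (at p)"
    unfolding act_def[abs_def] using has_derivative_Pair[OF a b] .
  then show ?thesis
    by (intro exI[of _ "\<lambda>v. (e \<gamma> (snd p) * fst v + E (snd v) * fst p, snd v)"])
       (simp add: J_prod_def E(2) J_complex algebra_simps)
qed

text \<open>The metric is built from \<open>s\<close>, \<open>\<partial>s\<close> and a constant form on the base.  Since \<open>s\<close> is invariant and the action
  is by translations on the base, only first derivatives of the factor of automorphy enter.\<close>

lemma cusp_metric_invariant:
  assumes \<gamma>: "\<gamma> \<in> \<Gamma>" and p: "p \<in> punctured_disc"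
  shows "pullback (act e \<gamma>) cusp_metric p v w = cusp_metric p v w"
proof -
  obtain D where D: "(act e \<gamma> has_derivative D) (at p)" "\<And>v. D (J v) = J (D v)" "\<And>v. snd (D v) = snd v"
    using act_has_derivative[OF \<gamma>] by blast
  have fd: "frechet_derivative (act e \<gamma>) (at p) = D" by (rule frechet_derivative_at[OF D(1), symmetric])
  have p0: "fst p \<noteq> 0" "fst (act e \<gamma> p) \<noteq> 0" using p act_punctured_disc[OF \<gamma> p] by auto
  have "((\<lambda>x. log_norm (act e \<gamma> x)) has_derivative (\<lambda>v. 2 * Re (del_log_norm (act e \<gamma> p) (D v)))) (at p)"
    using has_derivative_compose[OF D(1) log_norm_has_derivative[OF p0(2)]] .
  moreover have "((\<lambda>x. log_norm (act e \<gamma> x)) has_derivative (\<lambda>v. 2 * Re (del_log_norm p v))) (at p)"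
    by (rule has_derivative_transform_within_open[OF log_norm_has_derivative[OF p0(1)] punctured_disc_open p])
       (simp add: log_norm_act[OF \<gamma>])
  ultimately have "(\<lambda>v. 2 * Re (del_log_norm (act e \<gamma> p) (D v))) = (\<lambda>v. 2 * Re (del_log_norm p v))"
    by (rule has_derivative_unique)
  \<comment> \<open>Only real parts are compared by the chain rule; complex linearity recovers the imaginary parts.\<close>
  then have re: "Re (del_log_norm (act e \<gamma> p) (D v)) = Re (del_log_norm p v)" for v
    by (auto dest: fun_cong)
  have "del_log_norm (act e \<gamma> p) (D v) = del_log_norm p v" for v
    using re[of v] re[of "J v"] by (simp add: complex_eq_iff D(2) del_log_norm_J)
  then show ?thesis
    unfolding pullback_def fd cusp_metric_def D(3) log_norm_act[OF \<gamma> p0(1)] by simp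
qed

lemma cusp_metric_quotient: "quotient_metric_on \<Gamma> e (disc_bundle \<Gamma> e h 0) cusp_metric"
  unfolding quotient_metric_on_def preim_disc_bundle
  using cusp_metric_invariant by (auto intro: cusp_metric_hermitian)

lemma siegel_domain_eq: "siegel_domain h = siegel"
  by (auto simp: siegel_domain_def siegel_def h_eq)

lemma kaehler_form_pullback_cover_map:
  "kaehler_form (pullback cover_map g) p v w =
    kaehler_form g (cover_map p) (exp (\<i> * fst p / 2) * (\<i> * fst v / 2), snd v)
      (exp (\<i> * fst p / 2) * (\<i> * fst w / 2), snd (w :: complex \<times> (complex^'n)))"
  unfolding kaehler_form_def pullback_def frechet_derivative_at[OF cover_map_has_derivative, symmetric]
  by (simp add: J_prod_def J_complex mult_ac)

lemma cusp_metric_bergman_type: "bergman_type_metric \<Gamma> e h cusp_metric"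
  unfolding bergman_type_metric_def siegel_domain_eq kaehler_form_pullback_cover_map
  using cusp_metric_quotient cusp_metric_bergman by auto

lemma kaehler_form_eq_imp_eq:
  assumes "\<And>v w. kaehler_form g p v w = kaehler_form g' p v w"
  shows "g p v w = g' p v w"
proof -
  have "J (J (- v)) = v" by (simp add: J_J)
  then show ?thesis using assms[of "J (- v)" w] by (simp add: kaehler_form_def)
qed

text \<open>Every nonzero \<open>w\<close> is \<open>exp (\<i> u / 2)\<close> for some \<open>u\<close>, and the differential of the covering map is onto, so a
  metric is determined by its pull-back.\<close>

lemma bergman_type_metric_unique:
  assumes g: "bergman_type_metric \<Gamma> e h g" and p: "p \<in> punctured_disc"
  shows "g p v w = cusp_metric p v w"
proof (rule kaehler_form_eq_imp_eq)
  fix v w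
  \<comment> \<open>Any logarithm of \<open>w\<close> will do: the norm condition depends on \<open>Im u\<close> only.\<close>
  define u where "u = - 2 * \<i> * Ln (fst p)"
  have p0: "fst p \<noteq> 0" using p by simp
  have ex: "exp (\<i> * u / 2) = fst p" using p0 by (simp add: u_def)
  have cov: "cover_map (u, snd p) = p" by (simp add: cover_map_def ex)
  have us: "(u, snd p) \<in> siegel"
    using p log_norm_cover_map[of "(u, snd p)"] unfolding cov by (simp add: siegel_def)
  define l where "l v = (fst v * 2 / (\<i> * fst p), snd v)" for v :: "complex \<times> (complex^'n)"
  have l: "(fst p * (\<i> * fst (l v) / 2), snd (l v)) = v" for v
    using p0 by (simp add: l_def prod_eq_iff)
  have "kaehler_form (pullback cover_map g) (u, snd p) (l v) (l w) =
      kaehler_form (pullback cover_map cusp_metric) (u, snd p) (l v) (l w)"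
  proof -
    have "kaehler_form (pullback cover_map g') (u, snd p) (l v) (l w) =
        i_ddbar (\<lambda>x. ln (Re (bergman_kernel siegel x x))) (u, snd p) (l v) (l w)"
      if "bergman_type_metric \<Gamma> e h g'" for g'
      using that us unfolding bergman_type_metric_def siegel_domain_eq by blast
    then show ?thesis using g cusp_metric_bergman_type by simp
  qed
  then show "kaehler_form g p v w = kaehler_form cusp_metric p v w"
    unfolding kaehler_form_pullback_cover_map by (simp only: cov fst_conv ex l)
qed

lemma ln_h: "(\<lambda>z. ln (h z)) = im_form"
  by (simp add: h_eq fun_eq_iff)

text \<open>The matrix of \<open>\<partial>\<partial>bar\<close> of a quadratic form is constant, hence so is its determinant.\<close>

lemma im_form_ricci_flat: "ricci_flat_kaehler_potential im_form"
  unfolding ricci_flat_kaehler_potential_def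
proof (intro conjI allI impI)
  fix z v :: "complex^'n" assume "v \<noteq> 0"
  have "i_ddbar im_form z v (J v) = of_real (Re (bil v (cnj_vec v)))"
    unfolding i_ddbar_im_form cnj_vec_J bil_scale by simp
  then show "i_ddbar im_form z v (J v) \<in> \<real>" "0 < Re (i_ddbar im_form z v (J v))"
    using bil_self_conj_pos[OF \<open>v \<noteq> 0\<close>] by auto
next
  have db: "delbar (\<lambda>y. complex_of_real (im_form y)) x w = cnj (- \<i> * bil (shifted_im x) w)" for x w
  proof -
    have "((\<lambda>y. complex_of_real (im_form y)) has_derivative (\<lambda>v. of_real (2 * Re (- \<i> * bil (shifted_im x) v)))) (at x)"
      by (rule has_derivative_of_real[OF im_form_has_derivative])
    then have fd: "frechet_derivative (\<lambda>y. complex_of_real (im_form y)) (at x) = (\<lambda>v. of_real (2 * Re (- \<i> * bil (shifted_im x) v)))"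
      by (rule frechet_derivative_at[symmetric])
    show ?thesis unfolding delbar_def fd bil_J by (simp add: complex_eq_iff)
  qed
  have dd: "del (\<lambda>y. delbar (\<lambda>y. complex_of_real (im_form y)) y w) x v = bil v (cnj_vec w) / 2" for x v w
    unfolding db del_def frechet_derivative_at[OF cnj_del_im_form_has_derivative, symmetric]
    by (rule del_delbar_im_form)
  show "i_ddbar (\<lambda>x. ln (Re (det (\<chi> j k. del (\<lambda>y. delbar (\<lambda>y. complex_of_real (im_form y)) y (axis k 1)) x (axis j 1))))) z v w = 0"
    for z v w :: "complex^'n"
    unfolding dd by (rule i_ddbar_const)
qed

lemma bundle_metric_h: "bundle_metric \<Gamma> e h"
  by (simp add: bundle_metric_def h_eq sq_norm_act)

lemma calabi_ansatz_unfold: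
  "calabi_ansatz_metric \<Gamma> e h g \<longleftrightarrow> quotient_metric_on \<Gamma> e (disc_bundle \<Gamma> e h 0) g \<and>
     (\<forall>p\<in>punctured_disc. \<forall>v w. kaehler_form g p v w = kaehler_form cusp_metric p v w)"
proof -
  have "kaehler_form cusp_metric p v w = pullback snd (i_ddbar im_form) p v w +
      i_ddbar (\<lambda>x. calabi_potential CARD('n) (ln (sq_norm h x))) p v w" if "p \<in> punctured_disc" for p v w
    using that by (intro cusp_metric_calabi) (auto simp: ln_sq_norm)
  then show ?thesis
    unfolding calabi_ansatz_metric_def ln_h preim_disc_bundle
    using bundle_metric_h im_form_ricci_flat by auto
qed

theorem bergman_type_eq_calabi_ansatz:
  "(\<exists>g. bergman_type_metric \<Gamma> e h g) \<and> (\<exists>\<omega>. calabi_ansatz_metric \<Gamma> e h \<omega>) \<and>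
    (\<forall>g \<omega>. bergman_type_metric \<Gamma> e h g \<and> calabi_ansatz_metric \<Gamma> e h \<omega> \<longrightarrow>
      (\<forall>p\<in>preim \<Gamma> e (disc_bundle \<Gamma> e h 0). \<forall>v w.
         g p v w = \<omega> p v w \<and>
         kaehler_form g p v w =
           - (of_nat CARD('n) + 2) * i_ddbar (\<lambda>im_form. ln \<bar>ln (sq_norm h im_form)\<bar>) p v w))"
proof (intro conjI allI impI ballI)
  show "\<exists>g. bergman_type_metric \<Gamma> e h g" using cusp_metric_bergman_type by blast
  show "\<exists>\<omega>. calabi_ansatz_metric \<Gamma> e h \<omega>"
    using cusp_metric_quotient by (auto simp: calabi_ansatz_unfold)
  fix g \<omega> p v w
  assume a: "bergman_type_metric \<Gamma> e h g \<and> calabi_ansatz_metric \<Gamma> e h \<omega>"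
    and "p \<in> preim \<Gamma> e (disc_bundle \<Gamma> e h 0)"
  then have p: "p \<in> punctured_disc" by (simp add: preim_disc_bundle)
  have g: "g p v w = cusp_metric p v w" for v w
    using a p by (blast intro: bergman_type_metric_unique)
  have "\<omega> p v w = cusp_metric p v w"
    by (rule kaehler_form_eq_imp_eq) (use a p in \<open>unfold calabi_ansatz_unfold, blast\<close>)
  then show "g p v w = \<omega> p v w" by (simp add: g)
  have "kaehler_form g p v w = kaehler_form cusp_metric p v w" by (simp add: kaehler_form_def g)
  also have "\<dots> = - (of_nat CARD('n) + 2) * i_ddbar (\<lambda>im_form. ln \<bar>ln (sq_norm h im_form)\<bar>) p v w"
    using p by (intro i_ddbar_log_abs_log_norm) (auto simp: ln_sq_norm)
  finally show "kaehler_form g p v w = - (of_nat CARD('n) + 2) * i_ddbar (\<lambda>im_form. ln \<bar>ln (sq_norm h im_form)\<bar>) p v w" .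
qed

end

lemma lattice_induct:
  fixes b :: "'i::finite \<Rightarrow> 'a::euclidean_space"
  assumes basis: "lattice_basis \<Gamma> b" and \<gamma>: "\<gamma> \<in> \<Gamma>"
    and zero: "Q 0" and gen: "\<And>i. Q (b i)"
    and add: "\<And>x y. x \<in> \<Gamma> \<Longrightarrow> y \<in> \<Gamma> \<Longrightarrow> Q x \<Longrightarrow> Q y \<Longrightarrow> Q (x + y)"
    and minus: "\<And>x. x \<in> \<Gamma> \<Longrightarrow> - x \<in> \<Gamma> \<Longrightarrow> Q x \<Longrightarrow> Q (- x)"
  shows "Q \<gamma>"
proof -
  have \<Gamma>: "\<Gamma> = {\<Sum>i\<in>UNIV. real_of_int (k i) *\<^sub>R b i |k. True}"
    using basis by (simp add: lattice_basis_def)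
  have mem: "(\<Sum>i\<in>UNIV. real_of_int (k i) *\<^sub>R b i) \<in> \<Gamma>" for k unfolding \<Gamma> by blast
  have single: "real_of_int m *\<^sub>R b i \<in> \<Gamma>" for m i
  proof -
    have "(\<Sum>j\<in>UNIV. real_of_int (if j = i then m else 0) *\<^sub>R b j) = real_of_int m *\<^sub>R b i"
      by (subst sum.remove[of _ i]) (auto intro!: sum.neutral)
    then show ?thesis using mem[of "\<lambda>j. if j = i then m else 0"] by simp
  qed
  have nat: "Q (real_of_int (int n) *\<^sub>R b i)" for n i
  proof (induction n)
    case (Suc n)
    have "Q (b i + real_of_int (int n) *\<^sub>R b i)"
      using Suc gen single[of 1 i] single[of "int n" i] by (intro add) auto
    then show ?case by (simp add: algebra_simps)
  qed (simp add: zero)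
  have int: "Q (real_of_int m *\<^sub>R b i)" for m i
  proof (cases "0 \<le> m")
    case True
    then show ?thesis using nat[of "nat m" i] by simp
  next
    case False
    then obtain n where n: "m = - int n" by (metis int_cases2 of_nat_0_le_iff)
    have "Q (- (real_of_int (int n) *\<^sub>R b i))"
      using minus[OF single[of "int n" i] _ nat] single[of "- int n" i] by simp
    then show ?thesis by (simp add: n)
  qed
  have part: "(\<Sum>i\<in>I. real_of_int (k i) *\<^sub>R b i) \<in> \<Gamma>" for I k
  proof -
    have "(\<Sum>i\<in>UNIV. real_of_int (if i \<in> I then k i else 0) *\<^sub>R b i) = (\<Sum>i\<in>I. real_of_int (k i) *\<^sub>R b i)"
      by (rule sum.mono_neutral_cong_right) auto
    then show ?thesis using mem[of "\<lambda>i. if i \<in> I then k i else 0"] by simp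
  qed
  have "Q (\<Sum>i\<in>I. real_of_int (k i) *\<^sub>R b i)" for I k
  proof (induction I rule: infinite_finite_induct)
    case (insert x I)
    then show ?case using int single part by (simp add: add)
  qed (simp_all add: zero)
  then show ?thesis using \<gamma> unfolding \<Gamma> by blast
qed

lemma matrix_inv_positive:
  fixes Y :: "real^'n^'n"
  assumes sym: "transpose Y = Y" and pos: "\<forall>v. v \<noteq> 0 \<longrightarrow> 0 < v \<bullet> (Y *v v)"
  shows "matrix_inv Y ** Y = mat 1" "transpose (matrix_inv Y) = matrix_inv Y"
    "\<And>v. v \<noteq> 0 \<Longrightarrow> 0 < v \<bullet> (matrix_inv Y *v v)"
proof -
  have "\<forall>x. Y *v x = 0 \<longrightarrow> x = 0" using pos by (metis inner_zero_right less_irrefl)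
  then have inv: "invertible Y"
    unfolding invertible_left_inverse matrix_left_invertible_ker .
  then have both: "Y ** matrix_inv Y = mat 1 \<and> matrix_inv Y ** Y = mat 1"
    unfolding invertible_def matrix_inv_def by (rule someI_ex)
  then show l: "matrix_inv Y ** Y = mat 1" by blast
  have r: "Y ** matrix_inv Y = mat 1" using both by blast
  show t: "transpose (matrix_inv Y) = matrix_inv Y"
    by (metis l r sym matrix_mul_assoc matrix_mul_lid matrix_mul_rid matrix_transpose_mul transpose_mat)
  fix v :: "real^'n" assume v: "v \<noteq> 0"
  let ?x = "matrix_inv Y *v v"
  have Yx: "Y *v ?x = v" by (simp add: matrix_vector_mul_assoc r)
  then have "?x \<noteq> 0" using v by auto
  then have "0 < ?x \<bullet> (Y *v ?x)" using pos by blast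
  then show "0 < v \<bullet> ?x" by (simp add: Yx inner_commute)
qed

theorem proposition3p1:
  fixes \<Gamma> :: "(complex^'n) set"
    and e :: "'n factor"
    and lam :: "'n + 'n \<Rightarrow> complex^'n"
    and \<delta> :: "'n \<Rightarrow> nat"
    and X Y :: "real^'n^'n"
    and t :: "complex^'n"
    and h :: "complex^'n \<Rightarrow> real"
  assumes basis: "lattice_basis \<Gamma> lam"
    and automorphy: "factor_of_automorphy \<Gamma> e"
    and negative: "negative_bundle \<Gamma> e"
    and delta_pos: "\<forall>\<alpha>. 0 < \<delta> \<alpha>"
    and chern: "\<forall>i j. c1_pairing e (lam i) (lam j) (elementary_form \<delta> i j)"
    and period_left: "\<forall>\<alpha>. lam (Inl \<alpha>) = axis \<alpha> (of_nat (\<delta> \<alpha>))"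
    and period_right: "\<forall>\<alpha> \<beta>. lam (Inr \<alpha>) $ \<beta> = of_real (X $ \<beta> $ \<alpha>) - \<i> * of_real (Y $ \<beta> $ \<alpha>)"
    and sym: "transpose X = X" "transpose Y = Y"
    and pos_def: "\<forall>v. v \<noteq> 0 \<longrightarrow> 0 < v \<bullet> (Y *v v)"
    and factor_left: "\<forall>\<alpha> z. e (lam (Inl \<alpha>)) z = 1"
    and factor_right: "\<forall>\<alpha> z. e (lam (Inr \<alpha>)) z = exp (- 2 * of_real pi * \<i> * (z $ \<alpha> - t $ \<alpha>))"
    and h: "h = theta_metric Y t"
  shows "(\<exists>g. bergman_type_metric \<Gamma> e h g) \<and> (\<exists>\<omega>. calabi_ansatz_metric \<Gamma> e h \<omega>) \<and>
    (\<forall>g \<omega>. bergman_type_metric \<Gamma> e h g \<and> calabi_ansatz_metric \<Gamma> e h \<omega> \<longrightarrow>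
      (\<forall>p\<in>preim \<Gamma> e (disc_bundle \<Gamma> e h 0). \<forall>v w.
         g p v w = \<omega> p v w \<and>
         kaehler_form g p v w =
           - (of_nat CARD('n) + 2) * i_ddbar (\<lambda>q. ln \<bar>ln (sq_norm h q)\<bar>) p v w))"
proof -
  define W where "W = matrix_inv Y"
  define P where "P = (2 * pi) *\<^sub>R W"
  define c where "c = (\<chi> i. Y $ i $ i / 2 - Im (t $ i))"
  have P_ij: "P $ i $ j = 2 * pi * W $ i $ j" for i j by (simp add: P_def)
  have c_i: "c $ i = Y $ i $ i / 2 - Im (t $ i)" for i by (simp add: c_def)
  note W = matrix_inv_positive[OF sym(2) pos_def, folded W_def]
  have W_sym: "W $ i $ j = W $ j $ i" for i j
    using arg_cong[OF W(2), of "\<lambda>M. M $ j $ i"] by (simp add: transpose_def)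
  interpret positive_form P c
  proof
    show "P $ i $ j = P $ j $ i" for i j unfolding P_ij by (subst W_sym) (rule refl)
    show "0 < (\<Sum>i\<in>UNIV. \<Sum>j\<in>UNIV. P $ i $ j * (v $ i * v $ j))" if "v \<noteq> 0" for v
    proof -
      have "(\<Sum>i\<in>UNIV. \<Sum>j\<in>UNIV. P $ i $ j * (v $ i * v $ j)) = 2 * pi * (v \<bullet> (W *v v))"
        unfolding inner_vec_def matrix_vector_mult_def vec_lambda_beta inner_real_def sum_distrib_left P_ij
        by (intro sum.cong refl) simp
      then show ?thesis using W(3)[OF that] by simp
    qed
  qed
  have h_im_form: "h z = exp (im_form z)" for z
  proof -
    let ?c = "\<lambda>\<alpha>. z $ \<alpha> - cnj (z $ \<alpha>) + \<i> * of_real (Y $ \<alpha> $ \<alpha>) - t $ \<alpha> + cnj (t $ \<alpha>)"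
    \<comment> \<open>The factors in the exponent are \<open>2 \<i>\<close> times real numbers, which accounts for the sign.\<close>
    have c_eq: "?c \<alpha> = 2 * \<i> * shifted_im z $ \<alpha>" for \<alpha>
      by (simp add: shifted_im_def im_vec_def c_i complex_eq_iff)
    have "(\<Sum>\<alpha>\<in>UNIV. \<Sum>\<beta>\<in>UNIV. of_real (W $ \<alpha> $ \<beta>) * ?c \<alpha> * ?c \<beta>) =
        - (2 / of_real pi) * bil (shifted_im z) (shifted_im z)"
      unfolding c_eq bil_def sum_distrib_left
      by (intro sum.cong refl) (simp add: P_ij)
    then have "- (pi / 2) * Re (\<Sum>\<alpha>\<in>UNIV. \<Sum>\<beta>\<in>UNIV. of_real (W $ \<alpha> $ \<beta>) * ?c \<alpha> * ?c \<beta>) = im_form z"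
      by (simp add: im_form_def)
    then show ?thesis unfolding h theta_metric_def Let_def W_def by simp
  qed
  define inv where "inv \<gamma> \<longleftrightarrow> (\<forall>z. (cmod (e \<gamma> z))\<^sup>2 * h (z + \<gamma>) = h z)" for \<gamma>
  have sums: "\<Gamma> = {\<Sum>i\<in>UNIV. real_of_int (k i) *\<^sub>R lam i |k. True}"
    using basis by (simp add: lattice_basis_def)
  have zero: "0 \<in> \<Gamma>"
  proof -
    have "(\<Sum>i\<in>UNIV. real_of_int 0 *\<^sub>R lam i) = 0" by simp
    then show ?thesis unfolding sums by (intro CollectI exI[of _ "\<lambda>_. 0"]) simp
  qed
  have cocycle: "e (\<gamma> + \<mu>) z = e \<gamma> (z + \<mu>) * e \<mu> z" if "\<gamma> \<in> \<Gamma>" "\<mu> \<in> \<Gamma>" for \<gamma> \<mu> z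
    using automorphy that unfolding factor_of_automorphy_def by blast
  have e0: "e 0 z = 1" for z
  proof -
    have "e 0 z \<noteq> 0" using automorphy zero unfolding factor_of_automorphy_def by blast
    then show ?thesis using cocycle[OF zero zero, of z] by simp
  qed
  have inv_left: "inv (lam (Inl \<alpha>))" for \<alpha>
  proof -
    have "im_vec (lam (Inl \<alpha>)) = 0"
      by (simp add: period_left im_vec_def vec_eq_iff axis_def)
    then have "im_form (z + lam (Inl \<alpha>)) = im_form z" for z unfolding im_form_def shifted_im_add by simp
    then show ?thesis unfolding inv_def using factor_left by (simp add: h_im_form)
  qed
  have inv_right: "inv (lam (Inr \<alpha>))" for \<alpha>
    unfolding inv_def
  proof
    fix z
    let ?y = "\<chi> i. complex_of_real (Y $ i $ \<alpha>)"
    \<comment> \<open>Translation by this period moves the imaginary part by a column of \<open>- Y\<close>, which \<open>W\<close> turns into a unit vector.\<close>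
    have im: "im_vec (lam (Inr \<alpha>)) = (- 1) *s ?y"
      by (simp add: im_vec_def vec_eq_iff period_right)
    have bilY: "bil v ?y = 2 * of_real pi * v $ \<alpha>" for v
    proof -
      have WY: "(\<Sum>j\<in>UNIV. W $ i $ j * Y $ j $ \<alpha>) = (if i = \<alpha> then 1 else 0)" for i
        using arg_cong[OF W(1), of "\<lambda>M. M $ i $ \<alpha>"] by (simp add: matrix_matrix_mult_def mat_def)
      have "bil v ?y = (\<Sum>i\<in>UNIV. 2 * of_real pi * v $ i * of_real (\<Sum>j\<in>UNIV. W $ i $ j * Y $ j $ \<alpha>))"
        unfolding bil_def of_real_sum sum_distrib_left by (intro sum.cong refl) (simp add: P_ij)
      also have "\<dots> = 2 * of_real pi * v $ \<alpha>"
        unfolding WY by (simp add: if_distrib[of of_real] if_distrib[of "\<lambda>x. _ * x"] cong: if_cong)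
      finally show ?thesis .
    qed
    have "im_form (z + lam (Inr \<alpha>)) = Re (bil (shifted_im z) (shifted_im z) - 2 * bil (shifted_im z) ?y + bil ?y ?y)"
      unfolding im_form_def shifted_im_add im bil_add bil_scale bil_commute[of ?y "shifted_im z"] by simp
    also have "\<dots> = im_form z - 4 * pi * Im (z $ \<alpha> - t $ \<alpha>)"
      unfolding bilY by (simp add: im_form_def shifted_im_def im_vec_def c_i algebra_simps)
    finally have shift: "im_form (z + lam (Inr \<alpha>)) = im_form z - 4 * pi * Im (z $ \<alpha> - t $ \<alpha>)" .
    have "(cmod (e (lam (Inr \<alpha>)) z))\<^sup>2 = exp (4 * pi * Im (z $ \<alpha> - t $ \<alpha>))"
      using factor_right by (simp add: power2_eq_square exp_add[symmetric])
    then show "(cmod (e (lam (Inr \<alpha>)) z))\<^sup>2 * h (z + lam (Inr \<alpha>)) = h z"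
      by (simp add: h_im_form shift exp_add[symmetric])
  qed
  have inv: "inv \<gamma>" if "\<gamma> \<in> \<Gamma>" for \<gamma>
  proof (rule lattice_induct[OF basis that])
    show "inv 0" by (simp add: inv_def e0)
    show "inv (lam i)" for i using inv_left inv_right by (cases i) auto
    show "inv (x + y)" if "x \<in> \<Gamma>" "y \<in> \<Gamma>" "inv x" "inv y" for x y
      unfolding inv_def
    proof
      fix z
      have "(cmod (e (x + y) z))\<^sup>2 * h (z + (x + y)) = (cmod (e y z))\<^sup>2 * ((cmod (e x (z + y)))\<^sup>2 * h ((z + y) + x))"
        by (simp add: cocycle[OF that(1,2)] norm_mult power_mult_distrib add_ac mult_ac)
      then show "(cmod (e (x + y) z))\<^sup>2 * h (z + (x + y)) = h z"
        using that(3,4) by (simp add: inv_def)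
    qed
    show "inv (- x)" if "x \<in> \<Gamma>" "- x \<in> \<Gamma>" "inv x" for x
      unfolding inv_def
    proof
      fix z
      have "e (- x) z * e x (z - x) = 1"
        using cocycle[OF that(2,1), of "z - x"] by (simp add: e0)
      then have 1: "(cmod (e (- x) z))\<^sup>2 * (cmod (e x (z - x)))\<^sup>2 = 1"
        by (metis norm_mult norm_one power_mult_distrib power_one)
      have "(cmod (e x (z - x)))\<^sup>2 * h z = h (z - x)"
        using that(3)[unfolded inv_def, rule_format, of "z - x"] by simp
      then show "(cmod (e (- x) z))\<^sup>2 * h (z + - x) = h z"
        using 1 by (metis diff_conv_add_uminus mult.assoc mult_1)
    qed
  qed
  interpret cusp_bundle P c \<Gamma> e h
  proof
    show "holo_on UNIV (e \<gamma>)" if "\<gamma> \<in> \<Gamma>" for \<gamma>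
      using automorphy that unfolding factor_of_automorphy_def by blast
    show "(cmod (e \<gamma> z))\<^sup>2 * h (z + \<gamma>) = h z" if "\<gamma> \<in> \<Gamma>" for \<gamma> z
      using inv[OF that] by (simp add: inv_def)
  qed (simp_all add: h_im_form zero e0)
  show ?thesis by (rule bergman_type_eq_calabi_ansatz)
qed

end
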